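(* Let $\mathsf K\subseteq[n-1]$, $w=w_0w_0^{\mathsf K}$, and let $\mathbf i=(i_r,\dots,i_1)$ be a reduced word of $w$ of the form $I_m\cdots I_1$ (concatenation), where each $I_i$ is an interval word starting with $a_i$ and ending with $b_i$, and for every $i>1$ one has $b_i\notin\bigcup_{j<i}I_j$ while $I_i\setminus\{b_i\}\subseteq\bigcup_{j<i}I_j$ (viewing words as sets of letters). Then the module $M_{\mathbf i,k}$ has a simple top for every $1\le k\le r$.
   Context: Fix an integer $n>1$; $[n-1]=\{1,\dots,n-1\}$. $W=S_n$ is the Weyl group of $\mathrm{GL}_n$ with simple reflections $\sigma_i$, $i\in[n-1]$; $w_0$ and $w_0^{\mathsf K}$ are the longest elements of $W$ and of the subgroup generated by $\sigma_i$, $i\in\mathsf K$. A word $\mathbf i=(i_r,\dots,i_1)$ with letters in $[n-1]$ represents $\sigma_{i_r}\cdots\sigma_{i_1}$ and is reduced if $r$ is the length of this element. An interval word starting with $a$ and ending with $b$ is $(a,a+1,\dots,b)$ if $a\le b$ and $(a,a-1,\dots,b)$ if $a\ge b$. $\Pi$ is the preprojective algebra over $\mathbb C$ of type $\mathbb A_{n-1}$ with vertices $1,\dots,n-1$; $S_j$ is the simple and $R_j$ the indecomposable injective $\Pi$-module with socle $S_j$. For a $\Pi$-module $M$, $\operatorname{soc}_{(j_1)}M$ is the trace of $S_{j_1}$ in $M$ (sum of all submodules isomorphic to $S_{j_1}$), and $\operatorname{soc}_{(j_1,\dots,j_s)}M$ is the preimage in $M$ of the trace of $S_{j_s}$ in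 $M/\operatorname{soc}_{(j_1,\dots,j_{s-1})}M$. Put $V_{\mathbf i,0}=0$ and $V_{\mathbf i,k}=\operatorname{soc}_{(i_k,i_{k-1},\dots,i_1)}R_{i_k}$ for $1\le k\le r$. Let $k^-=\max(\{0\}\cup\{s:s<k,\ i_s=i_k\})$; there is an embedding $V_{\mathbf i,k^-}\subseteq V_{\mathbf i,k}$ and $M_{\mathbf i,k}=V_{\mathbf i,k}/V_{\mathbf i,k^-}$. *)

theory Defs
  imports "HOL-Algebra.Module" "HOL-Algebra.QuotRing" "HOL-Algebra.Sym_Groups" Complex_Main
begin

section \<open>Left modules over a ring\<close>

text \<open>The library locale \<^locale>\<open>module\<close> is restricted to commutative rings. Here are left modules
  over an arbitrary unital ring, on the same record type (of which the fields \<open>mult\<close> and \<open>one\<close>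
  play no role). The library locale \<^locale>\<open>submodule\<close> does not depend on commutativity.\<close>

locale lmodule = R?: ring R + M?: abelian_group M
    for R :: "('a, 'x) ring_scheme" (structure) and M :: "('a, 'b, 'y) module_scheme" (structure) +
  assumes smult_closed [simp, intro]:
      "\<lbrakk>a \<in> carrier R; x \<in> carrier M\<rbrakk> \<Longrightarrow> a \<odot>\<^bsub>M\<^esub> x \<in> carrier M"
    and smult_l_distr:
      "\<lbrakk>a \<in> carrier R; b \<in> carrier R; x \<in> carrier M\<rbrakk> \<Longrightarrow>
        (a \<oplus>\<^bsub>R\<^esub> b) \<odot>\<^bsub>M\<^esub> x = a \<odot>\<^bsub>M\<^esub> x \<oplus>\<^bsub>M\<^esub> b \<odot>\<^bsub>M\<^esub> x"
    and smult_r_distr: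
      "\<lbrakk>a \<in> carrier R; x \<in> carrier M; y \<in> carrier M\<rbrakk> \<Longrightarrow>
        a \<odot>\<^bsub>M\<^esub> (x \<oplus>\<^bsub>M\<^esub> y) = a \<odot>\<^bsub>M\<^esub> x \<oplus>\<^bsub>M\<^esub> a \<odot>\<^bsub>M\<^esub> y"
    and smult_assoc1:
      "\<lbrakk>a \<in> carrier R; b \<in> carrier R; x \<in> carrier M\<rbrakk> \<Longrightarrow>
        (a \<otimes>\<^bsub>R\<^esub> b) \<odot>\<^bsub>M\<^esub> x = a \<odot>\<^bsub>M\<^esub> (b \<odot>\<^bsub>M\<^esub> x)"
    and smult_one [simp]:
      "x \<in> carrier M \<Longrightarrow> \<one>\<^bsub>R\<^esub> \<odot>\<^bsub>M\<^esub> x = x"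

definition lmod_hom ::
    "('a, 'x) ring_scheme \<Rightarrow> ('a, 'b, 'y) module_scheme \<Rightarrow> ('a, 'c, 'z) module_scheme \<Rightarrow> ('b \<Rightarrow> 'c) set"
  where "lmod_hom R M N =
    {f \<in> carrier M \<rightarrow> carrier N.
      (\<forall>x\<in>carrier M. \<forall>y\<in>carrier M. f (x \<oplus>\<^bsub>M\<^esub> y) = f x \<oplus>\<^bsub>N\<^esub> f y) \<and>
      (\<forall>r\<in>carrier R. \<forall>x\<in>carrier M. f (r \<odot>\<^bsub>M\<^esub> x) = r \<odot>\<^bsub>N\<^esub> f x)}"

definition lmod_iso ::
    "('a, 'x) ring_scheme \<Rightarrow> ('a, 'b, 'y) module_scheme \<Rightarrow> ('a, 'c, 'z) module_scheme \<Rightarrow> bool"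
  where "lmod_iso R M N \<longleftrightarrow> (\<exists>f\<in>lmod_hom R M N. bij_betw f (carrier M) (carrier N))"

abbreviation sub_lmod :: "('a, 'b, 'y) module_scheme \<Rightarrow> 'b set \<Rightarrow> ('a, 'b, 'y) module_scheme"
  where "sub_lmod M N \<equiv> M\<lparr>carrier := N\<rparr>"

definition quot_lmod :: "('a, 'b, 'y) module_scheme \<Rightarrow> 'b set \<Rightarrow> ('a, 'b set) module"
  where "quot_lmod M N =
    \<lparr>carrier = a_rcosets\<^bsub>M\<^esub> N, monoid.mult = undefined, one = undefined, zero = N, add = set_add M,
      smult = (\<lambda>r C. \<Union>x\<in>C. N +>\<^bsub>M\<^esub> (r \<odot>\<^bsub>M\<^esub> x))\<rparr>"

definition simple_lmod :: "('a, 'x) ring_scheme \<Rightarrow> ('a, 'b, 'y) module_scheme \<Rightarrow> bool"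
  where "simple_lmod R M \<longleftrightarrow> lmodule R M \<and> carrier M \<noteq> {\<zero>\<^bsub>M\<^esub>} \<and>
    (\<forall>N. submodule N R M \<longrightarrow> N = {\<zero>\<^bsub>M\<^esub>} \<or> N = carrier M)"

definition indecomposable_lmod :: "('a, 'x) ring_scheme \<Rightarrow> ('a, 'b, 'y) module_scheme \<Rightarrow> bool"
  where "indecomposable_lmod R M \<longleftrightarrow> lmodule R M \<and> carrier M \<noteq> {\<zero>\<^bsub>M\<^esub>} \<and>
    (\<forall>A B. submodule A R M \<and> submodule B R M \<and> A \<inter> B = {\<zero>\<^bsub>M\<^esub>} \<and> A <+>\<^bsub>M\<^esub> B = carrier M \<longrightarrow>
      A = {\<zero>\<^bsub>M\<^esub>} \<or> B = {\<zero>\<^bsub>M\<^esub>})"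

text \<open>A definition cannot quantify over types, so the test modules \<open>A\<close>, \<open>B\<close> in the definition of
  injectivity have elements of the same type as the ring. This is no restriction: by Baer's
  criterion the inclusions of the left ideals of \<open>R\<close> into \<open>R\<close> already detect injectivity.\<close>

definition injective_lmod :: "('a, 'x) ring_scheme \<Rightarrow> ('a, 'b, 'y) module_scheme \<Rightarrow> bool"
  where "injective_lmod R E \<longleftrightarrow> lmodule R E \<and>
    (\<forall>(A :: ('a, 'a) module) (B :: ('a, 'a) module) f g.
      lmodule R A \<and> lmodule R B \<and> f \<in> lmod_hom R A B \<and> inj_on f (carrier A) \<and> g \<in> lmod_hom R A E \<longrightarrow>
      (\<exists>h\<in>lmod_hom R B E. \<forall>x\<in>carrier A. h (f x) = g x))"

text \<open>The sum of a family of submodules, as the smallest submodule containing all of them.\<close>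

definition sum_submodules :: "('a, 'x) ring_scheme \<Rightarrow> ('a, 'b, 'y) module_scheme \<Rightarrow> 'b set set \<Rightarrow> 'b set"
  where "sum_submodules R M F = \<Inter>{N. submodule N R M \<and> \<Union>F \<subseteq> N}"

definition socle :: "('a, 'x) ring_scheme \<Rightarrow> ('a, 'b, 'y) module_scheme \<Rightarrow> 'b set"
  where "socle R M = sum_submodules R M {N. submodule N R M \<and> simple_lmod R (sub_lmod M N)}"

definition trace_simple ::
    "('a, 'x) ring_scheme \<Rightarrow> ('a, 'c, 'z) module_scheme \<Rightarrow> ('a, 'b, 'y) module_scheme \<Rightarrow> 'b set"
  where "trace_simple R S M = sum_submodules R M {N. submodule N R M \<and> lmod_iso R (sub_lmod M N) S}"

definition maximal_submodule :: "'b set \<Rightarrow> ('a, 'x) ring_scheme \<Rightarrow> ('a, 'b, 'y) module_scheme \<Rightarrow> bool"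
  where "maximal_submodule N R M \<longleftrightarrow> submodule N R M \<and> N \<noteq> carrier M \<and>
    (\<forall>N'. submodule N' R M \<and> N \<subseteq> N' \<longrightarrow> N' = N \<or> N' = carrier M)"

definition radical :: "('a, 'x) ring_scheme \<Rightarrow> ('a, 'b, 'y) module_scheme \<Rightarrow> 'b set"
  where "radical R M = {x \<in> carrier M. \<forall>N. maximal_submodule N R M \<longrightarrow> x \<in> N}"

definition top_lmod :: "('a, 'x) ring_scheme \<Rightarrow> ('a, 'b, 'y) module_scheme \<Rightarrow> ('a, 'b set) module"
  where "top_lmod R M = quot_lmod M (radical R M)"


section \<open>The preprojective algebra of type A\<close>

text \<open>The double quiver of type \<open>A\<^sub>n\<^sub>-\<^sub>1\<close> has vertices \<open>1, \<dots>, n - 1\<close> and exactly one arrow in each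
  direction between \<open>i\<close> and \<open>i + 1\<close>. So a path is determined by the nonempty list of the vertices it
  visits. The list is written from right to left: its last entry is the source of the path and its
  head is the target, and the product \<open>p q\<close> is ``first \<open>q\<close>, then \<open>p\<close>''. In particular \<open>[i]\<close> is the
  trivial path at \<open>i\<close>, and \<open>[i + 1, i]\<close> is the arrow from \<open>i\<close> to \<open>i + 1\<close>.\<close>

definition quiver_paths :: "nat \<Rightarrow> nat list set"
  where "quiver_paths n = {p. p \<noteq> [] \<and> set p \<subseteq> {1..<n} \<and>
    (\<forall>k. Suc k < length p \<longrightarrow> p ! Suc k = Suc (p ! k) \<or> p ! k = Suc (p ! Suc k))}"

text \<open>Elements of the path algebra are finitely supported functions on paths. A path \<open>p\<close> factors
  as a product of two paths exactly once for each position \<open>k\<close> at which it is cut.\<close>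

definition path_algebra :: "nat \<Rightarrow> (nat list \<Rightarrow> complex) ring"
  where "path_algebra n =
    \<lparr>carrier = {f. finite {p. f p \<noteq> 0} \<and> {p. f p \<noteq> 0} \<subseteq> quiver_paths n},
      monoid.mult = (\<lambda>f g p. \<Sum>k<length p. f (take (Suc k) p) * g (drop k p)),
      one = (\<lambda>p. if \<exists>i\<in>{1..<n}. p = [i] then 1 else 0),
      zero = (\<lambda>p. 0),
      add = (\<lambda>f g p. f p + g p)\<rparr>"

definition path_elem :: "nat list \<Rightarrow> nat list \<Rightarrow> complex"
  where "path_elem p = (\<lambda>q. if q = p then 1 else 0)"

text \<open>With \<open>a i\<close> the arrow from \<open>i\<close> to \<open>i + 1\<close> and \<open>a' i\<close> the opposite arrow, this is the sum over
  \<open>1 \<le> i \<le> n - 2\<close> of \<open>a' i * a i - a i * a' i\<close>.\<close>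

definition preprojective_relation :: "nat \<Rightarrow> nat list \<Rightarrow> complex"
  where "preprojective_relation n =
    (\<lambda>p. \<Sum>i\<in>{1..<n - 1}. path_elem [i, Suc i, i] p - path_elem [Suc i, i, Suc i] p)"

definition preprojective_algebra :: "nat \<Rightarrow> (nat list \<Rightarrow> complex) set ring"
  where "preprojective_algebra n =
    path_algebra n Quot (Idl\<^bsub>path_algebra n\<^esub> {preprojective_relation n})"

text \<open>The simple module at the vertex \<open>j\<close>: the trivial path at \<open>j\<close> acts on \<open>\<complex>\<close> as the identity, all
  other paths act as \<open>0\<close>. The coefficient of a representative at the trivial path does not depend on
  the representative, since the relation is a combination of paths of length 2.\<close>

definition simple_at :: "nat \<Rightarrow> ((nat list \<Rightarrow> complex) set, complex) module"
  where "simple_at j =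
    \<lparr>carrier = UNIV, monoid.mult = undefined, one = undefined, zero = 0, add = (+),
      smult = (\<lambda>C c. (SOME f. f \<in> C) [j] * c)\<rparr>"

definition soc_preimage ::
    "nat \<Rightarrow> ((nat list \<Rightarrow> complex) set, 'b, 'y) module_scheme \<Rightarrow> 'b set \<Rightarrow> nat \<Rightarrow> 'b set"
  where "soc_preimage n M N j =
    {x \<in> carrier M. N +>\<^bsub>M\<^esub> x \<in> trace_simple (preprojective_algebra n) (simple_at j) (quot_lmod M N)}"

text \<open>The submodule \<open>soc\<^sub>(\<^sub>j\<^sub>1\<^sub>,\<^sub>\<dots>\<^sub>,\<^sub>j\<^sub>s\<^sub>) M\<close> for \<open>js = [j\<^sub>1, \<dots>, j\<^sub>s]\<close>; it is \<open>0\<close> for \<open>js = []\<close>.\<close>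

definition soc_seq ::
    "nat \<Rightarrow> ((nat list \<Rightarrow> complex) set, 'b, 'y) module_scheme \<Rightarrow> nat list \<Rightarrow> 'b set"
  where "soc_seq n M js = foldl (soc_preimage n M) {\<zero>\<^bsub>M\<^esub>} js"


section \<open>Words in the symmetric group\<close>

text \<open>A word \<open>(i\<^sub>r, \<dots>, i\<^sub>1)\<close> is the list \<open>[i\<^sub>r, \<dots>, i\<^sub>1]\<close> in the order in which it is written.\<close>

definition word_perm :: "nat list \<Rightarrow> nat \<Rightarrow> nat"
  where "word_perm ws = foldr (\<lambda>i p. Transposition.transpose i (Suc i) \<circ> p) ws id"

definition weyl_length :: "nat \<Rightarrow> (nat \<Rightarrow> nat) \<Rightarrow> nat"
  where "weyl_length n p = (LEAST l. \<exists>ws. set ws \<subseteq> {1..<n} \<and> word_perm ws = p \<and> length ws = l)"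

definition is_reduced_word_of :: "nat \<Rightarrow> nat list \<Rightarrow> (nat \<Rightarrow> nat) \<Rightarrow> bool"
  where "is_reduced_word_of n ws p \<longleftrightarrow>
    set ws \<subseteq> {1..<n} \<and> word_perm ws = p \<and> length ws = weyl_length n p"

definition parabolic :: "nat \<Rightarrow> nat set \<Rightarrow> (nat \<Rightarrow> nat) set"
  where "parabolic n K = generate (sym_group n) ((\<lambda>i. Transposition.transpose i (Suc i)) ` K)"

definition longest_elem :: "nat \<Rightarrow> (nat \<Rightarrow> nat) set \<Rightarrow> nat \<Rightarrow> nat"
  where "longest_elem n G = (ARG_MAX (weyl_length n) p. p \<in> G)"

definition interval_word :: "nat \<Rightarrow> nat \<Rightarrow> nat list"
  where "interval_word a b = (if a \<le> b then [a..<Suc b] else rev [b..<Suc a])"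


section \<open>The modules attached to a word\<close>

definition letter :: "nat list \<Rightarrow> nat \<Rightarrow> nat"
  where "letter ws k = ws ! (length ws - k)"

definition prev_pos :: "nat list \<Rightarrow> nat \<Rightarrow> nat"
  where "prev_pos ws k = Max ({0} \<union> {s. 1 \<le> s \<and> s < k \<and> letter ws s = letter ws k})"

text \<open>For \<open>ws = [i\<^sub>r, \<dots>, i\<^sub>1]\<close> the list \<open>drop (length ws - k) ws\<close> is \<open>[i\<^sub>k, \<dots>, i\<^sub>1]\<close>. So for
  \<open>k \<ge> 1\<close> and \<open>Q = R\<^bsub>i\<^sub>k\<^esub>\<close> this is \<open>V\<^bsub>i,k\<^esub>\<close>, and for \<open>k = 0\<close> it is the zero submodule of \<open>Q\<close>.\<close>

definition V_sub ::
    "nat \<Rightarrow> ((nat list \<Rightarrow> complex) set, 'b, 'y) module_scheme \<Rightarrow> nat list \<Rightarrow> nat \<Rightarrow> 'b set"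
  where "V_sub n Q ws k = soc_seq n Q (drop (length ws - k) ws)"

text \<open>If \<open>k\<^sup>- > 0\<close>, then \<open>i\<^sub>k\<close> and \<open>i\<^bsub>k\<^sup>-\<^esub>\<close> agree, and the embedding of \<open>V\<^bsub>i,k\<^sup>-\<^esub>\<close> into \<open>V\<^bsub>i,k\<^esub>\<close> is
  the inclusion of submodules of \<open>R\<^bsub>i\<^sub>k\<^esub>\<close>.\<close>

definition M_mod ::
    "nat \<Rightarrow> (nat \<Rightarrow> ((nat list \<Rightarrow> complex) set, 'b) module) \<Rightarrow> nat list \<Rightarrow> nat \<Rightarrow>
      ((nat list \<Rightarrow> complex) set, 'b set) module"
  where "M_mod n R ws k =
    (let Q = R (letter ws k) in quot_lmod (sub_lmod Q (V_sub n Q ws k)) (V_sub n Q ws (prev_pos ws k)))"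


section \<open>The preprojective algebra is a ring, and the simple modules are modules over it\<close>

lemma path_algebra_simps:
  "f \<in> carrier (path_algebra n) \<longleftrightarrow> finite {p. f p \<noteq> 0} \<and> {p. f p \<noteq> 0} \<subseteq> quiver_paths n"
  "f \<otimes>\<^bsub>path_algebra n\<^esub> g = (\<lambda>p. \<Sum>k<length p. f (take (Suc k) p) * g (drop k p))"
  "\<one>\<^bsub>path_algebra n\<^esub> = (\<lambda>p. if \<exists>i\<in>{1..<n}. p = [i] then 1 else 0)"
  "\<zero>\<^bsub>path_algebra n\<^esub> = (\<lambda>p. 0)"
  "f \<oplus>\<^bsub>path_algebra n\<^esub> g = (\<lambda>p. f p + g p)"
  by (auto simp: path_algebra_def)

lemma path_glue:
  assumes "take (Suc k) p \<in> quiver_paths n" "drop k p \<in> quiver_paths n" "k < length p"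
  shows "p \<in> quiver_paths n"
proof -
  have "p ! Suc j = Suc (p ! j) \<or> p ! j = Suc (p ! Suc j)" if "Suc j < length p" for j
  proof (cases "j < k")
    case True
    then show ?thesis using assms(1,3) that unfolding quiver_paths_def
      by (auto dest!: spec[of _ j])
  next
    case False
    then show ?thesis using assms(2,3) that unfolding quiver_paths_def
      by (auto dest!: spec[of _ "j - k"])
  qed
  moreover have "set p \<subseteq> set (take (Suc k) p) \<union> set (drop k p)"
  proof
    fix x assume "x \<in> set p"
    then have "x \<in> set (take k p) \<union> set (drop k p)" by (metis append_take_drop_id set_append)
    then show "x \<in> set (take (Suc k) p) \<union> set (drop k p)"
      using set_take_subset_set_take[of k "Suc k" p] by auto
  qed
  ultimately show ?thesis using assms unfolding quiver_paths_def by force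
qed

lemma path_algebra_off_paths: "f \<in> carrier (path_algebra n) \<Longrightarrow> p \<notin> quiver_paths n \<Longrightarrow> f p = 0"
  unfolding path_algebra_simps(1) by auto

lemma path_algebra_mult_closed:
  assumes "f \<in> carrier (path_algebra n)" "g \<in> carrier (path_algebra n)"
  shows "f \<otimes>\<^bsub>path_algebra n\<^esub> g \<in> carrier (path_algebra n)"
proof -
  let ?h = "f \<otimes>\<^bsub>path_algebra n\<^esub> g"
  have *: "\<exists>k<length p. f (take (Suc k) p) \<noteq> 0 \<and> g (drop k p) \<noteq> 0" if "?h p \<noteq> 0" for p
  proof (rule ccontr)
    assume "\<not> ?thesis"
    then have "\<forall>k\<in>{..<length p}. f (take (Suc k) p) * g (drop k p) = 0" by auto
    then have "?h p = 0" unfolding path_algebra_simps by (rule sum.neutral)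
    with that show False by simp
  qed
  have "{p. ?h p \<noteq> 0} \<subseteq> (\<lambda>(u, v). u @ tl v) ` ({p. f p \<noteq> 0} \<times> {p. g p \<noteq> 0})"
  proof
    fix p assume "p \<in> {p. ?h p \<noteq> 0}"
    then obtain k where k: "k < length p" "f (take (Suc k) p) \<noteq> 0" "g (drop k p) \<noteq> 0" using * by auto
    moreover have "p = take (Suc k) p @ tl (drop k p)"
      by (metis append_take_drop_id drop_Suc tl_drop)
    ultimately show "p \<in> (\<lambda>(u, v). u @ tl v) ` ({p. f p \<noteq> 0} \<times> {p. g p \<noteq> 0})"
      by (intro image_eqI[of _ _ "(take (Suc k) p, drop k p)"]) auto
  qed
  moreover have "finite ({p. f p \<noteq> 0} \<times> {p. g p \<noteq> 0})"
    using assms unfolding path_algebra_simps(1) by (intro finite_cartesian_product) simp_all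
  ultimately have "finite {p. ?h p \<noteq> 0}" using finite_subset finite_imageI by metis
  moreover have "{p. ?h p \<noteq> 0} \<subseteq> quiver_paths n"
  proof
    fix p assume "p \<in> {p. ?h p \<noteq> 0}"
    then obtain k where k: "k < length p" "f (take (Suc k) p) \<noteq> 0" "g (drop k p) \<noteq> 0" using * by auto
    show "p \<in> quiver_paths n"
    proof (rule path_glue[OF _ _ k(1)])
      show "take (Suc k) p \<in> quiver_paths n" using path_algebra_off_paths[OF assms(1)] k(2) by blast
      show "drop k p \<in> quiver_paths n" using path_algebra_off_paths[OF assms(2)] k(3) by blast
    qed
  qed
  ultimately show ?thesis unfolding path_algebra_simps(1) by simp
qed

lemma path_algebra_assoc: "(f \<otimes>\<^bsub>path_algebra n\<^esub> g) \<otimes>\<^bsub>path_algebra n\<^esub> h = f \<otimes>\<^bsub>path_algebra n\<^esub> (g \<otimes>\<^bsub>path_algebra n\<^esub> h)"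
proof
  fix p
  define F where "F l k = f (take (Suc l) p) * g (drop l (take (Suc k) p)) * h (drop k p)" for l k
  let ?n = "length p"
  have "((f \<otimes>\<^bsub>path_algebra n\<^esub> g) \<otimes>\<^bsub>path_algebra n\<^esub> h) p = (\<Sum>k<?n. \<Sum>l<Suc k. F l k)"
    unfolding path_algebra_simps F_def sum_distrib_right
    by (intro sum.cong refl) (auto simp: min_def)
  also have "\<dots> = (\<Sum>(k, l)\<in>(SIGMA k:{..<?n}. {..<Suc k}). F l k)"
    by (rule sum.Sigma) auto
  also have "\<dots> = (\<Sum>(l, k)\<in>(SIGMA l:{..<?n}. {..<?n - l}). F l (l + k))"
    by (rule sum.reindex_bij_witness[of _ "\<lambda>(l, k). (l + k, l)" "\<lambda>(k, l). (l, k - l)"]) auto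
  also have "\<dots> = (\<Sum>l<?n. \<Sum>k<?n - l. F l (l + k))"
    by (rule sum.Sigma[symmetric]) auto
  also have "\<dots> = (f \<otimes>\<^bsub>path_algebra n\<^esub> (g \<otimes>\<^bsub>path_algebra n\<^esub> h)) p"
    unfolding path_algebra_simps F_def sum_distrib_left
    by (intro sum.cong refl) (auto simp: mult.assoc add.commute drop_take)
  finally show "((f \<otimes>\<^bsub>path_algebra n\<^esub> g) \<otimes>\<^bsub>path_algebra n\<^esub> h) p = (f \<otimes>\<^bsub>path_algebra n\<^esub> (g \<otimes>\<^bsub>path_algebra n\<^esub> h)) p" .
qed

lemma path_algebra_one_closed: "\<one>\<^bsub>path_algebra n\<^esub> \<in> carrier (path_algebra n)"
  unfolding path_algebra_simps by (auto simp: quiver_paths_def intro!: finite_subset[of _ "(\<lambda>i. [i]) ` {1..<n}"])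

lemma path_algebra_one_l:
  assumes "f \<in> carrier (path_algebra n)"
  shows "\<one>\<^bsub>path_algebra n\<^esub> \<otimes>\<^bsub>path_algebra n\<^esub> f = f"
proof
  fix p
  show "(\<one>\<^bsub>path_algebra n\<^esub> \<otimes>\<^bsub>path_algebra n\<^esub> f) p = f p"
  proof (cases "p \<in> quiver_paths n")
    case True
    then have "p \<noteq> []" "hd p \<in> {1..<n}" using hd_in_set[of p] by (auto simp: quiver_paths_def simp del: hd_in_set)
    then have "(\<one>\<^bsub>path_algebra n\<^esub> \<otimes>\<^bsub>path_algebra n\<^esub> f) p = (\<Sum>k<length p. if k = 0 then f p else 0)"
      unfolding path_algebra_simps by (intro sum.cong refl) (cases p, auto simp: take_Cons')
    then show ?thesis using \<open>p \<noteq> []\<close> by simp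
  next
    case False
    then show ?thesis
      using path_algebra_off_paths[OF path_algebra_mult_closed[OF path_algebra_one_closed assms]]
        path_algebra_off_paths[OF assms] by simp
  qed
qed

lemma path_algebra_one_r:
  assumes "f \<in> carrier (path_algebra n)"
  shows "f \<otimes>\<^bsub>path_algebra n\<^esub> \<one>\<^bsub>path_algebra n\<^esub> = f"
proof
  fix p
  show "(f \<otimes>\<^bsub>path_algebra n\<^esub> \<one>\<^bsub>path_algebra n\<^esub>) p = f p"
  proof (cases "p \<in> quiver_paths n")
    case True
    then have p: "p \<noteq> []" "last p \<in> {1..<n}" using last_in_set[of p] by (auto simp: quiver_paths_def simp del: last_in_set)
    have "(f \<otimes>\<^bsub>path_algebra n\<^esub> \<one>\<^bsub>path_algebra n\<^esub>) p = (\<Sum>k<length p. if k = length p - 1 then f p else 0)"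
      unfolding path_algebra_simps
    proof (intro sum.cong refl)
      fix k assume k: "k \<in> {..<length p}"
      show "f (take (Suc k) p) * (if \<exists>i\<in>{1..<n}. drop k p = [i] then 1 else 0) = (if k = length p - 1 then f p else 0)"
      proof (cases "k = length p - 1")
        case True
        then have "drop k p = [last p]" using p by (metis append_butlast_last_id append_eq_conv_conj length_butlast)
        then show ?thesis using True p by auto
      next
        case False
        then have "length (drop k p) \<noteq> 1" using k by auto
        then have "\<nexists>i. drop k p = [i]" by (metis length_Cons list.size(3) One_nat_def)
        then show ?thesis using False by auto
      qed
    qed
    then show ?thesis using p by (simp add: sum.delta)
  next
    case False
    then show ?thesis
      using path_algebra_off_paths[OF path_algebra_mult_closed[OF assms path_algebra_one_closed]]
        path_algebra_off_paths[OF assms] by simp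
  qed
qed

lemma ring_path_algebra: "ring (path_algebra n)"
proof (rule ringI)
  show "abelian_group (path_algebra n)"
  proof (rule abelian_groupI)
    fix f g assume fg: "f \<in> carrier (path_algebra n)" "g \<in> carrier (path_algebra n)"
    have "{p. f p + g p \<noteq> 0} \<subseteq> {p. f p \<noteq> 0} \<union> {p. g p \<noteq> 0}" by auto
    with fg show "f \<oplus>\<^bsub>path_algebra n\<^esub> g \<in> carrier (path_algebra n)"
      unfolding path_algebra_simps by (meson finite_UnI finite_subset le_sup_iff subset_trans)
  next
    fix f assume "f \<in> carrier (path_algebra n)"
    then show "\<exists>g\<in>carrier (path_algebra n). g \<oplus>\<^bsub>path_algebra n\<^esub> f = \<zero>\<^bsub>path_algebra n\<^esub>"
      unfolding path_algebra_simps by (intro bexI[of _ "\<lambda>p. - f p"]) (auto simp: path_algebra_simps)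
  qed (auto simp: path_algebra_simps add_ac)
  show "monoid (path_algebra n)"
    by (rule monoidI) (auto simp: path_algebra_mult_closed path_algebra_assoc path_algebra_one_l path_algebra_one_r path_algebra_one_closed)
qed (auto simp: path_algebra_simps sum.distrib algebra_simps)

lemma preprojective_relation_carrier: "preprojective_relation n \<in> carrier (path_algebra n)"
proof -
  have "{p. preprojective_relation n p \<noteq> 0} \<subseteq> (\<lambda>i. [i, Suc i, i]) ` {1..<n-1} \<union> (\<lambda>i. [Suc i, i, Suc i]) ` {1..<n-1}"
  proof
    fix p assume "p \<in> {p. preprojective_relation n p \<noteq> 0}"
    then obtain i where "i \<in> {1..<n-1}" "path_elem [i, Suc i, i] p - path_elem [Suc i, i, Suc i] p \<noteq> 0"
      unfolding preprojective_relation_def mem_Collect_eq by (elim sum.not_neutral_contains_not_neutral)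
    then show "p \<in> (\<lambda>i. [i, Suc i, i]) ` {1..<n-1} \<union> (\<lambda>i. [Suc i, i, Suc i]) ` {1..<n-1}"
      by (auto simp: path_elem_def split: if_splits)
  qed
  moreover have "\<dots> \<subseteq> quiver_paths n"
    by (auto simp: quiver_paths_def nth_Cons' less_Suc_eq)
  ultimately show ?thesis unfolding path_algebra_simps
    by (meson finite_UnI finite_atLeastLessThan finite_imageI finite_subset order_trans)
qed

lemma ideal_preprojective: "ideal (Idl\<^bsub>path_algebra n\<^esub> {preprojective_relation n}) (path_algebra n)"
  using ring.genideal_ideal[OF ring_path_algebra] preprojective_relation_carrier by blast

lemma ring_preprojective_algebra: "ring (preprojective_algebra n)"
  unfolding preprojective_algebra_def by (rule ideal.quotient_is_ring[OF ideal_preprojective])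

lemma ideal_preprojective_coeff:
  assumes "f \<in> Idl\<^bsub>path_algebra n\<^esub> {preprojective_relation n}"
  shows "f [j] = 0"
proof -
  interpret ring "path_algebra n" by (rule ring_path_algebra)
  let ?I = "{f \<in> carrier (path_algebra n). \<forall>j. f [j] = 0}"
  have neg: "\<ominus>\<^bsub>path_algebra n\<^esub> f = (\<lambda>p. - f p)" if "f \<in> carrier (path_algebra n)" for f
    by (rule minus_equality) (use that in \<open>auto simp: path_algebra_simps\<close>)
  have "ideal ?I (path_algebra n)"
  proof (rule idealI)
    show "subgroup ?I (add_monoid (path_algebra n))"
    proof (rule add.subgroupI)
      show "?I \<noteq> {}" using path_algebra_simps(4) zero_closed by (auto intro!: exI[of _ "\<zero>\<^bsub>path_algebra n\<^esub>"])
      fix f assume f: "f \<in> ?I"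
      then show "\<ominus>\<^bsub>path_algebra n\<^esub> f \<in> ?I" using neg a_inv_closed[of f] by auto
      fix g assume g: "g \<in> ?I"
      then show "f \<oplus>\<^bsub>path_algebra n\<^esub> g \<in> ?I" using f a_closed[of f g] by (auto simp: path_algebra_simps(5))
    qed auto
  qed (auto simp: path_algebra_mult_closed, auto simp: path_algebra_simps(2), rule ring_axioms)
  moreover have "preprojective_relation n \<in> ?I"
    using preprojective_relation_carrier by (auto simp: preprojective_relation_def path_elem_def)
  ultimately show ?thesis using assms unfolding genideal_def by blast
qed

lemma coset_coeff:
  assumes "f \<in> carrier (path_algebra n)" "C = (Idl\<^bsub>path_algebra n\<^esub> {preprojective_relation n}) +>\<^bsub>path_algebra n\<^esub> f"
  shows "(SOME f. f \<in> C) [j] = f [j]"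
proof -
  have "f \<in> C" using assms(2) ideal.rcos_const_imp_mem
    by (metis abelian_subgroup.a_rcos_self abelian_subgroupI3 assms(1) ideal.axioms(1) ideal_preprojective ring_def ring_path_algebra additive_subgroup.a_subgroup)
  moreover have "g [j] = f [j]" if "g \<in> C" for g
    using that ideal_preprojective_coeff unfolding assms(2) by (auto simp: a_r_coset_def' path_algebra_simps)
  ultimately show ?thesis by (metis someI)
qed

lemma preprojective_algebra_carrier: "carrier (preprojective_algebra n) = {(Idl\<^bsub>path_algebra n\<^esub> {preprojective_relation n}) +>\<^bsub>path_algebra n\<^esub> f | f. f \<in> carrier (path_algebra n)}"
  by (auto simp: preprojective_algebra_def FactRing_def A_RCOSETS_def')

lemma lmodule_simple_at: assumes "j \<in> {1..<n}" shows "lmodule (preprojective_algebra n) (simple_at j)"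
proof -
  interpret P: ring "preprojective_algebra n" by (rule ring_preprojective_algebra)
  interpret A: ring "path_algebra n" by (rule ring_path_algebra)
  let ?J = "Idl\<^bsub>path_algebra n\<^esub> {preprojective_relation n}"
  interpret J: ideal ?J "path_algebra n" by (rule ideal_preprojective)
  have m: "(?J +>\<^bsub>path_algebra n\<^esub> f) \<odot>\<^bsub>simple_at j\<^esub> c = f [j] * c" if "f \<in> carrier (path_algebra n)" for f c
    using coset_coeff[OF that refl] by (simp add: simple_at_def)
  have [simp]: "carrier (simple_at j) = UNIV" "a \<oplus>\<^bsub>simple_at j\<^esub> b = a + b" "\<zero>\<^bsub>simple_at j\<^esub> = 0" for a b
    by (auto simp: simple_at_def)
  have "abelian_group (simple_at j)"
    by (rule abelian_groupI) (auto simp: add_ac intro: exI[of _ "- _"] add.left_inverse)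
  then interpret S: abelian_group "simple_at j" .
  show ?thesis
  proof unfold_locales
    fix a b x y assume "a \<in> carrier (preprojective_algebra n)" "b \<in> carrier (preprojective_algebra n)"
    then obtain f g where fg: "f \<in> carrier (path_algebra n)" "a = ?J +>\<^bsub>path_algebra n\<^esub> f"
      "g \<in> carrier (path_algebra n)" "b = ?J +>\<^bsub>path_algebra n\<^esub> g" by (auto simp: preprojective_algebra_carrier)
    have 1: "a \<oplus>\<^bsub>preprojective_algebra n\<^esub> b = ?J +>\<^bsub>path_algebra n\<^esub> (f \<oplus>\<^bsub>path_algebra n\<^esub> g)"
      using fg by (simp add: preprojective_algebra_def FactRing_def J.a_rcos_sum)
    have 2: "a \<otimes>\<^bsub>preprojective_algebra n\<^esub> b = ?J +>\<^bsub>path_algebra n\<^esub> (f \<otimes>\<^bsub>path_algebra n\<^esub> g)"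
      using fg by (simp add: preprojective_algebra_def FactRing_def J.rcoset_mult_add)
    show "(a \<oplus>\<^bsub>preprojective_algebra n\<^esub> b) \<odot>\<^bsub>simple_at j\<^esub> x = a \<odot>\<^bsub>simple_at j\<^esub> x \<oplus>\<^bsub>simple_at j\<^esub> b \<odot>\<^bsub>simple_at j\<^esub> x"
      unfolding 1 m[OF A.a_closed[OF fg(1,3)]] unfolding fg(2,4) m[OF fg(1)] m[OF fg(3)]
      by (simp add: path_algebra_simps(5) algebra_simps)
    show "(a \<otimes>\<^bsub>preprojective_algebra n\<^esub> b) \<odot>\<^bsub>simple_at j\<^esub> x = a \<odot>\<^bsub>simple_at j\<^esub> (b \<odot>\<^bsub>simple_at j\<^esub> x)"
      unfolding 2 m[OF A.m_closed[OF fg(1,3)]] unfolding fg(2,4) m[OF fg(1)] m[OF fg(3)]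
      by (simp add: path_algebra_simps(2))
  next
    fix a x y assume "a \<in> carrier (preprojective_algebra n)"
    show "a \<odot>\<^bsub>simple_at j\<^esub> (x \<oplus>\<^bsub>simple_at j\<^esub> y) = a \<odot>\<^bsub>simple_at j\<^esub> x \<oplus>\<^bsub>simple_at j\<^esub> a \<odot>\<^bsub>simple_at j\<^esub> y"
      by (simp add: simple_at_def algebra_simps)
  next
    fix x
    have "\<one>\<^bsub>preprojective_algebra n\<^esub> = ?J +>\<^bsub>path_algebra n\<^esub> \<one>\<^bsub>path_algebra n\<^esub>"
      by (simp add: preprojective_algebra_def FactRing_def)
    then show "\<one>\<^bsub>preprojective_algebra n\<^esub> \<odot>\<^bsub>simple_at j\<^esub> x = x"
      using assms by (simp add: m) (simp add: path_algebra_simps(3))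
  qed auto
qed

end

theory Submission
  imports Defs
begin

text \<open>
  The proof turns the modules \<open>M\<close> into skew shapes and the simple top into a forbidden pattern of
  permutations.

  \<^bold>\<open>Modules.\<close> Let \<open>e\<^sub>c\<close> be the idempotent of the vertex \<open>c\<close>, and let \<open>U\<close> and \<open>D\<close> be the sums of all
  arrows that raise, respectively lower, the vertex by one. The preprojective relation is \<open>DU - UD\<close>,
  so a module is a graded vector space with two commuting operators of degree \<open>1\<close> and \<open>-1\<close>
  (\<open>lower_raise\<close>, \<open>proj_raise\<close>, \<open>proj_lower\<close>). The injective module \<open>R\<^sub>j\<close> looks like a \<open>j \<times> (n - j)\<close>
  rectangle of cells with the socle in a corner, where \<open>U\<close> and \<open>D\<close> move one step towards the two sides
  meeting in that corner. The Young diagrams in this rectangle correspond to the subsets \<open>A\<close> of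
  \<open>{1..n}\<close> with \<open>j\<close> elements: the boundary path of the diagram is vertical in step \<open>t\<close> iff \<open>t \<in> A\<close>.
  The diagram of \<open>A\<close> spans the submodule \<open>N\<^sub>A\<close> of all \<open>x\<close> such that \<open>U\<^bsup>p\<^esup> D\<^bsup>q\<^esup> e\<^sub>c x = 0\<close> for all \<open>c\<close>, where
  \<open>p\<close> is the number of elements of \<open>A\<close> above \<open>c\<close> and \<open>q\<close> the number of elements of \<open>{1..c}\<close> missing in \<open>A\<close>,
  and this formula serves as the definition (\<open>shape_sub\<close>). It makes sense in every module
  and refers to no basis of \<open>R\<^sub>j\<close>. The socle enters twice: \<open>N\<close> of \<open>{1..j}\<close> is zero
  (\<open>shape_sub_initial\<close>), and the quotients between consecutive kernels are at most
  one-dimensional (\<open>socle_line\<close>). Injectivity enters through \<open>injective_lift\<close>, which shows that all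
  cells of the rectangle are present (\<open>exists_shift_to_socle\<close>).

  \<^bold>\<open>Words.\<close> Passing from \<open>N\<^sub>A\<close> to the preimage of the trace of \<open>S\<^sub>c\<close> in the quotient adds the cell of
  colour \<open>c\<close> that can be added to the diagram, if there is one; that is, it replaces \<open>A\<close> by its image
  under the transposition \<open>\<sigma>\<^sub>c\<close>, unless this would remove a cell (\<open>soc_preimage_shape_sub\<close>). With
  \<open>v\<^sub>k = \<sigma>\<^bsub>i\<^sub>k\<^esub> \<cdots> \<sigma>\<^bsub>i\<^sub>1\<^esub>\<close> it follows that \<open>V\<^bsub>i,k\<^esub>\<close> belongs to the set of positions \<open>t\<close> with
  \<open>v\<^sub>k t \<le> i\<^sub>k\<close> (\<open>soc_seq_shape_sub\<close>) and its submodule to the set \<open>A\<close> of positions with \<open>v t \<le> i\<^sub>k\<close>, where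
  \<open>v = v\<^bsub>k-1\<^esub>\<close>. The two sets differ by the exchange of \<open>x\<close> for \<open>y\<close>, where \<open>v x = i\<^sub>k\<close> and
  \<open>v y = i\<^sub>k + 1\<close>. Hence the skew shape of \<open>M\<^bsub>i,k\<^esub>\<close> is a ribbon with one cell for each colour
  \<open>x, \<dots>, y - 1\<close>, and the cells of colours \<open>c\<close> and \<open>c + 1\<close> are connected by \<open>U\<close> if \<open>c + 1 \<in> A\<close> and by
  \<open>D\<close> otherwise. Such a module has a simple top iff one cell generates it, so iff there are no
  \<open>x < t < t' < y\<close> with \<open>v t < i\<^sub>k\<close> and \<open>v t' > i\<^sub>k + 1\<close> (\<open>hook_step\<close>, \<open>ribbon_simple_top\<close>).

  \<^bold>\<open>Permutations.\<close> The permutation \<open>w\<^sub>0 w\<^sub>0\<^sup>K\<close> is increasing on the blocks of \<open>K\<close> and decreasing between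
  them, so it avoids the patterns \<open>132\<close> and \<open>213\<close> (\<open>rev_layered_w0_w0K\<close>). The last interval word
  applied is a cycle moving the value \<open>b\<close>, or \<open>b + 1\<close>, across the others, and the product of the earlier ones
  preserves \<open>{1..b}\<close> since \<open>b\<close> is a new letter. Under these conditions the earlier product again
  avoids both patterns on an interval of positions and is the identity elsewhere, and a forbidden
  pattern during the last interval word would be a \<open>132\<close> or \<open>213\<close> in the earlier product
  (\<open>rev_layered_unwind_descending\<close>, \<open>rev_layered_unwind_ascending\<close>). Induction on the number of
  interval words then shows that no step meets the forbidden pattern (\<open>hook_word_intervals\<close>).
\<close>

section \<open>Longest elements of the symmetric group and of its parabolic subgroups\<close>

definition inversions :: "nat \<Rightarrow> (nat \<Rightarrow> nat) \<Rightarrow> (nat \<times> nat) set"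
  where "inversions n p = {(x, y). 1 \<le> x \<and> x < y \<and> y \<le> n \<and> p y < p x}"

abbreviation adj_swap :: "nat \<Rightarrow> nat \<Rightarrow> nat" where "adj_swap i \<equiv> Transposition.transpose i (Suc i)"

lemma finite_inversions: "finite (inversions n p)"
  by (rule finite_subset[of _ "{1..n} \<times> {1..n}"]) (auto simp: inversions_def)

lemma word_perm_simps:
  "word_perm [] = id" "word_perm (i # ws) = adj_swap i \<circ> word_perm ws"
  by (auto simp: word_perm_def)

lemma word_perm_append: "word_perm (us @ ws) = word_perm us \<circ> word_perm ws"
  by (induction us) (auto simp: word_perm_simps)

lemma bij_word_perm: "bij (word_perm ws)"
proof (induction ws)
  case Nil
  show ?case by (simp only: word_perm_simps bij_id)
next
  case (Cons i ws)
  show ?case unfolding word_perm_simps by (rule bij_comp[OF Cons bij_transpose])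
qed

text \<open>Relabelling both coordinates by \<open>\<sigma>\<^sub>i\<close> matches the inversions of \<open>p\<close> with those of \<open>p \<sigma>\<^sub>i\<close>,
  except for the pair \<open>(i, i + 1)\<close> itself.\<close>
lemma card_inversions_ascent:
  assumes "1 \<le> i" "i < n" "p i < p (Suc i)"
  shows "card (inversions n (p \<circ> adj_swap i)) = Suc (card (inversions n p))"
proof -
  let ?f = "map_prod (adj_swap i) (adj_swap i)"
  have inj: "inj ?f" by (intro prod.inj_map inj_transpose)
  have less: "adj_swap i x < adj_swap i y" if "x < y" "\<not> (x = i \<and> y = Suc i)" for x y
    using that by (auto simp: transpose_def)
  have range: "1 \<le> adj_swap i x \<and> adj_swap i x \<le> n \<longleftrightarrow> 1 \<le> x \<and> x \<le> n" for x
    using assms by (auto simp: transpose_def)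
  have eq: "inversions n (p \<circ> adj_swap i) = insert (i, Suc i) (?f ` inversions n p)"
  proof (intro equalityI subsetI)
    fix z assume "z \<in> inversions n (p \<circ> adj_swap i)"
    then obtain x y where z: "z = (x, y)" "1 \<le> x" "x < y" "y \<le> n" "p (adj_swap i y) < p (adj_swap i x)"
      by (auto simp: inversions_def)
    show "z \<in> insert (i, Suc i) (?f ` inversions n p)"
    proof (cases "x = i \<and> y = Suc i")
      case False
      then have "adj_swap i x < adj_swap i y" using less z by blast
      then have "(adj_swap i x, adj_swap i y) \<in> inversions n p"
        using z range[of x] range[of y] by (auto simp: inversions_def)
      then show ?thesis unfolding z(1) by (intro insertI2 image_eqI[of _ _ "(adj_swap i x, adj_swap i y)"]) auto
    qed (use z in auto)
  next
    fix z assume "z \<in> insert (i, Suc i) (?f ` inversions n p)"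
    then consider "z = (i, Suc i)" | x y where "z = (adj_swap i x, adj_swap i y)" "(x, y) \<in> inversions n p" by auto
    then show "z \<in> inversions n (p \<circ> adj_swap i)"
    proof cases
      case 2
      then have "\<not> (x = i \<and> y = Suc i)" using assms by (auto simp: inversions_def)
      then have "adj_swap i x < adj_swap i y" using 2 less by (auto simp: inversions_def)
      then show ?thesis using 2 range[of x] range[of y] by (auto simp: inversions_def)
    qed (use assms in \<open>auto simp: inversions_def\<close>)
  qed
  have "(i, Suc i) \<notin> ?f ` inversions n p"
    using assms by (auto simp: inversions_def transpose_def split: if_splits)
  then show ?thesis unfolding eq
    by (subst card_insert_disjoint)
      (auto simp: finite_inversions card_image[OF inj_on_subset[OF inj subset_UNIV]])
qed

lemma card_inversions_le: 
  assumes "1 \<le> i" "i < n" "inj p"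
  shows "card (inversions n (p \<circ> adj_swap i)) \<le> Suc (card (inversions n p))"
proof -
  consider "p i < p (Suc i)" | "p (Suc i) < p i" using assms(3) by (meson injD linorder_neqE_nat n_not_Suc_n)
  then show ?thesis
  proof cases
    case 2
    then have "card (inversions n ((p \<circ> adj_swap i) \<circ> adj_swap i)) = Suc (card (inversions n (p \<circ> adj_swap i)))"
      using assms by (intro card_inversions_ascent) auto
    then show ?thesis by (simp add: comp_assoc)
  qed (use card_inversions_ascent[OF assms(1,2)] in auto)
qed

lemma card_inversions_word:
  assumes "set ws \<subseteq> {1..<n}"
  shows "card (inversions n (word_perm ws)) \<le> length ws"
  using assms
proof (induction ws rule: rev_induct)
  case Nil
  have "inversions n (word_perm []) = {}" by (auto simp: inversions_def word_perm_simps)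
  then show ?case by simp
next
  case (snoc i ws)
  then have "card (inversions n (word_perm ws \<circ> adj_swap i)) \<le> Suc (card (inversions n (word_perm ws)))"
    by (intro card_inversions_le) (auto simp: bij_word_perm bij_is_inj)
  with snoc show ?case by (simp add: word_perm_append word_perm_simps o_def)
qed

text \<open>An increasing self-map of an interval is at least the identity when read from the left end and
  at most the identity when read from the right end.\<close>
lemma increasing_self_map_id:
  fixes p :: "nat \<Rightarrow> nat"
  assumes mono: "\<And>x y. l \<le> x \<Longrightarrow> x < y \<Longrightarrow> y \<le> r \<Longrightarrow> p x < p y"
    and img: "\<And>x. x \<in> {l..r} \<Longrightarrow> p x \<in> {l..r}" and x: "x \<in> {l..r}"
  shows "p x = x"
proof -
  have lower: "l + d \<le> r \<Longrightarrow> l + d \<le> p (l + d)" for d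
  proof (induction d)
    case 0 then show ?case using img[of l] by auto
  next
    case (Suc d) then show ?case using mono[of "l + d" "l + Suc d"] by auto
  qed
  have upper: "l + d \<le> r \<Longrightarrow> p (r - d) \<le> r - d" for d
  proof (induction d)
    case 0 then show ?case using img[of r] by auto
  next
    case (Suc d) then show ?case using mono[of "r - Suc d" "r - d"] by simp linarith
  qed
  show ?thesis using lower[of "x - l"] upper[of "r - x"] x by auto
qed

text \<open>Sorting by adjacent exchanges removes one inversion per letter.\<close>
lemma word_exists:
  assumes "p permutes {1..n}"
  shows "\<exists>ws. set ws \<subseteq> {1..<n} \<and> word_perm ws = p \<and> length ws = card (inversions n p)"
  using assms
proof (induction "card (inversions n p)" arbitrary: p)
  case 0
  then have none: "inversions n p = {}" using finite_inversions by simp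
  have "p x = x" for x
  proof (cases "x \<in> {1..n}")
    case True
    have mono: "p x < p y" if "1 \<le> x" "x < y" "y \<le> n" for x y
    proof -
      have "\<not> p y < p x" using none that by (auto simp: inversions_def)
      moreover have "p x \<noteq> p y" using permutes_inj[OF 0(2)] that by (auto dest: injD)
      ultimately show ?thesis by simp
    qed
    show ?thesis
      by (rule increasing_self_map_id[OF mono _ True]) (use permutes_in_image[OF 0(2)] in auto)
  qed (use 0 in \<open>auto simp: permutes_def\<close>)
  then have "word_perm [] = p" by (auto simp: word_perm_simps)
  then show ?case using 0 by (intro exI[of _ "[]"]) auto
next
  case (Suc l)
  have "\<exists>i. 1 \<le> i \<and> i < n \<and> p (Suc i) < p i"
  proof (rule ccontr)
    assume "\<not> ?thesis"
    then have asc: "p i \<le> p (Suc i)" if "1 \<le> i" "i < n" for i using that by (meson not_le)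
    have "p x \<le> p (x + d)" if "1 \<le> x" "x + d \<le> n" for x d
      using that by (induction d) (auto intro: order_trans[OF _ asc])
    then have "inversions n p = {}" unfolding inversions_def
      by (auto simp: not_less) (metis le_add_diff_inverse less_imp_le not_le)
    then show False using Suc by simp
  qed
  then obtain i where i: "1 \<le> i" "i < n" "p (Suc i) < p i" by blast
  let ?q = "p \<circ> adj_swap i"
  have "card (inversions n (?q \<circ> adj_swap i)) = Suc (card (inversions n ?q))"
    using i by (intro card_inversions_ascent) auto
  then have "l = card (inversions n ?q)" using Suc(2) by (simp add: comp_assoc)
  moreover have "?q permutes {1..n}"
    using i Suc(3) by (intro permutes_compose permutes_swap_id) auto
  ultimately obtain ws where ws: "set ws \<subseteq> {1..<n}" "word_perm ws = ?q" "length ws = l"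
    using Suc(1) by blast
  have "word_perm (ws @ [i]) = p" by (simp add: word_perm_append word_perm_simps ws comp_assoc)
  then show ?case using ws i Suc(2) by (intro exI[of _ "ws @ [i]"]) auto
qed

lemma weyl_length_eq:
  assumes "p permutes {1..n}"
  shows "weyl_length n p = card (inversions n p)"
  unfolding weyl_length_def
  by (rule Least_equality) (use word_exists[OF assms] card_inversions_word in auto)

text \<open>An ascent at some \<open>i \<in> K\<close> could be exchanged within \<open>G\<close>, which would increase the length. The
  length is bounded on permutations of \<open>{1..n}\<close>, so the maximum is attained.\<close>
lemma longest_elem_descents:
  assumes perm: "\<And>p. p \<in> G \<Longrightarrow> p permutes {1..n}" and "id \<in> G"
    and closed: "\<And>p i. p \<in> G \<Longrightarrow> i \<in> K \<Longrightarrow> p \<circ> adj_swap i \<in> G" and K: "K \<subseteq> {1..<n}"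
  shows "longest_elem n G \<in> G" "\<And>i. i \<in> K \<Longrightarrow> longest_elem n G (Suc i) < longest_elem n G i"
proof -
  have "weyl_length n p < Suc (n * n)" if "p \<in> G" for p
  proof -
    have "card (inversions n p) \<le> card ({1..n} \<times> {1..n})"
      by (intro card_mono) (auto simp: inversions_def)
    then show ?thesis using weyl_length_eq[OF perm[OF that]] by simp
  qed
  then have "\<forall>p. p \<in> G \<longrightarrow> weyl_length n p < Suc (n * n)" by blast
  note max = arg_max_nat_lemma[of "\<lambda>p. p \<in> G", OF \<open>id \<in> G\<close> this, folded longest_elem_def]
  have *: "longest_elem n G \<in> G" "\<forall>p. p \<in> G \<longrightarrow> weyl_length n p \<le> weyl_length n (longest_elem n G)"
    using max by (rule conjunct1, rule conjunct2)
  then show "longest_elem n G \<in> G" by blast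
  fix i assume i: "i \<in> K"
  let ?p = "longest_elem n G"
  show "?p (Suc i) < ?p i"
  proof (rule ccontr)
    assume "\<not> ?thesis"
    moreover have "?p (Suc i) \<noteq> ?p i" using inj_eq[OF permutes_inj[OF perm[OF *(1)]]] by simp
    ultimately have "?p i < ?p (Suc i)" by simp
    moreover have "1 \<le> i" "i < n" using i K by auto
    ultimately have "card (inversions n (?p \<circ> adj_swap i)) = Suc (card (inversions n ?p))"
      by (intro card_inversions_ascent)
    moreover have "weyl_length n (?p \<circ> adj_swap i) \<le> weyl_length n ?p" using * closed i by blast
    ultimately show False
      using weyl_length_eq[OF perm[OF *(1)]] weyl_length_eq[OF perm[OF closed[OF *(1) i]]] by simp
  qed
qed

definition avoids_132 :: "nat \<Rightarrow> nat \<Rightarrow> (nat \<Rightarrow> nat) \<Rightarrow> bool" where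
  "avoids_132 l r w \<longleftrightarrow> (\<forall>x y z. l \<le> x \<and> x < y \<and> y < z \<and> z \<le> r \<longrightarrow> \<not> (w x < w z \<and> w z < w y))"

definition avoids_213 :: "nat \<Rightarrow> nat \<Rightarrow> (nat \<Rightarrow> nat) \<Rightarrow> bool" where
  "avoids_213 l r w \<longleftrightarrow> (\<forall>x y z. l \<le> x \<and> x < y \<and> y < z \<and> z \<le> r \<longrightarrow> \<not> (w y < w x \<and> w x < w z))"

text \<open>The permutations \<open>w\<^sub>0 w\<^sub>0\<^sup>K\<close> of the interval \<open>{l..r}\<close>, described by the patterns that they avoid.
  In this form no block structure has to be carried through the induction over the interval words.\<close>
definition rev_layered :: "nat \<Rightarrow> nat \<Rightarrow> (nat \<Rightarrow> nat) \<Rightarrow> bool" where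
  "rev_layered l r w \<longleftrightarrow> avoids_132 l r w \<and> avoids_213 l r w \<and> (\<forall>x. x \<notin> {l..r} \<longrightarrow> w x = x)"

lemma parabolic_elem:
  assumes "p \<in> parabolic n K" "K \<subseteq> {1..<n}"
  shows "p permutes {1..n}" "\<And>c x. c \<in> {1..<n} - K \<Longrightarrow> p x \<le> c \<longleftrightarrow> x \<le> c"
proof -
  have adj: "adj_swap i permutes {1..n}" "\<forall>c\<in>{1..<n} - K. \<forall>x. adj_swap i x \<le> c \<longleftrightarrow> x \<le> c" if "i \<in> K" for i
  proof -
    show "adj_swap i permutes {1..n}" using that assms(2) by (intro permutes_swap_id) auto
    have "adj_swap i x \<le> c \<longleftrightarrow> x \<le> c" if "c \<noteq> i" for c x
      using that by (auto simp: transpose_def)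
    then show "\<forall>c\<in>{1..<n} - K. \<forall>x. adj_swap i x \<le> c \<longleftrightarrow> x \<le> c" using that by (metis DiffD2)
  qed
  have "p permutes {1..n} \<and> (\<forall>c\<in>{1..<n} - K. \<forall>x. p x \<le> c \<longleftrightarrow> x \<le> c)"
    using assms(1) unfolding parabolic_def
  proof (induction rule: generate.induct)
    case one
    show ?case unfolding sym_group_one by (intro conjI permutes_id) simp
  next
    case (incl h)
    then show ?case using adj by blast
  next
    case (inv h)
    then obtain i where i: "h = adj_swap i" "i \<in> K" by auto
    then have "inv\<^bsub>sym_group n\<^esub> h = adj_swap i"
      using adj(1) by (simp only: sym_group_inv_equality sym_group_carrier inv_transpose_eq)
    then show ?case using adj[OF i(2)] by simp
  next
    case (eng p q)
    then show ?case unfolding sym_group_mult by (intro conjI permutes_compose) auto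
  qed
  then show "p permutes {1..n}" "\<And>c x. c \<in> {1..<n} - K \<Longrightarrow> p x \<le> c \<longleftrightarrow> x \<le> c" by auto
qed

text \<open>Write \<open>p\<close> for the longest element of the parabolic subgroup. As \<open>w\<^sub>0\<close> is decreasing, a pattern
  \<open>132\<close> or \<open>213\<close> of \<open>w\<^sub>0 p\<close> would be a pattern \<open>312\<close> or \<open>231\<close> of \<open>p\<close>. In both of these the outer positions form
  an inversion of \<open>p\<close>. They lie in one block, on which \<open>p\<close> is decreasing.\<close>
lemma rev_layered_w0_w0K:
  assumes K: "K \<subseteq> {1..<n}"
  shows "rev_layered 1 n (longest_elem n (carrier (sym_group n)) \<circ> longest_elem n (parabolic n K))"
    (is "rev_layered 1 n (?w0 \<circ> ?p)")
proof -
  have id: "id \<in> carrier (sym_group n)"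
    by (simp only: sym_group_carrier permutes_id)
  have closed: "p \<circ> adj_swap i \<in> carrier (sym_group n)" if "p \<in> carrier (sym_group n)" "i \<in> {1..<n}" for p i
    using that permutes_compose[of "adj_swap i" "{1..n}" p] permutes_swap_id[of i "{1..n}" "Suc i"]
    by (auto simp: sym_group_carrier)
  have w0: "?w0 \<in> carrier (sym_group n)" "\<And>i. i \<in> {1..<n} \<Longrightarrow> ?w0 (Suc i) < ?w0 i"
    by (rule longest_elem_descents[where K = "{1..<n}" and G = "carrier (sym_group n)"];
        (rule id closed subset_refl | simp add: sym_group_carrier)?; assumption)+
  then have w0p: "?w0 permutes {1..n}" by (simp add: sym_group_carrier)
  have "p \<circ> adj_swap i \<in> parabolic n K" if "p \<in> parabolic n K" "i \<in> K" for p i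
    using that generate.eng[of p "sym_group n" _ "adj_swap i"] generate.incl[of "adj_swap i" _ "sym_group n"]
    unfolding parabolic_def by (auto simp: sym_group_def)
  moreover have "id \<in> parabolic n K"
    using generate.one[of "sym_group n"] unfolding parabolic_def by (simp add: sym_group_def)
  ultimately have p: "?p \<in> parabolic n K" "\<And>i. i \<in> K \<Longrightarrow> ?p (Suc i) < ?p i"
    using longest_elem_descents[of "parabolic n K" n K] K parabolic_elem by auto
  note pp = parabolic_elem[OF p(1) K]
  have pn: "?p x \<in> {1..n}" if "x \<in> {1..n}" for x using permutes_in_image[OF pp(1)] that by blast
  have dec0: "?w0 y < ?w0 x" if "1 \<le> x" "x < y" "y \<le> n" for x y
    using that(2,1,3)
  proof (induction rule: strict_inc_induct[of x y])
    case (base i) then show ?case using w0(2) by auto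
  next
    case (step i) then show ?case using w0(2)[of i] by auto
  qed
  have mono: "?p y < ?p x" if "(?w0 \<circ> ?p) x < (?w0 \<circ> ?p) y" "x \<in> {1..n}" "y \<in> {1..n}" for x y
    using that dec0[of "?p x" "?p y"] pn[of x] pn[of y]
    by (metis atLeastAtMost_iff comp_apply linorder_neqE_nat order_less_asym)
  \<comment> \<open>Every simple reflection between the positions of an inversion of \<open>p\<close> lies in \<open>K\<close>, because
    otherwise \<open>p\<close> preserves an initial segment separating them.\<close>
  have block: "?p b < ?p a" if "?p z < ?p x" "1 \<le> x" "x \<le> a" "a < b" "b \<le> z" "z \<le> n" for x z a b
  proof -
    have inK: "i \<in> K" if i: "x \<le> i" "i < z" for i
    proof (rule ccontr)
      assume "i \<notin> K"
      then have "i \<in> {1..<n} - K" using i \<open>1 \<le> x\<close> \<open>z \<le> n\<close> by auto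
      from pp(2)[OF this, of x] pp(2)[OF this, of z] show False using i \<open>?p z < ?p x\<close> by auto
    qed
    show ?thesis using that(4,3,5)
    proof (induction rule: strict_inc_induct[of a b])
      case (base i) then show ?case using p(2) inK by auto
    next
      case (step i) then show ?case using p(2)[OF inK, of i] by auto
    qed
  qed
  show ?thesis unfolding rev_layered_def
  proof (intro conjI)
    show "avoids_132 1 n (?w0 \<circ> ?p)" unfolding avoids_132_def
    proof (intro allI impI notI, elim conjE)
      fix x y z assume h: "1 \<le> x" "x < y" "y < z" "z \<le> n"
        and "(?w0 \<circ> ?p) x < (?w0 \<circ> ?p) z" "(?w0 \<circ> ?p) z < (?w0 \<circ> ?p) y"
      then have "?p z < ?p x" "?p y < ?p z" using mono[of x z] mono[of z y] by auto
      then show False using block[of z x y z] h by auto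
    qed
    show "avoids_213 1 n (?w0 \<circ> ?p)" unfolding avoids_213_def
    proof (intro allI impI notI, elim conjE)
      fix x y z assume h: "1 \<le> x" "x < y" "y < z" "z \<le> n"
        and "(?w0 \<circ> ?p) y < (?w0 \<circ> ?p) x" "(?w0 \<circ> ?p) x < (?w0 \<circ> ?p) z"
      then have "?p z < ?p x" "?p x < ?p y" using mono[of y x] mono[of x z] by auto
      then show False using block[of z x x y] h by auto
    qed
    show "\<forall>x. x \<notin> {1..n} \<longrightarrow> (?w0 \<circ> ?p) x = x" using w0p pp(1) by (simp add: permutes_def)
  qed
qed

section \<open>Unwinding interval words\<close>

text \<open>The letter \<open>i\<close> is applied to \<open>v\<close> and exchanges the values \<open>i\<close> and \<open>i + 1\<close>. The first conjunct says
  that this creates an inversion, the second one that the ribbon added by this step is a hook whose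
  corner is its unique generator.\<close>
definition hook_step :: "(nat \<Rightarrow> nat) \<Rightarrow> nat \<Rightarrow> bool" where
  "hook_step v i \<longleftrightarrow> (\<forall>x y. v x = i \<and> v y = Suc i \<longrightarrow>
    x < y \<and> (\<forall>s t. x < s \<and> s < t \<and> t < y \<longrightarrow> \<not> (v s < i \<and> Suc i < v t)))"

fun hook_word :: "nat list \<Rightarrow> bool" where
  "hook_word [] \<longleftrightarrow> True"
| "hook_word (i # ws) \<longleftrightarrow> hook_word ws \<and> hook_step (word_perm ws) i"

lemma word_perm_descending:
  "word_perm (rev [b..<b + d]) z = (if z = b then b + d else if b < z \<and> z \<le> b + d then z - 1 else z)"
  by (induction d) (auto simp: word_perm_simps transpose_def)

lemma word_perm_ascending:
  "word_perm [e - d..<e] z = (if z = e then e - d else if e - d \<le> z \<and> z < e then Suc z else z)" if "d \<le> e"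
  using that
proof (induction d)
  case (Suc d)
  then have "[e - Suc d..<e] = (e - Suc d) # [e - d..<e]" by (subst upt_conv_Cons) (auto simp: Suc_diff_Suc)
  with Suc show ?case by (auto simp: word_perm_simps transpose_def)
qed (auto simp: word_perm_simps)

lemma word_perm_le_iff: "b \<notin> set ws \<Longrightarrow> word_perm ws z \<le> b \<longleftrightarrow> z \<le> b"
  by (induction ws) (auto simp: word_perm_simps transpose_def)

text \<open>While the letters \<open>b, b + 1, \<dots>\<close> are applied to \<open>u\<close>, the position \<open>x\<close> with \<open>u x = b\<close> carries the moving value,
  and the values passed drop by one. So a forbidden pattern \<open>x < s < t < y\<close> of a
  step means \<open>u s < u y < u t\<close>, which is a pattern \<open>132\<close> of \<open>u\<close>.\<close>
lemma hook_word_descending: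
  assumes "hook_word ws" and stab: "\<And>z. word_perm ws z \<le> b \<longleftrightarrow> z \<le> b"
    and avoid: "\<And>x s t y. \<lbrakk>word_perm ws x = b; x < s; s < t; t < y; b < word_perm ws y; word_perm ws y \<le> b + d\<rbrakk>
      \<Longrightarrow> \<not> (word_perm ws s < word_perm ws y \<and> word_perm ws y < word_perm ws t)"
  shows "hook_word (rev [b..<b + d] @ ws)"
  using avoid
proof (induction d)
  case (Suc d)
  let ?u = "word_perm ws"
  let ?v = "word_perm (rev [b..<b + d] @ ws)"
  have v: "?v z = (if ?u z = b then b + d else if b < ?u z \<and> ?u z \<le> b + d then ?u z - 1 else ?u z)" for z
    unfolding word_perm_append comp_apply word_perm_descending ..
  have "hook_step ?v (b + d)"
    unfolding hook_step_def
  proof (intro allI impI, elim conjE)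
    fix x y assume xy: "?v x = b + d" "?v y = Suc (b + d)"
    have ux: "?u x = b" and uy: "?u y = Suc (b + d)"
      using xy unfolding v by (auto split: if_splits)
    have "x \<le> b" "\<not> y \<le> b" using stab[of x] stab[of y] ux uy by auto
    moreover have "\<not> (?v s < b + d \<and> Suc (b + d) < ?v t)" if "x < s" "s < t" "t < y" for s t
    proof
      assume h: "?v s < b + d \<and> Suc (b + d) < ?v t"
      then have "?u s < ?u y" "?u y < ?u t" unfolding v uy by (auto split: if_splits)
      then show False using Suc(2)[OF ux that] uy by auto
    qed
    ultimately show "x < y \<and> (\<forall>s t. x < s \<and> s < t \<and> t < y \<longrightarrow> \<not> (?v s < b + d \<and> Suc (b + d) < ?v t))"
      by auto
  qed
  moreover have "hook_word (rev [b..<b + d] @ ws)" using Suc by simp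
  ultimately show ?case by simp
qed (use assms in simp)

text \<open>Here the value \<open>b + 1\<close> moves down, at a fixed position \<open>y\<close>, and a forbidden pattern of a step
  becomes a pattern \<open>213\<close> of \<open>u\<close> at the positions \<open>x < s < t\<close>.\<close>
lemma hook_word_ascending:
  assumes "hook_word ws" and stab: "\<And>z. word_perm ws z \<le> b \<longleftrightarrow> z \<le> b" and "d \<le> Suc b"
    and avoid: "\<And>x s t y. \<lbrakk>word_perm ws y = Suc b; x < s; s < t; t < y; Suc b - d \<le> word_perm ws x; word_perm ws x \<le> b\<rbrakk>
      \<Longrightarrow> \<not> (word_perm ws s < word_perm ws x \<and> word_perm ws x < word_perm ws t)"
  shows "hook_word ([Suc b - d..<Suc b] @ ws)"
  using avoid \<open>d \<le> Suc b\<close>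
proof (induction d)
  case (Suc d)
  let ?u = "word_perm ws" and ?e = "Suc b - d" and ?i = "b - d"
  let ?v = "word_perm ([?e..<Suc b] @ ws)"
  have "d \<le> b" using Suc by simp
  then have v: "?v z = (if ?u z = Suc b then ?e else if ?e \<le> ?u z \<and> ?u z < Suc b then Suc (?u z) else ?u z)" for z
    unfolding word_perm_append comp_apply by (subst word_perm_ascending) auto
  have e: "?e = Suc ?i" using \<open>d \<le> b\<close> by simp
  have "hook_step ?v ?i"
    unfolding hook_step_def
  proof (intro allI impI, elim conjE)
    fix x y assume xy: "?v x = ?i" "?v y = Suc ?i"
    have uy: "?u y = Suc b" and ux: "?u x = ?i"
      using xy e unfolding v by (auto split: if_splits)
    have "x \<le> b" "\<not> y \<le> b" using stab[of x] stab[of y] ux uy by auto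
    moreover have "\<not> (?v s < ?i \<and> Suc ?i < ?v t)" if "x < s" "s < t" "t < y" for s t
    proof
      assume h: "?v s < ?i \<and> Suc ?i < ?v t"
      then have "?u s < ?i" "?i < ?u t" unfolding v by (auto simp: e split: if_splits)
      then show False using Suc(2)[OF uy that] ux \<open>d \<le> b\<close> by auto
    qed
    ultimately show "x < y \<and> (\<forall>s t. x < s \<and> s < t \<and> t < y \<longrightarrow> \<not> (?v s < ?i \<and> Suc ?i < ?v t))"
      by auto
  qed
  moreover have "hook_word ([?e..<Suc b] @ ws)" using Suc by simp
  moreover have "[Suc b - Suc d..<Suc b] = ?i # [?e..<Suc b]"
    using \<open>d \<le> b\<close> e by (subst upt_conv_Cons) auto
  ultimately show ?case by simp
qed (use assms in simp)

lemma rev_layered_restrict: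
  assumes "rev_layered l r w" "l \<le> l'" "r' \<le> r"
    and ord: "\<And>x y. \<lbrakk>l' \<le> x; x \<le> r'; l' \<le> y; y \<le> r'\<rbrakk> \<Longrightarrow> u x < u y \<longleftrightarrow> w x < w y"
    and "\<And>x. x < l' \<Longrightarrow> u x = x" "\<And>x. r' < x \<Longrightarrow> u x = x"
  shows "rev_layered l' r' u"
proof -
  have "\<not> (u x < u z \<and> u z < u y)" "\<not> (u y < u x \<and> u x < u z)"
    if "l' \<le> x" "x < y" "y < z" "z \<le> r'" for x y z
  proof -
    have "l' \<le> y" "y \<le> r'" "l' \<le> z" "x \<le> r'" "l \<le> x" "z \<le> r" using that assms(2,3) by auto
    moreover have "\<not> (w x < w z \<and> w z < w y)" "\<not> (w y < w x \<and> w x < w z)"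
      using assms(1) \<open>l \<le> x\<close> \<open>x < y\<close> \<open>y < z\<close> \<open>z \<le> r\<close>
      unfolding rev_layered_def avoids_132_def avoids_213_def by blast+
    ultimately show "\<not> (u x < u z \<and> u z < u y)" "\<not> (u y < u x \<and> u x < u z)"
      using that ord by metis+
  qed
  then show ?thesis using assms(5,6) unfolding rev_layered_def avoids_132_def avoids_213_def
    by (auto simp: not_le)
qed

text \<open>Let \<open>x\<^sub>0\<close> be the position at which the value \<open>b\<close> moves to \<open>a + 1\<close>. The position \<open>y\<^sub>1\<close> of the value
  \<open>b + 1\<close> gets the value \<open>b\<close>. A position \<open>x < x\<^sub>0\<close> would give the pattern \<open>132\<close> at
  \<open>x, x\<^sub>0, y\<^sub>1\<close>; so \<open>x\<^sub>0 = l\<close>. If \<open>b = l\<close>, then \<open>u\<close> and \<open>w\<close> have the same patterns to the right of \<open>l\<close>.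
  If \<open>b > l\<close>, then the small value at \<open>l + 1\<close> has two effects: no value above \<open>a + 1\<close> may follow, so
  \<open>a + 1 = r\<close>, and the values at the positions above \<open>b\<close> increase, so \<open>u\<close> is the identity there.\<close>
lemma rev_layered_unwind_descending:
  assumes RL: "rev_layered l r w" and "bij u" "bij w"
    and stab: "\<And>z. u z \<le> b \<longleftrightarrow> z \<le> b" and "b \<le> a"
    and w: "\<And>z. w z = (if u z = b then Suc a else if b < u z \<and> u z \<le> Suc a then u z - 1 else u z)"
  shows "\<exists>l' r'. rev_layered l' r' u"
    and "\<And>x s t y. \<lbrakk>u x = b; x < s; s < t; t < y; b < u y; u y \<le> Suc a\<rbrakk> \<Longrightarrow> \<not> (u s < u y \<and> u y < u t)"
proof -
  have inj: "u x = u y \<longleftrightarrow> x = y" "w x = w y \<longleftrightarrow> x = y" for x y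
    using bij_is_inj[OF \<open>bij u\<close>] bij_is_inj[OF \<open>bij w\<close>] by (auto dest: injD)
  have id: "w x = x" if "\<not> (l \<le> x \<and> x \<le> r)" for x using RL that by (auto simp: rev_layered_def)
  have av132: "\<not> (w x < w z \<and> w z < w y)" if "l \<le> x" "x < y" "y < z" "z \<le> r" for x y z
    using RL that unfolding rev_layered_def avoids_132_def by blast
  have av213: "\<not> (w y < w x \<and> w x < w z)" if "l \<le> x" "x < y" "y < z" "z \<le> r" for x y z
    using RL that unfolding rev_layered_def avoids_213_def by blast
  obtain x0 where x0: "u x0 = b" using bij_is_surj[OF \<open>bij u\<close>] by (metis surjD)
  obtain y1 where y1: "u y1 = Suc b" using bij_is_surj[OF \<open>bij u\<close>] by (metis surjD)
  have "x0 \<le> b" "b < y1" using stab[of x0] stab[of y1] x0 y1 by auto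
  have w0: "w x0 = Suc a" and w1: "w y1 = b" using x0 y1 \<open>b \<le> a\<close> by (auto simp: w)
  have "l \<le> x0" "x0 \<le> r" using id[of x0] w0 \<open>x0 \<le> b\<close> \<open>b \<le> a\<close> by auto
  have "y1 \<le> r" using id[of y1] w1 \<open>x0 \<le> b\<close> \<open>l \<le> x0\<close> \<open>b < y1\<close> by auto
  have "Suc a \<le> r"
  proof (rule ccontr)
    assume "\<not> ?thesis"
    then have "w (Suc a) = w x0" using id[of "Suc a"] w0 by auto
    then show False using inj \<open>x0 \<le> b\<close> \<open>b \<le> a\<close> by auto
  qed
  have small: "w x = u x \<and> u x < b" if "x \<le> b" "x \<noteq> x0" for x
    using that stab[of x] inj(1)[of x x0] x0 by (auto simp: w)
  have big: "w x < w y \<longleftrightarrow> u x < u y" if "b < x" "b < y" for x y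
    using that stab[of x] stab[of y] by (auto simp: w)
  have above: "u x = x" if "r < x" for x
    using id[of x] that stab[of x] \<open>Suc a \<le> r\<close> \<open>b \<le> a\<close> by (auto simp: w split: if_splits)
  have below: "u x = x" if "x < l" for x
    using id[of x] small[of x] that \<open>l \<le> x0\<close> \<open>x0 \<le> b\<close> by auto
  have "x0 = l"
  proof (rule ccontr)
    assume "x0 \<noteq> l"
    then have "l < x0" using \<open>l \<le> x0\<close> by simp
    then show False using av132[of l x0 y1] small[of l] w0 w1 \<open>x0 \<le> b\<close> \<open>b < y1\<close> \<open>y1 \<le> r\<close> \<open>b \<le> a\<close> by auto
  qed
  have "(\<exists>l' r'. rev_layered l' r' u) \<and>
    (\<forall>s t y. x0 < s \<and> s < t \<and> t < y \<and> b < u y \<and> u y \<le> Suc a \<longrightarrow> \<not> (u s < u y \<and> u y < u t))"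
  proof (cases "b = l")
    case True
    have "rev_layered (Suc l) r u"
    proof (rule rev_layered_restrict[OF RL])
      show "u x = x" if "x < Suc l" for x
        using that below x0 \<open>x0 = l\<close> True by (cases "x = l") auto
    qed (use big above True in auto)
    moreover have "\<not> (u s < u y \<and> u y < u t)" if "x0 < s" "s < t" "t < y" "b < u y" "u y \<le> Suc a" for s t y
    proof -
      have "y \<le> r" using above[of y] that(5) \<open>Suc a \<le> r\<close> by (cases "r < y") auto
      then show ?thesis using av132[of s t y] big[of s y] big[of y t] that True \<open>x0 = l\<close> by auto
    qed
    ultimately show ?thesis by blast
  next
    case False
    then have "l < b" using \<open>x0 = l\<close> \<open>x0 \<le> b\<close> by simp
    then have sl: "w (Suc l) < b" using small[of "Suc l"] \<open>x0 = l\<close> by simp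
    have "Suc a = r"
    proof (rule ccontr)
      assume "Suc a \<noteq> r"
      then have "Suc a < r" using \<open>Suc a \<le> r\<close> by simp
      obtain z where z: "w z = r" using bij_is_surj[OF \<open>bij w\<close>] by (metis surjD)
      have "z \<le> r" using id[of z] z by (cases "r < z") auto
      moreover have "b < z" using small[of z] z w0 \<open>Suc a < r\<close> \<open>b \<le> a\<close> by (cases "z = x0"; cases "z \<le> b") auto
      ultimately show False
        using av213[of l "Suc l" z] sl w0 z \<open>x0 = l\<close> \<open>Suc a < r\<close> \<open>l < b\<close> \<open>b \<le> a\<close> by auto
    qed
    have wb: "b \<le> w y" if "b < y" for y using that stab[of y] by (auto simp: w)
    have mono: "u x < u y" if "Suc b \<le> x" "x < y" "y \<le> r" for x y
    proof -
      have "\<not> w y < w x" using av132[of "Suc l" x y] sl wb[of y] that \<open>l < b\<close> by auto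
      moreover have "u x \<noteq> u y" using inj that by simp
      ultimately show ?thesis using big[of y x] that by auto
    qed
    have img: "u x \<in> {Suc b..r}" if "x \<in> {Suc b..r}" for x
    proof -
      have "\<not> r < u x"
      proof
        assume "r < u x"
        then have "u (u x) = u x" using above by blast
        then show False using inj(1)[of "u x" x] \<open>r < u x\<close> that by simp
      qed
      then show ?thesis using that stab[of x] by auto
    qed
    have fix_above: "u x = x" if "b < x" for x
      using increasing_self_map_id[of "Suc b" r u x, OF mono img] above that by (cases "x \<le> r") auto
    have ord: "u x < u y \<longleftrightarrow> w x < w y" if "x \<le> b" "y \<le> b" for x y
      using small[of x] small[of y] that x0 w0 \<open>b \<le> a\<close> by (cases "x = x0"; cases "y = x0") auto
    have "b \<le> r" using \<open>b \<le> a\<close> \<open>Suc a \<le> r\<close> by simp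
    have "rev_layered l b u"
      by (rule rev_layered_restrict[OF RL]) (use ord below fix_above \<open>b \<le> r\<close> in auto)
    moreover have "\<not> (u s < u y \<and> u y < u t)" if "t < y" "b < u y" for s t y
      using fix_above[of y] fix_above[of t] stab[of y] stab[of t] that by (cases "t \<le> b") auto
    ultimately show ?thesis by blast
  qed
  then show "\<exists>l' r'. rev_layered l' r' u"
    "\<And>x s t y. \<lbrakk>u x = b; x < s; s < t; t < y; b < u y; u y \<le> Suc a\<rbrakk> \<Longrightarrow> \<not> (u s < u y \<and> u y < u t)"
    using inj(1)[of _ x0] x0 by auto
qed

text \<open>The mirror image of the previous lemma under \<open>x \<mapsto> l + r - x\<close> on positions and values, which
  exchanges the patterns \<open>132\<close> and \<open>213\<close>.\<close>
lemma rev_layered_unwind_ascending: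
  assumes RL: "rev_layered l r w" and "bij u" "bij w"
    and stab: "\<And>z. u z \<le> b \<longleftrightarrow> z \<le> b" and "a \<le> b"
    and w: "\<And>z. w z = (if u z = Suc b then a else if a \<le> u z \<and> u z \<le> b then Suc (u z) else u z)"
  shows "\<exists>l' r'. rev_layered l' r' u"
    and "\<And>x s t y. \<lbrakk>u y = Suc b; x < s; s < t; t < y; a \<le> u x; u x \<le> b\<rbrakk> \<Longrightarrow> \<not> (u s < u x \<and> u x < u t)"
proof -
  have inj: "u x = u y \<longleftrightarrow> x = y" "w x = w y \<longleftrightarrow> x = y" for x y
    using bij_is_inj[OF \<open>bij u\<close>] bij_is_inj[OF \<open>bij w\<close>] by (auto dest: injD)
  have id: "w x = x" if "\<not> (l \<le> x \<and> x \<le> r)" for x using RL that by (auto simp: rev_layered_def)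
  have av132: "\<not> (w x < w z \<and> w z < w y)" if "l \<le> x" "x < y" "y < z" "z \<le> r" for x y z
    using RL that unfolding rev_layered_def avoids_132_def by blast
  have av213: "\<not> (w y < w x \<and> w x < w z)" if "l \<le> x" "x < y" "y < z" "z \<le> r" for x y z
    using RL that unfolding rev_layered_def avoids_213_def by blast
  obtain y0 where y0: "u y0 = Suc b" using bij_is_surj[OF \<open>bij u\<close>] by (metis surjD)
  obtain x1 where x1: "u x1 = b" using bij_is_surj[OF \<open>bij u\<close>] by (metis surjD)
  have "x1 \<le> b" "b < y0" using stab[of x1] stab[of y0] x1 y0 by auto
  have w0: "w y0 = a" and w1: "w x1 = Suc b" using x1 y0 \<open>a \<le> b\<close> by (auto simp: w)
  have "l \<le> y0" "y0 \<le> r" using id[of y0] w0 \<open>b < y0\<close> \<open>a \<le> b\<close> by auto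
  have "l \<le> x1" using id[of x1] w1 \<open>y0 \<le> r\<close> \<open>x1 \<le> b\<close> \<open>b < y0\<close> by auto
  have "l \<le> a"
  proof (rule ccontr)
    assume "\<not> ?thesis"
    then have "w a = w y0" using id[of a] w0 by auto
    then show False using inj \<open>b < y0\<close> \<open>a \<le> b\<close> by auto
  qed
  have large: "w x = u x \<and> Suc b < u x" if "b < x" "x \<noteq> y0" for x
  proof -
    have "u x \<noteq> Suc b" "b < u x" using that stab[of x] inj(1)[of x y0] y0 by auto
    then show ?thesis by (auto simp: w)
  qed
  have low: "w x < w y \<longleftrightarrow> u x < u y" if "x \<le> b" "y \<le> b" for x y
  proof -
    have "u x \<le> b" "u y \<le> b" using that stab by auto
    then show ?thesis by (auto simp: w)
  qed
  have below: "u x = x" if "x < l" for x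
    using id[of x] that stab[of x] \<open>l \<le> a\<close> \<open>a \<le> b\<close> by (auto simp: w split: if_splits)
  have above: "u x = x" if "r < x" for x
    using id[of x] large[of x] that \<open>y0 \<le> r\<close> \<open>b < y0\<close> by auto
  have "y0 = r"
  proof (rule ccontr)
    assume "y0 \<noteq> r"
    then have "y0 < r" using \<open>y0 \<le> r\<close> by simp
    then show False using av213[of x1 y0 r] large[of r] w0 w1 \<open>l \<le> x1\<close> \<open>x1 \<le> b\<close> \<open>b < y0\<close> \<open>a \<le> b\<close> by auto
  qed
  have "(\<exists>l' r'. rev_layered l' r' u) \<and>
    (\<forall>x s t. x < s \<and> s < t \<and> t < y0 \<and> a \<le> u x \<and> u x \<le> b \<longrightarrow> \<not> (u s < u x \<and> u x < u t))"
  proof (cases "Suc b = r")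
    case True
    have "rev_layered l b u"
    proof (rule rev_layered_restrict[OF RL])
      show "u x = x" if "b < x" for x
        using that above y0 \<open>y0 = r\<close> True by (cases "x = r") auto
    qed (use low below True in auto)
    moreover have "\<not> (u s < u x \<and> u x < u t)" if "x < s" "s < t" "t < y0" "a \<le> u x" "u x \<le> b" for s t x
    proof -
      have "l \<le> x" using below[of x] that(4) \<open>l \<le> a\<close> by (cases "x < l") auto
      then show ?thesis using av213[of x s t] low[of s x] low[of x t] that True \<open>y0 = r\<close> by auto
    qed
    ultimately show ?thesis by blast
  next
    case False
    then have "Suc b < r" using \<open>y0 = r\<close> \<open>b < y0\<close> by simp
    then have lr: "Suc b < w (r - 1)" using large[of "r - 1"] \<open>y0 = r\<close> by simp
    have wb: "w x \<le> Suc b" if "x \<le> b" for x using that stab[of x] by (auto simp: w)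
    have "a = l"
    proof (rule ccontr)
      assume "a \<noteq> l"
      then have "l < a" using \<open>l \<le> a\<close> by simp
      obtain z where z: "w z = l" using bij_is_surj[OF \<open>bij w\<close>] by (metis surjD)
      have "l \<le> z" using id[of z] z by (cases "z < l") auto
      moreover have "z \<le> b" using large[of z] z w0 \<open>l < a\<close> \<open>a \<le> b\<close> by (cases "z = y0"; cases "b < z") auto
      moreover have "z < r - 1" "r - 1 < r" using \<open>z \<le> b\<close> \<open>Suc b < r\<close> by auto
      ultimately show False
        using av132[of z "r - 1" r] lr w0 z \<open>y0 = r\<close> \<open>l < a\<close> \<open>Suc b < r\<close> \<open>a \<le> b\<close> by auto
    qed
    have mono: "u x < u y" if "l \<le> x" "x < y" "y \<le> b" for x y
    proof -
      have "\<not> w y < w x" using av213[of x y "r - 1"] lr wb[of x] that \<open>Suc b < r\<close> by auto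
      moreover have "u x \<noteq> u y" using inj that by simp
      ultimately show ?thesis using low[of y x] that by auto
    qed
    have img: "u x \<in> {l..b}" if "x \<in> {l..b}" for x
    proof -
      have "\<not> u x < l"
      proof
        assume "u x < l"
        then have "u (u x) = u x" using below by blast
        then show False using inj(1)[of "u x" x] \<open>u x < l\<close> that by simp
      qed
      then show ?thesis using that stab[of x] by auto
    qed
    have fix_below: "u x = x" if "x \<le> b" for x
      using increasing_self_map_id[of l b u x, OF mono img] below that by (cases "l \<le> x") auto
    have ord: "u x < u y \<longleftrightarrow> w x < w y" if "b < x" "b < y" for x y
      using large[of x] large[of y] that y0 w0 \<open>a \<le> b\<close> by (cases "x = y0"; cases "y = y0") auto
    have "l \<le> Suc b" using \<open>l \<le> a\<close> \<open>a \<le> b\<close> by simp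
    have "rev_layered (Suc b) r u"
      by (rule rev_layered_restrict[OF RL]) (use ord above fix_below \<open>l \<le> Suc b\<close> in auto)
    moreover have "\<not> (u s < u x \<and> u x < u t)" if "x < s" "u x \<le> b" for s t x
      using fix_below[of x] fix_below[of s] stab[of x] stab[of s] that by (cases "s \<le> b") auto
    ultimately show ?thesis by blast
  qed
  then show "\<exists>l' r'. rev_layered l' r' u"
    "\<And>x s t y. \<lbrakk>u y = Suc b; x < s; s < t; t < y; a \<le> u x; u x \<le> b\<rbrakk> \<Longrightarrow> \<not> (u s < u x \<and> u x < u t)"
    using inj(1)[of _ y0] y0 by auto
qed

lemma hook_word_intervals:
  assumes "\<And>i. 1 < i \<Longrightarrow> i \<le> m \<Longrightarrow> b i \<notin> (\<Union>j\<in>{1..<i}. set (interval_word (a j) (b j)))"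
    and "rev_layered l r (word_perm (concat (map (\<lambda>i. interval_word (a i) (b i)) (rev [1..<Suc m]))))"
  shows "hook_word (concat (map (\<lambda>i. interval_word (a i) (b i)) (rev [1..<Suc m])))"
  using assms
proof (induction m arbitrary: l r)
  case (Suc m)
  define us where "us = concat (map (\<lambda>i. interval_word (a i) (b i)) (rev [1..<Suc m]))"
  let ?a = "a (Suc m)" and ?b = "b (Suc m)"
  have ws: "concat (map (\<lambda>i. interval_word (a i) (b i)) (rev [1..<Suc (Suc m)])) = interval_word ?a ?b @ us"
    by (simp add: us_def)
  have set_us: "set us = (\<Union>j\<in>{1..<Suc m}. set (interval_word (a j) (b j)))"
    unfolding us_def by (simp del: upt_Suc)
  have "?b \<notin> set us"
  proof (cases "m = 0")
    case False then show ?thesis unfolding set_us using Suc(2)[of "Suc m"] by simp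
  qed (simp add: us_def)
  note stab = word_perm_le_iff[OF this]
  have RL: "rev_layered l r (word_perm (interval_word ?a ?b @ us))" using Suc(3) unfolding ws .
  have IH: "hook_word us" if "rev_layered l' r' (word_perm us)" for l' r'
    using Suc(1)[of l' r'] Suc(2) that unfolding us_def by simp
  show ?case unfolding ws
  proof (cases "?b \<le> ?a")
    case True
    then have iw: "interval_word ?a ?b = rev [?b..<?b + (Suc ?a - ?b)]" by (auto simp: interval_word_def)
    have w: "word_perm (interval_word ?a ?b @ us) z = (if word_perm us z = ?b then Suc ?a
        else if ?b < word_perm us z \<and> word_perm us z \<le> Suc ?a then word_perm us z - 1 else word_perm us z)" for z
      using True unfolding iw word_perm_append comp_apply by (subst word_perm_descending) auto
    note unwind = rev_layered_unwind_descending[OF RL bij_word_perm bij_word_perm stab True w]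
    have "hook_word (rev [?b..<?b + (Suc ?a - ?b)] @ us)"
    proof (rule hook_word_descending[OF _ stab])
      show "hook_word us" using unwind(1) IH by blast
      show "\<not> (word_perm us s < word_perm us y \<and> word_perm us y < word_perm us t)"
        if "word_perm us x = ?b" "x < s" "s < t" "t < y" "?b < word_perm us y" "word_perm us y \<le> ?b + (Suc ?a - ?b)"
        for x s t y using unwind(2)[OF that(1-5)] that(6) True by simp
    qed
    then show "hook_word (interval_word ?a ?b @ us)" unfolding iw .
  next
    case False
    then have iw: "interval_word ?a ?b = [Suc ?b - (Suc ?b - ?a)..<Suc ?b]" by (auto simp: interval_word_def)
    have w: "word_perm (interval_word ?a ?b @ us) z = (if word_perm us z = Suc ?b then ?a
        else if ?a \<le> word_perm us z \<and> word_perm us z \<le> ?b then Suc (word_perm us z) else word_perm us z)" for z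
      using False unfolding iw word_perm_append comp_apply by (subst word_perm_ascending) auto
    have "?a \<le> ?b" using False by simp
    note unwind = rev_layered_unwind_ascending[OF RL bij_word_perm bij_word_perm stab this w]
    have "hook_word ([Suc ?b - (Suc ?b - ?a)..<Suc ?b] @ us)"
    proof (rule hook_word_ascending[OF _ stab])
      show "hook_word us" using unwind(1) IH by blast
      show "\<not> (word_perm us s < word_perm us x \<and> word_perm us x < word_perm us t)"
        if "word_perm us y = Suc ?b" "x < s" "s < t" "t < y" "Suc ?b - (Suc ?b - ?a) \<le> word_perm us x" "word_perm us x \<le> ?b"
        for x s t y using unwind(2)[OF that(1-4) _ that(6)] that(5) False by simp
    qed simp
    then show "hook_word (interval_word ?a ?b @ us)" unfolding iw .
  qed
qed simp

section \<open>Left modules: submodules, quotients and tops\<close>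

context lmodule
begin

lemma smult_l_null: assumes "x \<in> carrier M" shows "\<zero>\<^bsub>R\<^esub> \<odot>\<^bsub>M\<^esub> x = \<zero>\<^bsub>M\<^esub>"
proof -
  have "\<zero>\<^bsub>R\<^esub> \<odot>\<^bsub>M\<^esub> x = \<zero>\<^bsub>R\<^esub> \<odot>\<^bsub>M\<^esub> x \<oplus>\<^bsub>M\<^esub> \<zero>\<^bsub>R\<^esub> \<odot>\<^bsub>M\<^esub> x"
    using smult_l_distr[of "\<zero>\<^bsub>R\<^esub>" "\<zero>\<^bsub>R\<^esub>" x] assms by simp
  then show ?thesis using assms smult_closed by (metis M.add.r_cancel_one' R.zero_closed)
qed

lemma smult_r_null: assumes "r \<in> carrier R" shows "r \<odot>\<^bsub>M\<^esub> \<zero>\<^bsub>M\<^esub> = \<zero>\<^bsub>M\<^esub>"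
proof -
  have "r \<odot>\<^bsub>M\<^esub> \<zero>\<^bsub>M\<^esub> = r \<odot>\<^bsub>M\<^esub> \<zero>\<^bsub>M\<^esub> \<oplus>\<^bsub>M\<^esub> r \<odot>\<^bsub>M\<^esub> \<zero>\<^bsub>M\<^esub>"
    using smult_r_distr[of r "\<zero>\<^bsub>M\<^esub>" "\<zero>\<^bsub>M\<^esub>"] assms by simp
  then show ?thesis using assms smult_closed by (metis M.add.r_cancel_one' M.zero_closed)
qed

lemma smult_minus_one: assumes "x \<in> carrier M" shows "(\<ominus>\<^bsub>R\<^esub> \<one>\<^bsub>R\<^esub>) \<odot>\<^bsub>M\<^esub> x = \<ominus>\<^bsub>M\<^esub> x"
proof -
  have "(\<ominus>\<^bsub>R\<^esub> \<one>\<^bsub>R\<^esub>) \<odot>\<^bsub>M\<^esub> x \<oplus>\<^bsub>M\<^esub> x = (\<ominus>\<^bsub>R\<^esub> \<one>\<^bsub>R\<^esub> \<oplus>\<^bsub>R\<^esub> \<one>\<^bsub>R\<^esub>) \<odot>\<^bsub>M\<^esub> x"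
    using assms by (simp add: smult_l_distr)
  also have "\<dots> = \<zero>\<^bsub>M\<^esub>" using assms smult_l_null by (simp add: R.l_neg)
  finally show ?thesis using assms by (intro M.minus_equality[symmetric]) auto
qed

lemma submoduleI:
  assumes sub: "N \<subseteq> carrier M" and zero: "\<zero>\<^bsub>M\<^esub> \<in> N"
    and add: "\<And>x y. x \<in> N \<Longrightarrow> y \<in> N \<Longrightarrow> x \<oplus>\<^bsub>M\<^esub> y \<in> N"
    and smult: "\<And>r x. r \<in> carrier R \<Longrightarrow> x \<in> N \<Longrightarrow> r \<odot>\<^bsub>M\<^esub> x \<in> N"
  shows "submodule N R M"
proof (intro submodule.intro subgroup.intro submodule_axioms.intro)
  fix x assume x: "x \<in> N"
  then have "\<ominus>\<^bsub>M\<^esub> x \<in> N" using smult[of "\<ominus>\<^bsub>R\<^esub> \<one>\<^bsub>R\<^esub>" x] smult_minus_one[of x] sub by auto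
  then show "inv\<^bsub>add_monoid M\<^esub> x \<in> N" by (simp add: a_inv_def)
qed (use assms in auto)

lemma carrier_submodule: "submodule (carrier M) R M"
  by (rule submoduleI) auto

end

lemma submoduleD:
  assumes "submodule N R M"
  shows "N \<subseteq> carrier M" "\<zero>\<^bsub>M\<^esub> \<in> N" "\<And>x y. x \<in> N \<Longrightarrow> y \<in> N \<Longrightarrow> x \<oplus>\<^bsub>M\<^esub> y \<in> N"
    "\<And>r x. r \<in> carrier R \<Longrightarrow> x \<in> N \<Longrightarrow> r \<odot>\<^bsub>M\<^esub> x \<in> N" "\<And>x. x \<in> N \<Longrightarrow> \<ominus>\<^bsub>M\<^esub> x \<in> N"
proof -
  interpret submodule N R M by (rule assms)
  show "N \<subseteq> carrier M" "\<zero>\<^bsub>M\<^esub> \<in> N" "\<And>x y. x \<in> N \<Longrightarrow> y \<in> N \<Longrightarrow> x \<oplus>\<^bsub>M\<^esub> y \<in> N"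
    "\<And>r x. r \<in> carrier R \<Longrightarrow> x \<in> N \<Longrightarrow> r \<odot>\<^bsub>M\<^esub> x \<in> N" "\<And>x. x \<in> N \<Longrightarrow> \<ominus>\<^bsub>M\<^esub> x \<in> N"
    using subset one_closed m_closed m_inv_closed smult_closed by (simp_all add: a_inv_def)
qed

lemma lmodule_sub:
  assumes "lmodule R M" "submodule N R M"
  shows "lmodule R (sub_lmod M N)"
proof -
  interpret lmodule R M by fact
  note N = submoduleD[OF assms(2)]
  have "abelian_group (sub_lmod M N)"
  proof (rule abelian_groupI)
    fix x assume x: "x \<in> carrier (sub_lmod M N)"
    then show "\<exists>y\<in>carrier (sub_lmod M N). y \<oplus>\<^bsub>sub_lmod M N\<^esub> x = \<zero>\<^bsub>sub_lmod M N\<^esub>"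
      using N(1,5) by (intro bexI[of _ "\<ominus>\<^bsub>M\<^esub> x"]) (auto simp: M.l_neg)
  qed (use N(1-3) in \<open>auto simp: M.a_ac subset_iff\<close>)
  then show ?thesis
    using N(1,4) by (intro lmodule.intro lmodule_axioms.intro R.ring_axioms)
      (auto simp: smult_l_distr smult_r_distr smult_assoc1 subset_iff)
qed

lemma submodule_sub_iff:
  assumes "lmodule R M" "submodule N R M"
  shows "submodule L R (sub_lmod M N) \<longleftrightarrow> submodule L R M \<and> L \<subseteq> N"
proof
  assume L: "submodule L R (sub_lmod M N)"
  note D = submoduleD[OF L] and N = submoduleD[OF assms(2)]
  show "submodule L R M \<and> L \<subseteq> N"
    using D N(1) by (auto intro!: lmodule.submoduleI[OF assms(1)])
next
  assume L: "submodule L R M \<and> L \<subseteq> N"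
  note D = submoduleD[OF conjunct1[OF L]]
  show "submodule L R (sub_lmod M N)"
    using D L by (auto intro!: lmodule.submoduleI[OF lmodule_sub[OF assms]])
qed

lemma abelian_subgroup_submodule:
  assumes "lmodule R M" "submodule N R M"
  shows "abelian_subgroup N M"
proof (rule abelian_subgroupI3)
  show "abelian_group M" using assms(1) by (simp add: lmodule_def)
  show "additive_subgroup N M" using assms(2) by (simp add: additive_subgroup_def submodule_def)
qed

lemma coset_eq_iff:
  assumes "lmodule R M" "submodule N R M" "x \<in> carrier M" "y \<in> carrier M"
  shows "N +>\<^bsub>M\<^esub> x = N +>\<^bsub>M\<^esub> y \<longleftrightarrow> x \<ominus>\<^bsub>M\<^esub> y \<in> N"
proof -
  interpret abelian_subgroup N M using assms abelian_subgroup_submodule by blast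
  have "x \<in> N +>\<^bsub>M\<^esub> y \<longleftrightarrow> x \<ominus>\<^bsub>M\<^esub> y \<in> N" using a_rcos_module[OF assms(4,3)] by (simp add: a_minus_def)
  then show ?thesis using a_repr_independence' a_repr_independenceD assms(3,4) by metis
qed

lemma coset_zero_iff:
  assumes "lmodule R M" "submodule N R M" "x \<in> carrier M"
  shows "N +>\<^bsub>M\<^esub> x = N \<longleftrightarrow> x \<in> N"
proof -
  interpret abelian_subgroup N M using assms abelian_subgroup_submodule by blast
  show ?thesis using a_rcos_const a_rcos_self assms(3) by blast
qed

lemma quot_lmod_simps:
  assumes "lmodule R M" "submodule N R M"
  shows "carrier (quot_lmod M N) = (\<lambda>x. N +>\<^bsub>M\<^esub> x) ` carrier M" "\<zero>\<^bsub>quot_lmod M N\<^esub> = N"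
    "\<And>x y. x \<in> carrier M \<Longrightarrow> y \<in> carrier M \<Longrightarrow>
      (N +>\<^bsub>M\<^esub> x) \<oplus>\<^bsub>quot_lmod M N\<^esub> (N +>\<^bsub>M\<^esub> y) = N +>\<^bsub>M\<^esub> (x \<oplus>\<^bsub>M\<^esub> y)"
    "\<And>r x. r \<in> carrier R \<Longrightarrow> x \<in> carrier M \<Longrightarrow> r \<odot>\<^bsub>quot_lmod M N\<^esub> (N +>\<^bsub>M\<^esub> x) = N +>\<^bsub>M\<^esub> (r \<odot>\<^bsub>M\<^esub> x)"
proof -
  interpret M: lmodule R M by fact
  interpret N: abelian_subgroup N M using assms abelian_subgroup_submodule by blast
  show "carrier (quot_lmod M N) = (\<lambda>x. N +>\<^bsub>M\<^esub> x) ` carrier M" "\<zero>\<^bsub>quot_lmod M N\<^esub> = N"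
    by (auto simp: quot_lmod_def A_RCOSETS_def')
  show "(N +>\<^bsub>M\<^esub> x) \<oplus>\<^bsub>quot_lmod M N\<^esub> (N +>\<^bsub>M\<^esub> y) = N +>\<^bsub>M\<^esub> (x \<oplus>\<^bsub>M\<^esub> y)"
    if "x \<in> carrier M" "y \<in> carrier M" for x y
    using that by (simp add: quot_lmod_def N.a_rcos_sum)
  show "r \<odot>\<^bsub>quot_lmod M N\<^esub> (N +>\<^bsub>M\<^esub> x) = N +>\<^bsub>M\<^esub> (r \<odot>\<^bsub>M\<^esub> x)" if r: "r \<in> carrier R" and x: "x \<in> carrier M" for r x
  proof -
    have "N +>\<^bsub>M\<^esub> (r \<odot>\<^bsub>M\<^esub> y) = N +>\<^bsub>M\<^esub> (r \<odot>\<^bsub>M\<^esub> x)" if y: "y \<in> N +>\<^bsub>M\<^esub> x" for y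
    proof -
      obtain h where h: "h \<in> N" "y = h \<oplus>\<^bsub>M\<^esub> x" using y by (auto simp: a_r_coset_def')
      then have hc: "h \<in> carrier M" using N.a_Hcarr by blast
      have "r \<odot>\<^bsub>M\<^esub> y = r \<odot>\<^bsub>M\<^esub> h \<oplus>\<^bsub>M\<^esub> r \<odot>\<^bsub>M\<^esub> x" using h hc r x by (simp add: M.smult_r_distr)
      moreover have "r \<odot>\<^bsub>M\<^esub> h \<in> N" using submoduleD(4)[OF assms(2) r h(1)] .
      ultimately have "r \<odot>\<^bsub>M\<^esub> y \<in> N +>\<^bsub>M\<^esub> (r \<odot>\<^bsub>M\<^esub> x)" by (auto simp: a_r_coset_def')
      then show ?thesis using N.a_repr_independence' r x by auto
    qed
    moreover have "N +>\<^bsub>M\<^esub> x \<noteq> {}" using N.a_rcos_self[OF x] by (metis empty_iff)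
    ultimately have "(\<Union>y\<in>N +>\<^bsub>M\<^esub> x. N +>\<^bsub>M\<^esub> (r \<odot>\<^bsub>M\<^esub> y)) = N +>\<^bsub>M\<^esub> (r \<odot>\<^bsub>M\<^esub> x)"
      by (intro SUP_eq_const)
    then show ?thesis unfolding quot_lmod_def by simp
  qed
qed

lemma lmodule_quot:
  assumes "lmodule R M" "submodule N R M"
  shows "lmodule R (quot_lmod M N)"
proof -
  interpret M: lmodule R M by fact
  note S = quot_lmod_simps[OF assms]
  have "abelian_group (quot_lmod M N)"
  proof (rule abelian_groupI)
    show "\<zero>\<^bsub>quot_lmod M N\<^esub> \<in> carrier (quot_lmod M N)"
      using coset_zero_iff[OF assms M.zero_closed] submoduleD(2)[OF assms(2)] unfolding S(1,2) by auto
    fix x assume x: "x \<in> carrier (quot_lmod M N)"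
    then obtain x' where x': "x = N +>\<^bsub>M\<^esub> x'" "x' \<in> carrier M" unfolding S(1) by auto
    have z: "\<zero>\<^bsub>quot_lmod M N\<^esub> = N +>\<^bsub>M\<^esub> \<zero>\<^bsub>M\<^esub>"
      using coset_zero_iff[OF assms M.zero_closed] submoduleD(2)[OF assms(2)] unfolding S(2) by auto
    show "\<zero>\<^bsub>quot_lmod M N\<^esub> \<oplus>\<^bsub>quot_lmod M N\<^esub> x = x"
      unfolding z x'(1) using x'(2) by (simp add: S(3))
    show "\<exists>y\<in>carrier (quot_lmod M N). y \<oplus>\<^bsub>quot_lmod M N\<^esub> x = \<zero>\<^bsub>quot_lmod M N\<^esub>"
      unfolding z x'(1) S(1) using x'(2) by (intro bexI[of _ "N +>\<^bsub>M\<^esub> (\<ominus>\<^bsub>M\<^esub> x')"]) (auto simp: S(3) M.l_neg)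
  qed (auto simp: S(1,3) M.a_ac)
  then show ?thesis
  proof (intro lmodule.intro lmodule_axioms.intro M.R.ring_axioms)
    fix r s x y
    assume r: "r \<in> carrier R" and x: "x \<in> carrier (quot_lmod M N)"
    obtain x' where x': "x = N +>\<^bsub>M\<^esub> x'" "x' \<in> carrier M" using x unfolding S(1) by blast
    show "r \<odot>\<^bsub>quot_lmod M N\<^esub> x \<in> carrier (quot_lmod M N)"
      unfolding x'(1) S(4)[OF r x'(2)] unfolding S(1) using r x'(2) by simp
    show "r \<odot>\<^bsub>quot_lmod M N\<^esub> (x \<oplus>\<^bsub>quot_lmod M N\<^esub> y) = r \<odot>\<^bsub>quot_lmod M N\<^esub> x \<oplus>\<^bsub>quot_lmod M N\<^esub> r \<odot>\<^bsub>quot_lmod M N\<^esub> y"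
      if y: "y \<in> carrier (quot_lmod M N)"
    proof -
      obtain y' where y': "y = N +>\<^bsub>M\<^esub> y'" "y' \<in> carrier M" using y unfolding S(1) by blast
      show ?thesis unfolding x'(1) y'(1) using r x'(2) y'(2) by (simp add: S(3,4) M.smult_r_distr)
    qed
    assume s: "s \<in> carrier R"
    show "(r \<oplus>\<^bsub>R\<^esub> s) \<odot>\<^bsub>quot_lmod M N\<^esub> x = r \<odot>\<^bsub>quot_lmod M N\<^esub> x \<oplus>\<^bsub>quot_lmod M N\<^esub> s \<odot>\<^bsub>quot_lmod M N\<^esub> x"
      unfolding x'(1) using r s x'(2) by (simp add: S(3,4) M.smult_l_distr)
    show "(r \<otimes>\<^bsub>R\<^esub> s) \<odot>\<^bsub>quot_lmod M N\<^esub> x = r \<odot>\<^bsub>quot_lmod M N\<^esub> (s \<odot>\<^bsub>quot_lmod M N\<^esub> x)"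
      unfolding x'(1) using r s x'(2) by (simp add: S(4) M.smult_assoc1)
  next
    fix x assume "x \<in> carrier (quot_lmod M N)"
    then obtain x' where x': "x = N +>\<^bsub>M\<^esub> x'" "x' \<in> carrier M" unfolding S(1) by blast
    show "\<one>\<^bsub>R\<^esub> \<odot>\<^bsub>quot_lmod M N\<^esub> x = x"
      unfolding x'(1) using x'(2) by (simp add: S(4))
  qed
qed

text \<open>The part of the correspondence theorem that reduces submodules of a quotient to submodules of
  the module.\<close>
lemma submodule_coset_preimage:
  assumes "lmodule R M" "submodule N R M" "submodule L R (quot_lmod M N)"
  shows "submodule {x \<in> carrier M. N +>\<^bsub>M\<^esub> x \<in> L} R M" "N \<subseteq> {x \<in> carrier M. N +>\<^bsub>M\<^esub> x \<in> L}"
proof -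
  interpret M: lmodule R M by fact
  note S = quot_lmod_simps[OF assms(1,2)] and N = submoduleD[OF assms(2)]
  note L = submoduleD[OF assms(3), unfolded S(2)]
  show "N \<subseteq> {x \<in> carrier M. N +>\<^bsub>M\<^esub> x \<in> L}"
  proof
    fix x assume x: "x \<in> N"
    then have "x \<in> carrier M" using N(1) by blast
    with x have "N +>\<^bsub>M\<^esub> x = N" using coset_zero_iff[OF assms(1,2)] by simp
    then show "x \<in> {x \<in> carrier M. N +>\<^bsub>M\<^esub> x \<in> L}" using L(2) \<open>x \<in> carrier M\<close> by simp
  qed
  then have zero: "\<zero>\<^bsub>M\<^esub> \<in> {x \<in> carrier M. N +>\<^bsub>M\<^esub> x \<in> L}" using N(2) by blast
  show "submodule {x \<in> carrier M. N +>\<^bsub>M\<^esub> x \<in> L} R M"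
  proof (rule M.submoduleI[OF _ zero])
    fix x y assume "x \<in> {x \<in> carrier M. N +>\<^bsub>M\<^esub> x \<in> L}" "y \<in> {x \<in> carrier M. N +>\<^bsub>M\<^esub> x \<in> L}"
    then show "x \<oplus>\<^bsub>M\<^esub> y \<in> {x \<in> carrier M. N +>\<^bsub>M\<^esub> x \<in> L}"
      using L(3)[of "N +>\<^bsub>M\<^esub> x" "N +>\<^bsub>M\<^esub> y"] S(3)[of x y] by simp
  next
    fix r x assume "r \<in> carrier R" "x \<in> {x \<in> carrier M. N +>\<^bsub>M\<^esub> x \<in> L}"
    then show "r \<odot>\<^bsub>M\<^esub> x \<in> {x \<in> carrier M. N +>\<^bsub>M\<^esub> x \<in> L}"
      using L(4)[of r "N +>\<^bsub>M\<^esub> x"] S(4)[of r x] by simp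
  qed blast
qed

text \<open>If all proper submodules lie in one proper submodule \<open>N\<close>, then \<open>N\<close> is the radical, and the
  submodules of the quotient by \<open>N\<close> correspond to the submodules above \<open>N\<close>, of which there are two.\<close>

lemma simple_top_if_largest_proper:
  assumes M: "lmodule R M" and N: "submodule N R M" "N \<noteq> carrier M"
    and largest: "\<And>L. submodule L R M \<Longrightarrow> L \<noteq> carrier M \<Longrightarrow> L \<subseteq> N"
  shows "simple_lmod R (top_lmod R M)"
proof -
  interpret M: lmodule R M by fact
  have "maximal_submodule N R M"
    using N largest unfolding maximal_submodule_def by blast
  moreover have "L = N" if "maximal_submodule L R M" for L
    using that N largest unfolding maximal_submodule_def by metis
  ultimately have rad: "radical R M = N"
    using submoduleD(1)[OF N(1)] unfolding radical_def by blast
  note S = quot_lmod_simps[OF M N(1)]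
  show ?thesis unfolding simple_lmod_def top_lmod_def rad S(2)
  proof (intro conjI allI impI)
    show "lmodule R (quot_lmod M N)" by (rule lmodule_quot[OF M N(1)])
    show "carrier (quot_lmod M N) \<noteq> {N}"
    proof
      assume *: "carrier (quot_lmod M N) = {N}"
      have "x \<in> N" if x: "x \<in> carrier M" for x
      proof -
        have "N +>\<^bsub>M\<^esub> x \<in> {N}" using x unfolding *[symmetric] S(1) by (rule imageI)
        then show ?thesis using coset_zero_iff[OF M N(1) x] by simp
      qed
      then show False using N(2) submoduleD(1)[OF N(1)] by auto
    qed
    fix L assume L: "submodule L R (quot_lmod M N)"
    let ?L = "{x \<in> carrier M. N +>\<^bsub>M\<^esub> x \<in> L}"
    have img: "L = (\<lambda>x. N +>\<^bsub>M\<^esub> x) ` ?L" using submoduleD(1)[OF L] unfolding S(1) by auto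
    note pre = submodule_coset_preimage[OF M N(1) L]
    show "L = {N} \<or> L = carrier (quot_lmod M N)"
    proof (cases "?L = carrier M")
      case True then show ?thesis using img S(1) by simp
    next
      case False
      then have "?L = N" using largest[OF pre(1)] pre(2) by blast
      then have "L = (\<lambda>x. N +>\<^bsub>M\<^esub> x) ` N" using img by simp
      moreover have "N +>\<^bsub>M\<^esub> x = N" if "x \<in> N" for x
        using that coset_zero_iff[OF M N(1)] submoduleD(1)[OF N(1)] by auto
      ultimately have "L = {N}" using submoduleD(2)[OF N(1)] by (auto intro: image_eqI)
      then show ?thesis ..
    qed
  qed
qed

section \<open>Generators of the path algebra\<close>

definition vtx :: "nat \<Rightarrow> nat \<Rightarrow> nat list \<Rightarrow> complex"
  where "vtx n c = (\<lambda>p. if c \<in> {1..<n} \<and> p = [c] then 1 else 0)"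

definition raise_elem :: "nat \<Rightarrow> nat list \<Rightarrow> complex"
  where "raise_elem n = (\<lambda>p. if \<exists>c\<in>{1..<n - 1}. p = [Suc c, c] then 1 else 0)"

definition lower_elem :: "nat \<Rightarrow> nat list \<Rightarrow> complex"
  where "lower_elem n = (\<lambda>p. if \<exists>c\<in>{1..<n - 1}. p = [c, Suc c] then 1 else 0)"

definition scalar_elem :: "nat \<Rightarrow> complex \<Rightarrow> nat list \<Rightarrow> complex"
  where "scalar_elem n z = (\<lambda>p. if \<exists>c\<in>{1..<n}. p = [c] then z else 0)"

lemma generators_closed:
  "vtx n c \<in> carrier (path_algebra n)" "raise_elem n \<in> carrier (path_algebra n)"
  "lower_elem n \<in> carrier (path_algebra n)" "scalar_elem n z \<in> carrier (path_algebra n)"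
proof -
  show "vtx n c \<in> carrier (path_algebra n)"
    by (auto simp: path_algebra_simps vtx_def quiver_paths_def intro!: finite_subset[of _ "{[c]}"] split: if_splits)
  show "raise_elem n \<in> carrier (path_algebra n)"
    by (auto simp: path_algebra_simps raise_elem_def quiver_paths_def nth_Cons' split: if_splits
        intro!: finite_subset[of _ "(\<lambda>c. [Suc c, c]) ` {1..<n - 1}"])
  show "lower_elem n \<in> carrier (path_algebra n)"
    by (auto simp: path_algebra_simps lower_elem_def quiver_paths_def nth_Cons' split: if_splits
        intro!: finite_subset[of _ "(\<lambda>c. [c, Suc c]) ` {1..<n - 1}"])
  show "scalar_elem n z \<in> carrier (path_algebra n)"
    by (auto simp: path_algebra_simps scalar_elem_def quiver_paths_def split: if_splits
        intro!: finite_subset[of _ "(\<lambda>c. [c]) ` {1..<n}"])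
qed

text \<open>If one factor is homogeneous, only one of the cuts of a path contributes to the product.\<close>
lemma mult_homogeneous_left:
  assumes "\<And>p. length p \<noteq> Suc l \<Longrightarrow> f p = 0"
  shows "(f \<otimes>\<^bsub>path_algebra n\<^esub> g) p = (if l < length p then f (take (Suc l) p) * g (drop l p) else 0)"
proof -
  have "(f \<otimes>\<^bsub>path_algebra n\<^esub> g) p = (\<Sum>k<length p. if k = l then f (take (Suc l) p) * g (drop l p) else 0)"
    unfolding path_algebra_simps using assms by (intro sum.cong) (auto simp: min_def)
  then show ?thesis by simp
qed

lemma mult_homogeneous_right:
  assumes "\<And>p. length p \<noteq> Suc l \<Longrightarrow> g p = 0"
  shows "(f \<otimes>\<^bsub>path_algebra n\<^esub> g) p =
    (if l < length p then f (take (length p - l) p) * g (drop (length p - Suc l) p) else 0)"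
proof -
  have "(f \<otimes>\<^bsub>path_algebra n\<^esub> g) p = (\<Sum>k<length p. if k = length p - Suc l \<and> l < length p
      then f (take (length p - l) p) * g (drop (length p - Suc l) p) else 0)"
    unfolding path_algebra_simps using assms
    by (intro sum.cong) (auto simp: Suc_diff_Suc)
  then show ?thesis by (cases "l < length p") auto
qed

lemma generators_length:
  "length p \<noteq> Suc 0 \<Longrightarrow> vtx n c p = 0" "length p \<noteq> Suc 0 \<Longrightarrow> scalar_elem n z p = 0"
  "length p \<noteq> Suc (Suc 0) \<Longrightarrow> raise_elem n p = 0" "length p \<noteq> Suc (Suc 0) \<Longrightarrow> lower_elem n p = 0"
  by (auto simp: vtx_def scalar_elem_def raise_elem_def lower_elem_def)

lemma vtx_mult:
  "vtx n c \<otimes>\<^bsub>path_algebra n\<^esub> f = (\<lambda>p. if c \<in> {1..<n} \<and> p \<noteq> [] \<and> hd p = c then f p else 0)"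
proof
  fix p show "(vtx n c \<otimes>\<^bsub>path_algebra n\<^esub> f) p = (if c \<in> {1..<n} \<and> p \<noteq> [] \<and> hd p = c then f p else 0)"
    by (subst mult_homogeneous_left[where l = 0, OF generators_length(1)], assumption)
      (cases p, auto simp: vtx_def)
qed

lemma mult_vtx:
  "f \<otimes>\<^bsub>path_algebra n\<^esub> vtx n c = (\<lambda>p. if c \<in> {1..<n} \<and> p \<noteq> [] \<and> last p = c then f p else 0)"
proof
  fix p show "(f \<otimes>\<^bsub>path_algebra n\<^esub> vtx n c) p = (if c \<in> {1..<n} \<and> p \<noteq> [] \<and> last p = c then f p else 0)"
    by (subst mult_homogeneous_right[where l = 0, OF generators_length(1)], assumption)
      (cases p rule: rev_cases, auto simp: vtx_def)
qed

lemma scalar_mult: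
  assumes "f \<in> carrier (path_algebra n)"
  shows "scalar_elem n z \<otimes>\<^bsub>path_algebra n\<^esub> f = (\<lambda>p. z * f p)" "f \<otimes>\<^bsub>path_algebra n\<^esub> scalar_elem n z = (\<lambda>p. z * f p)"
proof -
  have z: "p \<noteq> [] \<and> set p \<subseteq> {1..<n}" if "f p \<noteq> 0" for p
    using that assms unfolding path_algebra_simps quiver_paths_def by blast
  show "scalar_elem n z \<otimes>\<^bsub>path_algebra n\<^esub> f = (\<lambda>p. z * f p)"
  proof
    fix p show "(scalar_elem n z \<otimes>\<^bsub>path_algebra n\<^esub> f) p = z * f p"
      by (subst mult_homogeneous_left[where l = 0, OF generators_length(2)], assumption)
        (use z[of p] in \<open>cases p, auto simp: scalar_elem_def\<close>)
  qed
  show "f \<otimes>\<^bsub>path_algebra n\<^esub> scalar_elem n z = (\<lambda>p. z * f p)"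
  proof
    fix p show "(f \<otimes>\<^bsub>path_algebra n\<^esub> scalar_elem n z) p = z * f p"
      by (subst mult_homogeneous_right[where l = 0, OF generators_length(2)], assumption)
        (use z[of p] in \<open>cases p rule: rev_cases, auto simp: scalar_elem_def\<close>)
  qed
qed

lemma raise_mult:
  "raise_elem n \<otimes>\<^bsub>path_algebra n\<^esub> f =
    (\<lambda>p. case p of x # y # q \<Rightarrow> if y \<in> {1..<n - 1} \<and> x = Suc y then f (y # q) else 0 | _ \<Rightarrow> 0)"
proof
  fix p show "(raise_elem n \<otimes>\<^bsub>path_algebra n\<^esub> f) p =
    (case p of x # y # q \<Rightarrow> if y \<in> {1..<n - 1} \<and> x = Suc y then f (y # q) else 0 | _ \<Rightarrow> 0)"
    by (subst mult_homogeneous_left[where l = "Suc 0", OF generators_length(3)], assumption)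
      (auto simp: raise_elem_def split: list.split)
qed

lemma lower_mult:
  "lower_elem n \<otimes>\<^bsub>path_algebra n\<^esub> f =
    (\<lambda>p. case p of x # y # q \<Rightarrow> if x \<in> {1..<n - 1} \<and> y = Suc x then f (y # q) else 0 | _ \<Rightarrow> 0)"
proof
  fix p show "(lower_elem n \<otimes>\<^bsub>path_algebra n\<^esub> f) p =
    (case p of x # y # q \<Rightarrow> if x \<in> {1..<n - 1} \<and> y = Suc x then f (y # q) else 0 | _ \<Rightarrow> 0)"
    by (subst mult_homogeneous_left[where l = "Suc 0", OF generators_length(4)], assumption)
      (auto simp: lower_elem_def split: list.split)
qed

lemma vtx_vtx: "vtx n c \<otimes>\<^bsub>path_algebra n\<^esub> vtx n d = (if c = d then vtx n c else (\<lambda>p. 0))"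
  unfolding vtx_mult by (auto simp: vtx_def fun_eq_iff)

lemma vtx_out: "c \<notin> {1..<n} \<Longrightarrow> vtx n c = (\<lambda>p. 0)"
  by (auto simp: vtx_def)

lemma vtx_raise: "vtx n (Suc c) \<otimes>\<^bsub>path_algebra n\<^esub> raise_elem n = raise_elem n \<otimes>\<^bsub>path_algebra n\<^esub> vtx n c"
  unfolding vtx_mult mult_vtx by (auto simp: raise_elem_def fun_eq_iff)

lemma vtx_lower: "vtx n c \<otimes>\<^bsub>path_algebra n\<^esub> lower_elem n = lower_elem n \<otimes>\<^bsub>path_algebra n\<^esub> vtx n (Suc c)"
  unfolding vtx_mult mult_vtx by (auto simp: lower_elem_def fun_eq_iff)

text \<open>The two sums of the defining relation are the products \<open>DU\<close> and \<open>UD\<close>: a product of arrows sums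
  vanishes except on the paths \<open>i, i \<plusminus> 1, i\<close>.\<close>
lemma preprojective_relation_eq:
  "lower_elem n \<otimes>\<^bsub>path_algebra n\<^esub> raise_elem n =
    preprojective_relation n \<oplus>\<^bsub>path_algebra n\<^esub> raise_elem n \<otimes>\<^bsub>path_algebra n\<^esub> lower_elem n"
proof
  fix p :: "nat list"
  have s: "preprojective_relation n p =
    (\<Sum>i\<in>{1..<n - 1}. path_elem [i, Suc i, i] p) - (\<Sum>i\<in>{1..<n - 1}. path_elem [Suc i, i, Suc i] p)"
    by (simp add: preprojective_relation_def sum_subtractf)
  have 1: "(\<Sum>i\<in>{1..<n - 1}. path_elem [i, Suc i, i] p) = (lower_elem n \<otimes>\<^bsub>path_algebra n\<^esub> raise_elem n) p"
  proof (cases "\<exists>i\<in>{1..<n - 1}. p = [i, Suc i, i]")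
    case True
    then obtain i where i: "i \<in> {1..<n - 1}" "p = [i, Suc i, i]" by blast
    have "(\<Sum>i\<in>{1..<n - 1}. path_elem [i, Suc i, i] p) = (\<Sum>k\<in>{1..<n - 1}. if k = i then 1 else 0)"
      unfolding path_elem_def i(2) by (intro sum.cong) auto
    then show ?thesis using i by (auto simp: lower_mult raise_elem_def)
  next
    case False
    then have "(\<Sum>i\<in>{1..<n - 1}. path_elem [i, Suc i, i] p) = 0"
      unfolding path_elem_def by (intro sum.neutral) auto
    then show ?thesis using False by (auto simp: lower_mult raise_elem_def split: list.split)
  qed
  have 2: "(\<Sum>i\<in>{1..<n - 1}. path_elem [Suc i, i, Suc i] p) = (raise_elem n \<otimes>\<^bsub>path_algebra n\<^esub> lower_elem n) p"
  proof (cases "\<exists>i\<in>{1..<n - 1}. p = [Suc i, i, Suc i]")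
    case True
    then obtain i where i: "i \<in> {1..<n - 1}" "p = [Suc i, i, Suc i]" by blast
    have "(\<Sum>i\<in>{1..<n - 1}. path_elem [Suc i, i, Suc i] p) = (\<Sum>k\<in>{1..<n - 1}. if k = i then 1 else 0)"
      unfolding path_elem_def i(2) by (intro sum.cong) auto
    then show ?thesis using i by (auto simp: raise_mult lower_elem_def)
  next
    case False
    then have "(\<Sum>i\<in>{1..<n - 1}. path_elem [Suc i, i, Suc i] p) = 0"
      unfolding path_elem_def by (intro sum.neutral) auto
    then show ?thesis using False by (auto simp: raise_mult lower_elem_def split: list.split)
  qed
  show "(lower_elem n \<otimes>\<^bsub>path_algebra n\<^esub> raise_elem n) p =
    (preprojective_relation n \<oplus>\<^bsub>path_algebra n\<^esub> raise_elem n \<otimes>\<^bsub>path_algebra n\<^esub> lower_elem n) p"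
    unfolding path_algebra_simps(5) s 1 2 by simp
qed

text \<open>Induction over the path algebra as an algebra generated by vertices and by \<open>U\<close> and \<open>D\<close>. A single
  arrow is not among the generators, but it is \<open>U\<close> or \<open>D\<close> cut off by a vertex.\<close>
lemma path_algebra_induct [consumes 1, case_names zero add scalar vtx vtx_times raise lower]:
  assumes f: "f \<in> carrier (path_algebra n)"
    and zero: "P (\<lambda>p. 0)"
    and add: "\<And>f g. \<lbrakk>f \<in> carrier (path_algebra n); g \<in> carrier (path_algebra n); P f; P g\<rbrakk> \<Longrightarrow> P (f \<oplus>\<^bsub>path_algebra n\<^esub> g)"
    and scalar: "\<And>z f. \<lbrakk>f \<in> carrier (path_algebra n); P f\<rbrakk> \<Longrightarrow> P (scalar_elem n z \<otimes>\<^bsub>path_algebra n\<^esub> f)"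
    and vtx: "\<And>c. P (vtx n c)" and vtx_times: "\<And>c f. \<lbrakk>f \<in> carrier (path_algebra n); P f\<rbrakk> \<Longrightarrow> P (vtx n c \<otimes>\<^bsub>path_algebra n\<^esub> f)"
    and raise: "\<And>f. \<lbrakk>f \<in> carrier (path_algebra n); P f\<rbrakk> \<Longrightarrow> P (raise_elem n \<otimes>\<^bsub>path_algebra n\<^esub> f)"
    and lower: "\<And>f. \<lbrakk>f \<in> carrier (path_algebra n); P f\<rbrakk> \<Longrightarrow> P (lower_elem n \<otimes>\<^bsub>path_algebra n\<^esub> f)"
  shows "P f"
proof -
  have path: "path_elem p \<in> carrier (path_algebra n) \<and> P (path_elem p)" if "p \<in> quiver_paths n" for p
    using that
  proof (induction p rule: induct_list012)
    case 1 then show ?case by (simp add: quiver_paths_def)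
  next
    case (2 c)
    then have "path_elem [c] = vtx n c" by (auto simp: path_elem_def vtx_def quiver_paths_def)
    then show ?case using vtx[of c] generators_closed by simp
  next
    case (3 x y q)
    then have xy: "y = Suc x \<or> x = Suc y" and in_n: "x \<in> {1..<n}" "y \<in> {1..<n}"
      by (auto simp: quiver_paths_def dest: spec[of _ 0])
    have "y # q \<in> quiver_paths n"
      using 3(3) by (auto simp: quiver_paths_def dest: spec[of _ "Suc k" for k])
    then have IH: "path_elem (y # q) \<in> carrier (path_algebra n)" "P (path_elem (y # q))"
      using 3 by auto
    have "path_elem (x # y # q) = (\<lambda>p. 0)
        \<or> path_elem (x # y # q) = vtx n x \<otimes>\<^bsub>path_algebra n\<^esub> (raise_elem n \<otimes>\<^bsub>path_algebra n\<^esub> path_elem (y # q))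
        \<or> path_elem (x # y # q) = vtx n x \<otimes>\<^bsub>path_algebra n\<^esub> (lower_elem n \<otimes>\<^bsub>path_algebra n\<^esub> path_elem (y # q))"
      using xy in_n
      by (auto simp: path_elem_def vtx_mult raise_mult lower_mult fun_eq_iff split: list.split)
    moreover have "path_elem (x # y # q) \<in> carrier (path_algebra n)"
      using 3(3) by (auto simp: path_algebra_simps path_elem_def)
    ultimately show ?case using IH zero vtx_times raise lower generators_closed path_algebra_mult_closed by metis
  qed
  have "finite S \<Longrightarrow> S \<subseteq> quiver_paths n \<Longrightarrow> {p. f p \<noteq> 0} \<subseteq> S \<Longrightarrow>
    f \<in> carrier (path_algebra n) \<and> P f" for S f
  proof (induction S arbitrary: f rule: finite_induct)
    case empty
    then have "f = (\<lambda>p. 0)" by auto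
    then show ?case using zero by (auto simp: path_algebra_simps)
  next
    case (insert q S)
    let ?g = "\<lambda>p. if p = q then 0 else f p"
    have g: "?g \<in> carrier (path_algebra n) \<and> P ?g"
      using insert(4,5) by (intro insert(3)) auto
    have q: "path_elem q \<in> carrier (path_algebra n)" "P (path_elem q)" using path insert by auto
    have "f = scalar_elem n (f q) \<otimes>\<^bsub>path_algebra n\<^esub> path_elem q \<oplus>\<^bsub>path_algebra n\<^esub> ?g"
      unfolding scalar_mult(1)[OF q(1)] by (auto simp: path_algebra_simps path_elem_def)
    moreover have "f \<in> carrier (path_algebra n)"
      using insert by (auto simp: path_algebra_simps intro: finite_subset)
    ultimately show ?case
      using add[of "scalar_elem n (f q) \<otimes>\<^bsub>path_algebra n\<^esub> path_elem q" ?g] scalar[OF q] g q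
        path_algebra_mult_closed generators_closed(4) by metis
  qed
  then show ?thesis using f by (auto simp: path_algebra_simps)
qed

section \<open>Modules over the preprojective algebra\<close>

text \<open>Elements of the preprojective algebra are cosets. It is easier to let the path algebra act
  through representatives.\<close>
definition act ::
    "nat \<Rightarrow> ((nat list \<Rightarrow> complex) set, 'b, 'y) module_scheme \<Rightarrow> (nat list \<Rightarrow> complex) \<Rightarrow> 'b \<Rightarrow> 'b"
  where "act n M f x = (Idl\<^bsub>path_algebra n\<^esub> {preprojective_relation n} +>\<^bsub>path_algebra n\<^esub> f) \<odot>\<^bsub>M\<^esub> x"

abbreviation "raise n M \<equiv> act n M (raise_elem n)"
abbreviation "lower n M \<equiv> act n M (lower_elem n)"
abbreviation "proj n M c \<equiv> act n M (vtx n c)"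
abbreviation "scale n M z \<equiv> act n M (scalar_elem n z)"

definition comp_at ::
    "nat \<Rightarrow> ((nat list \<Rightarrow> complex) set, 'b, 'y) module_scheme \<Rightarrow> nat \<Rightarrow> 'b set"
  where "comp_at n M c = {x \<in> carrier M. proj n M c x = x}"

definition shift ::
    "nat \<Rightarrow> ((nat list \<Rightarrow> complex) set, 'b, 'y) module_scheme \<Rightarrow> nat \<Rightarrow> nat \<Rightarrow> 'b \<Rightarrow> 'b"
  where "shift n M p q x = (raise n M ^^ p) ((lower n M ^^ q) x)"

lemma preprojective_algebra_simps:
  fixes n
  defines "I \<equiv> Idl\<^bsub>path_algebra n\<^esub> {preprojective_relation n}"
  assumes "f \<in> carrier (path_algebra n)" "g \<in> carrier (path_algebra n)"
  shows "I +>\<^bsub>path_algebra n\<^esub> f \<in> carrier (preprojective_algebra n)"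
    "(I +>\<^bsub>path_algebra n\<^esub> f) \<oplus>\<^bsub>preprojective_algebra n\<^esub> (I +>\<^bsub>path_algebra n\<^esub> g) =
      I +>\<^bsub>path_algebra n\<^esub> (f \<oplus>\<^bsub>path_algebra n\<^esub> g)"
    "(I +>\<^bsub>path_algebra n\<^esub> f) \<otimes>\<^bsub>preprojective_algebra n\<^esub> (I +>\<^bsub>path_algebra n\<^esub> g) =
      I +>\<^bsub>path_algebra n\<^esub> (f \<otimes>\<^bsub>path_algebra n\<^esub> g)"
    "\<one>\<^bsub>preprojective_algebra n\<^esub> = I +>\<^bsub>path_algebra n\<^esub> \<one>\<^bsub>path_algebra n\<^esub>"
    "\<zero>\<^bsub>preprojective_algebra n\<^esub> = I"
proof -
  interpret J: ideal I "path_algebra n" unfolding I_def by (rule ideal_preprojective)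
  show "I +>\<^bsub>path_algebra n\<^esub> f \<in> carrier (preprojective_algebra n)"
    using assms unfolding preprojective_algebra_carrier I_def by blast
  show "(I +>\<^bsub>path_algebra n\<^esub> f) \<oplus>\<^bsub>preprojective_algebra n\<^esub> (I +>\<^bsub>path_algebra n\<^esub> g) =
      I +>\<^bsub>path_algebra n\<^esub> (f \<oplus>\<^bsub>path_algebra n\<^esub> g)"
    using assms J.a_rcos_sum by (simp add: preprojective_algebra_def FactRing_def I_def)
  show "(I +>\<^bsub>path_algebra n\<^esub> f) \<otimes>\<^bsub>preprojective_algebra n\<^esub> (I +>\<^bsub>path_algebra n\<^esub> g) =
      I +>\<^bsub>path_algebra n\<^esub> (f \<otimes>\<^bsub>path_algebra n\<^esub> g)"
    using assms J.rcoset_mult_add by (simp add: preprojective_algebra_def FactRing_def I_def)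
  show "\<one>\<^bsub>preprojective_algebra n\<^esub> = I +>\<^bsub>path_algebra n\<^esub> \<one>\<^bsub>path_algebra n\<^esub>" "\<zero>\<^bsub>preprojective_algebra n\<^esub> = I"
    by (simp_all add: preprojective_algebra_def FactRing_def I_def)
qed

lemma act_sub_lmod [simp]: "act n (sub_lmod M N) = act n M"
  by (intro ext) (simp add: act_def)

locale preproj_module = lmodule "preprojective_algebra n" M
  for n :: nat and M :: "((nat list \<Rightarrow> complex) set, 'b, 'y) module_scheme"
begin

abbreviation "PA \<equiv> path_algebra n"

lemma lmod: "lmodule (preprojective_algebra n) M" by (rule lmodule_axioms)

lemma act_closed: "f \<in> carrier PA \<Longrightarrow> x \<in> carrier M \<Longrightarrow> act n M f x \<in> carrier M"
  unfolding act_def using preprojective_algebra_simps(1) by (intro smult_closed)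

lemma act_add: "f \<in> carrier PA \<Longrightarrow> x \<in> carrier M \<Longrightarrow> y \<in> carrier M \<Longrightarrow>
    act n M f (x \<oplus>\<^bsub>M\<^esub> y) = act n M f x \<oplus>\<^bsub>M\<^esub> act n M f y"
  unfolding act_def using preprojective_algebra_simps(1) by (intro smult_r_distr)

lemma add_act: "f \<in> carrier PA \<Longrightarrow> g \<in> carrier PA \<Longrightarrow> x \<in> carrier M \<Longrightarrow>
    act n M (f \<oplus>\<^bsub>PA\<^esub> g) x = act n M f x \<oplus>\<^bsub>M\<^esub> act n M g x"
  unfolding act_def using preprojective_algebra_simps(1,2)[of f n g] preprojective_algebra_simps(1)[of g n f]
  by (metis smult_l_distr)

lemma mult_act: "f \<in> carrier PA \<Longrightarrow> g \<in> carrier PA \<Longrightarrow> x \<in> carrier M \<Longrightarrow>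
    act n M (f \<otimes>\<^bsub>PA\<^esub> g) x = act n M f (act n M g x)"
  unfolding act_def using preprojective_algebra_simps(1,3)[of f n g] preprojective_algebra_simps(1)[of g n f]
  by (metis smult_assoc1)

lemma one_act: "x \<in> carrier M \<Longrightarrow> act n M \<one>\<^bsub>PA\<^esub> x = x"
  unfolding act_def using preprojective_algebra_simps(4)[OF path_algebra_one_closed path_algebra_one_closed]
  by (metis smult_one)

lemma ideal_act:
  assumes "f \<in> Idl\<^bsub>PA\<^esub> {preprojective_relation n}" "x \<in> carrier M"
  shows "act n M f x = \<zero>\<^bsub>M\<^esub>"
proof -
  interpret J: ideal "Idl\<^bsub>PA\<^esub> {preprojective_relation n}" PA by (rule ideal_preprojective)
  have "Idl\<^bsub>PA\<^esub> {preprojective_relation n} +>\<^bsub>PA\<^esub> f = \<zero>\<^bsub>preprojective_algebra n\<^esub>"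
    unfolding preprojective_algebra_simps(5)[OF path_algebra_one_closed path_algebra_one_closed]
    using assms(1) by (rule J.a_rcos_const)
  then show ?thesis unfolding act_def using smult_l_null assms(2) by simp
qed

lemma zero_act: "x \<in> carrier M \<Longrightarrow> act n M (\<lambda>p. 0) x = \<zero>\<^bsub>M\<^esub>"
proof (rule ideal_act)
  interpret J: ideal "Idl\<^bsub>PA\<^esub> {preprojective_relation n}" PA by (rule ideal_preprojective)
  show "(\<lambda>p. 0) \<in> Idl\<^bsub>PA\<^esub> {preprojective_relation n}"
    using additive_subgroup.zero_closed[OF J.is_additive_subgroup] by (simp only: path_algebra_simps)
qed

lemma act_zero: "f \<in> carrier PA \<Longrightarrow> act n M f \<zero>\<^bsub>M\<^esub> = \<zero>\<^bsub>M\<^esub>"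
  unfolding act_def using preprojective_algebra_simps(1) by (intro smult_r_null)

lemmas [simp, intro] = generators_closed
lemmas [simp] = act_closed act_add act_zero

lemma lower_raise: "x \<in> carrier M \<Longrightarrow> lower n M (raise n M x) = raise n M (lower n M x)"
proof -
  assume x: "x \<in> carrier M"
  interpret PA: ring PA by (rule ring_path_algebra)
  have \<rho>: "preprojective_relation n \<in> Idl\<^bsub>PA\<^esub> {preprojective_relation n}"
    using PA.genideal_self' preprojective_relation_carrier by blast
  have "lower n M (raise n M x) = act n M (lower_elem n \<otimes>\<^bsub>PA\<^esub> raise_elem n) x"
    using x by (simp add: mult_act)
  also have "\<dots> = act n M (raise_elem n \<otimes>\<^bsub>PA\<^esub> lower_elem n) x"
    unfolding preprojective_relation_eq using x ideal_act[OF \<rho> x] preprojective_relation_carrier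
    by (subst add_act) (auto simp: path_algebra_mult_closed)
  finally show ?thesis using x by (simp add: mult_act)
qed

lemma proj_proj: "x \<in> carrier M \<Longrightarrow> proj n M c (proj n M d x) = (if c = d then proj n M c x else \<zero>\<^bsub>M\<^esub>)"
  by (simp add: mult_act[symmetric] vtx_vtx zero_act)

lemma proj_out: "x \<in> carrier M \<Longrightarrow> c \<notin> {1..<n} \<Longrightarrow> proj n M c x = \<zero>\<^bsub>M\<^esub>"
  by (simp add: vtx_out zero_act)

lemma proj_raise: "x \<in> carrier M \<Longrightarrow> proj n M (Suc c) (raise n M x) = raise n M (proj n M c x)"
  by (simp add: mult_act[symmetric] vtx_raise)

lemma proj_lower: "x \<in> carrier M \<Longrightarrow> proj n M c (lower n M x) = lower n M (proj n M (Suc c) x)"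
  by (simp add: mult_act[symmetric] vtx_lower)

lemma scale_act: "f \<in> carrier PA \<Longrightarrow> x \<in> carrier M \<Longrightarrow> act n M f (scale n M z x) = scale n M z (act n M f x)"
  by (simp add: mult_act[symmetric] scalar_mult)

lemma scale_scale: "x \<in> carrier M \<Longrightarrow> scale n M z (scale n M w x) = scale n M (z * w) x"
proof -
  have "scalar_elem n z \<otimes>\<^bsub>PA\<^esub> scalar_elem n w = scalar_elem n (z * w)"
    unfolding scalar_mult(1)[OF generators_closed(4)] by (simp add: scalar_elem_def fun_eq_iff)
  then show "x \<in> carrier M \<Longrightarrow> scale n M z (scale n M w x) = scale n M (z * w) x"
    by (simp add: mult_act[symmetric])
qed

lemma scale_add: "x \<in> carrier M \<Longrightarrow> scale n M (z + w) x = scale n M z x \<oplus>\<^bsub>M\<^esub> scale n M w x"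
proof -
  have "scalar_elem n (z + w) = scalar_elem n z \<oplus>\<^bsub>PA\<^esub> scalar_elem n w"
    by (auto simp: scalar_elem_def path_algebra_simps)
  then show "x \<in> carrier M \<Longrightarrow> scale n M (z + w) x = scale n M z x \<oplus>\<^bsub>M\<^esub> scale n M w x"
    by (simp add: add_act)
qed

lemma scale_1: "x \<in> carrier M \<Longrightarrow> scale n M 1 x = x"
proof -
  have "scalar_elem n 1 = \<one>\<^bsub>PA\<^esub>" by (simp add: scalar_elem_def path_algebra_simps)
  then show "x \<in> carrier M \<Longrightarrow> scale n M 1 x = x" by (simp add: one_act)
qed

lemma scale_0: "x \<in> carrier M \<Longrightarrow> scale n M 0 x = \<zero>\<^bsub>M\<^esub>"
proof -
  have "scalar_elem n 0 = (\<lambda>p. 0)" by (auto simp: scalar_elem_def)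
  then show "x \<in> carrier M \<Longrightarrow> scale n M 0 x = \<zero>\<^bsub>M\<^esub>" by (simp add: zero_act)
qed

lemma scale_eq_zero: "x \<in> carrier M \<Longrightarrow> scale n M z x = \<zero>\<^bsub>M\<^esub> \<longleftrightarrow> z = 0 \<or> x = \<zero>\<^bsub>M\<^esub>"
proof -
  assume x: "x \<in> carrier M"
  have "x = \<zero>\<^bsub>M\<^esub>" if "z \<noteq> 0" "scale n M z x = \<zero>\<^bsub>M\<^esub>"
  proof -
    have "x = scale n M (inverse z * z) x" using that x by (simp add: scale_1)
    also have "\<dots> = scale n M (inverse z) (scale n M z x)" using x by (simp add: scale_scale)
    finally show ?thesis using that by simp
  qed
  then show ?thesis using x scale_0 by auto
qed

lemma scale_minus: "x \<in> carrier M \<Longrightarrow> \<ominus>\<^bsub>M\<^esub> x = scale n M (-1) x"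
proof -
  assume x: "x \<in> carrier M"
  have "scale n M (-1) x \<oplus>\<^bsub>M\<^esub> x = scale n M (-1 + 1) x"
    using x by (simp only: scale_add scale_1)
  then have "scale n M (-1) x \<oplus>\<^bsub>M\<^esub> x = \<zero>\<^bsub>M\<^esub>" using x by (simp add: scale_0)
  then show ?thesis using x by (intro M.minus_equality) auto
qed

lemma act_minus: "f \<in> carrier PA \<Longrightarrow> x \<in> carrier M \<Longrightarrow> y \<in> carrier M \<Longrightarrow>
    act n M f (x \<ominus>\<^bsub>M\<^esub> y) = act n M f x \<ominus>\<^bsub>M\<^esub> act n M f y"
  by (simp add: a_minus_def scale_minus scale_act)

lemma scale_inject: "x \<in> carrier M \<Longrightarrow> x \<noteq> \<zero>\<^bsub>M\<^esub> \<Longrightarrow> scale n M z x = scale n M w x \<longleftrightarrow> z = w"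
proof -
  assume x: "x \<in> carrier M" "x \<noteq> \<zero>\<^bsub>M\<^esub>"
  have "z = w" if "scale n M z x = scale n M w x"
  proof -
    have "scale n M (z + - w) x = scale n M w x \<oplus>\<^bsub>M\<^esub> scale n M (- w) x"
      using x that by (simp only: scale_add)
    also have "\<dots> = scale n M (w + - w) x" using x by (simp only: scale_add)
    also have "\<dots> = \<zero>\<^bsub>M\<^esub>" using x by (simp add: scale_0)
    finally show ?thesis using x scale_eq_zero by simp
  qed
  then show ?thesis by blast
qed

text \<open>The unit is the sum of the vertex idempotents, which is added up one vertex at a time.\<close>
lemma mem_if_components:
  assumes x: "x \<in> carrier M" and N: "\<zero>\<^bsub>M\<^esub> \<in> N" "\<And>x y. x \<in> N \<Longrightarrow> y \<in> N \<Longrightarrow> x \<oplus>\<^bsub>M\<^esub> y \<in> N"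
    and comps: "\<And>c. c \<in> {1..<n} \<Longrightarrow> proj n M c x \<in> N"
  shows "x \<in> N"
proof -
  define ones where "ones k = (\<lambda>p. if \<exists>i\<in>{1..<k}. p = [i] then 1 else 0 :: complex)" for k :: nat
  have "ones k \<in> carrier PA \<and> act n M (ones k) x \<in> N" if "k \<le> n" for k
    using that
  proof (induction k)
    case 0
    have "ones 0 = (\<lambda>p. 0)" by (auto simp: ones_def)
    then show ?case using N(1) x by (simp add: zero_act) (simp add: path_algebra_simps)
  next
    case (Suc k)
    show ?case
    proof (cases "k = 0")
      case True
      then have "ones (Suc k) = (\<lambda>p. 0)" by (auto simp: ones_def)
      then show ?thesis using N(1) x by (simp add: zero_act) (simp add: path_algebra_simps)
    next
      case False
      then have "ones (Suc k) = ones k \<oplus>\<^bsub>PA\<^esub> vtx n k"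
        using Suc(2) by (auto simp: ones_def vtx_def path_algebra_simps fun_eq_iff less_Suc_eq)
      moreover have "ones k \<oplus>\<^bsub>PA\<^esub> vtx n k \<in> carrier PA"
        using Suc ring.ring_simprules(1)[OF ring_path_algebra] by simp
      ultimately show ?thesis using Suc N(2) comps[of k] False x by (simp add: add_act)
    qed
  qed
  moreover have "ones n = \<one>\<^bsub>PA\<^esub>" by (simp add: ones_def path_algebra_simps)
  ultimately show ?thesis using one_act[OF x] by (metis order_refl)
qed

lemma eq_zero_if_components:
  "x \<in> carrier M \<Longrightarrow> (\<And>c. c \<in> {1..<n} \<Longrightarrow> proj n M c x = \<zero>\<^bsub>M\<^esub>) \<Longrightarrow> x = \<zero>\<^bsub>M\<^esub>"
  using mem_if_components[of x "{\<zero>\<^bsub>M\<^esub>}"] by simp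

lemma carrier_PiE:
  assumes "r \<in> carrier (preprojective_algebra n)"
  obtains f where "f \<in> carrier PA" "\<And>x. r \<odot>\<^bsub>M\<^esub> x = act n M f x"
  using assms unfolding preprojective_algebra_carrier act_def by auto

lemma preproj_submoduleI:
  assumes N: "N \<subseteq> carrier M" "\<zero>\<^bsub>M\<^esub> \<in> N" "\<And>x y. x \<in> N \<Longrightarrow> y \<in> N \<Longrightarrow> x \<oplus>\<^bsub>M\<^esub> y \<in> N"
    and sc: "\<And>z x. x \<in> N \<Longrightarrow> scale n M z x \<in> N" and pr: "\<And>c x. x \<in> N \<Longrightarrow> proj n M c x \<in> N"
    and ra: "\<And>x. x \<in> N \<Longrightarrow> raise n M x \<in> N" and lo: "\<And>x. x \<in> N \<Longrightarrow> lower n M x \<in> N"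
  shows "submodule N (preprojective_algebra n) M"
proof (rule submoduleI[OF N])
  fix r x assume r: "r \<in> carrier (preprojective_algebra n)" and x: "x \<in> N"
  then have xc: "x \<in> carrier M" using N(1) by blast
  obtain f where f: "f \<in> carrier PA" "\<And>x. r \<odot>\<^bsub>M\<^esub> x = act n M f x" using carrier_PiE[OF r] by blast
  have "act n M f x \<in> N" using f(1)
  proof (induction rule: path_algebra_induct)
    case zero then show ?case using N(2) xc by (simp add: zero_act)
  qed (use N(3) sc pr ra lo x xc in \<open>simp_all add: add_act mult_act\<close>)
  then show "r \<odot>\<^bsub>M\<^esub> x \<in> N" using f(2) by simp
qed

lemma preproj_submoduleD:
  assumes "submodule N (preprojective_algebra n) M" "x \<in> N" "f \<in> carrier PA"
  shows "act n M f x \<in> N"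
  unfolding act_def using submoduleD(4)[OF assms(1) _ assms(2)] preprojective_algebra_simps(1) assms(3) by blast

lemma preproj_sub: "submodule N (preprojective_algebra n) M \<Longrightarrow> preproj_module n (sub_lmod M N)"
  unfolding preproj_module_def by (rule lmodule_sub[OF lmod])

lemma preproj_quot: "submodule N (preprojective_algebra n) M \<Longrightarrow> preproj_module n (quot_lmod M N)"
  unfolding preproj_module_def by (rule lmodule_quot[OF lmod])

lemma act_quot:
  assumes "submodule N (preprojective_algebra n) M" "f \<in> carrier PA" "x \<in> carrier M"
  shows "act n (quot_lmod M N) f (N +>\<^bsub>M\<^esub> x) = N +>\<^bsub>M\<^esub> (act n M f x)"
  unfolding act_def using quot_lmod_simps(4)[OF lmod assms(1)] preprojective_algebra_simps(1)[OF assms(2) assms(2)] assms(3)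
  by simp

text \<open>This is the isotypic component of \<open>S\<^sub>c\<close> in the socle, see \<open>trace_simple_eq\<close>.\<close>
definition killed_at :: "nat \<Rightarrow> 'b set"
  where "killed_at c = {x \<in> comp_at n M c. raise n M x = \<zero>\<^bsub>M\<^esub> \<and> lower n M x = \<zero>\<^bsub>M\<^esub>}"

text \<open>A path of positive length acts as zero, because its first arrow acts as \<open>U\<close>, \<open>D\<close> or zero.\<close>
lemma act_killed:
  assumes "x \<in> killed_at c" "f \<in> carrier PA" "c \<in> {1..<n}"
  shows "act n M f x = scale n M (f [c]) x"
proof -
  have x: "x \<in> carrier M" "proj n M c x = x" "raise n M x = \<zero>\<^bsub>M\<^esub>" "lower n M x = \<zero>\<^bsub>M\<^esub>"
    using assms by (auto simp: killed_at_def comp_at_def)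
  have pd: "proj n M d x = (if d = c then x else \<zero>\<^bsub>M\<^esub>)" for d
    using proj_proj[OF x(1), of d c] x(2) by (auto split: if_splits)
  show ?thesis using assms(2)
  proof (induction rule: path_algebra_induct)
    case zero then show ?case using x(1) by (simp add: zero_act scale_0)
  next
    case (add f g)
    have "(f \<oplus>\<^bsub>PA\<^esub> g) [c] = f [c] + g [c]" by (simp add: path_algebra_simps)
    then show ?case using x(1) add by (simp add: add_act scale_add)
  next
    case (scalar z f)
    have "(scalar_elem n z \<otimes>\<^bsub>PA\<^esub> f) [c] = z * f [c]" using scalar by (simp add: scalar_mult)
    then show ?case using x(1) scalar by (simp add: mult_act scale_scale)
  next
    case (vtx d)
    have "vtx n d [c] = (if d = c then 1 else 0)" using assms(3) by (auto simp: vtx_def)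
    then show ?case using x(1) by (simp add: pd scale_0 scale_1)
  next
    case (vtx_times d f)
    have "(vtx n d \<otimes>\<^bsub>PA\<^esub> f) [c] = (if d = c then f [c] else 0)" using assms(3) by (auto simp: vtx_mult)
    then show ?case using x(1) vtx_times by (simp add: mult_act scale_act pd scale_0)
  next
    case (raise f)
    have "(raise_elem n \<otimes>\<^bsub>PA\<^esub> f) [c] = 0" by (simp add: raise_mult)
    then show ?case using x raise by (simp add: mult_act scale_act scale_0)
  next
    case (lower f)
    have "(lower_elem n \<otimes>\<^bsub>PA\<^esub> f) [c] = 0" by (simp add: lower_mult)
    then show ?case using x lower by (simp add: mult_act scale_act scale_0)
  qed
qed

end

section \<open>Traces of simple modules\<close>

lemma act_simple_at: "f \<in> carrier (path_algebra n) \<Longrightarrow> act n (simple_at c) f z = f [c] * z"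
  unfolding act_def by (simp add: simple_at_def coset_coeff[OF _ refl])

lemma lmod_homD:
  assumes "\<phi> \<in> lmod_hom R M N"
  shows "\<And>x y. x \<in> carrier M \<Longrightarrow> y \<in> carrier M \<Longrightarrow> \<phi> (x \<oplus>\<^bsub>M\<^esub> y) = \<phi> x \<oplus>\<^bsub>N\<^esub> \<phi> y"
    "\<And>r x. r \<in> carrier R \<Longrightarrow> x \<in> carrier M \<Longrightarrow> \<phi> (r \<odot>\<^bsub>M\<^esub> x) = r \<odot>\<^bsub>N\<^esub> \<phi> x"
    "\<And>x. x \<in> carrier M \<Longrightarrow> \<phi> x \<in> carrier N"
  using assms by (auto simp: lmod_hom_def)

lemma lmod_hom_act:
  assumes "\<phi> \<in> lmod_hom (preprojective_algebra n) M N" "f \<in> carrier (path_algebra n)" "x \<in> carrier M"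
  shows "\<phi> (act n M f x) = act n N f (\<phi> x)"
  unfolding act_def using lmod_homD(2)[OF assms(1) preprojective_algebra_simps(1)[OF assms(2,2)] assms(3)] .

lemma (in lmodule) sum_submodules_submodule:
  assumes "\<Union>F \<subseteq> carrier M"
  shows "submodule (sum_submodules R M F) R M"
proof -
  have mem: "x \<in> sum_submodules R M F \<longleftrightarrow> (\<forall>N. submodule N R M \<and> \<Union>F \<subseteq> N \<longrightarrow> x \<in> N)" for x
    by (auto simp: sum_submodules_def)
  show ?thesis
  proof (rule submoduleI)
    show "sum_submodules R M F \<subseteq> carrier M" using mem carrier_submodule assms by blast
    show "\<zero>\<^bsub>M\<^esub> \<in> sum_submodules R M F" unfolding mem by (auto intro: submoduleD(2))
    show "x \<oplus>\<^bsub>M\<^esub> y \<in> sum_submodules R M F" if "x \<in> sum_submodules R M F" "y \<in> sum_submodules R M F" for x y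
      using that unfolding mem by (auto intro!: submoduleD(3))
    show "r \<odot>\<^bsub>M\<^esub> x \<in> sum_submodules R M F" if "r \<in> carrier R" "x \<in> sum_submodules R M F" for r x
      using that unfolding mem by (auto intro!: submoduleD(4))
  qed
qed

lemma sum_submodules_upper: "N \<in> F \<Longrightarrow> N \<subseteq> sum_submodules R M F"
  by (auto simp: sum_submodules_def)

lemma sum_submodules_least: "submodule N R M \<Longrightarrow> \<Union>F \<subseteq> N \<Longrightarrow> sum_submodules R M F \<subseteq> N"
  by (auto simp: sum_submodules_def)

context preproj_module
begin

lemma killedD:
  assumes "x \<in> killed_at c"
  shows "x \<in> carrier M" "proj n M c x = x" "raise n M x = \<zero>\<^bsub>M\<^esub>" "lower n M x = \<zero>\<^bsub>M\<^esub>"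
  using assms by (auto simp: killed_at_def comp_at_def)

lemma killedI:
  "x \<in> carrier M \<Longrightarrow> proj n M c x = x \<Longrightarrow> raise n M x = \<zero>\<^bsub>M\<^esub> \<Longrightarrow> lower n M x = \<zero>\<^bsub>M\<^esub> \<Longrightarrow> x \<in> killed_at c"
  by (auto simp: killed_at_def comp_at_def)

lemma proj_killed: "x \<in> killed_at c \<Longrightarrow> proj n M d x = (if d = c then x else \<zero>\<^bsub>M\<^esub>)"
  using proj_proj[of x d c] killedD[of x c] by auto

lemma zero_killed: "\<zero>\<^bsub>M\<^esub> \<in> killed_at c"
  by (rule killedI) auto

lemma killed_submodule: "submodule (killed_at c) (preprojective_algebra n) M"
proof (rule preproj_submoduleI)
  show "killed_at c \<subseteq> carrier M" using killedD by blast
  show "proj n M d x \<in> killed_at c" if "x \<in> killed_at c" for d x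
    using that proj_killed[OF that] zero_killed by simp
  show "x \<oplus>\<^bsub>M\<^esub> y \<in> killed_at c" if "x \<in> killed_at c" "y \<in> killed_at c" for x y
    using killedD[OF that(1)] killedD[OF that(2)] by (intro killedI) auto
  show "scale n M z x \<in> killed_at c" if "x \<in> killed_at c" for z x
    using killedD[OF that] by (intro killedI) (auto simp: scale_act)
qed (use zero_killed killedD in auto)

definition line :: "'b \<Rightarrow> 'b set"
  where "line x = range (\<lambda>z. scale n M z x)"

lemma mem_line: "x \<in> carrier M \<Longrightarrow> x \<in> line x"
  unfolding line_def using scale_1[of x] by (metis rangeI)

lemma line_submodule:
  assumes "x \<in> killed_at c" "c \<in> {1..<n}"
  shows "submodule (line x) (preprojective_algebra n) M"
proof (rule submoduleI)
  note x = killedD[OF assms(1)]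
  show "line x \<subseteq> carrier M" using x by (auto simp: line_def)
  show "\<zero>\<^bsub>M\<^esub> \<in> line x" unfolding line_def using scale_0[OF x(1)] by (metis rangeI)
  show "y \<oplus>\<^bsub>M\<^esub> y' \<in> line x" if "y \<in> line x" "y' \<in> line x" for y y'
    using that x by (auto simp: line_def simp flip: scale_add)
  show "r \<odot>\<^bsub>M\<^esub> y \<in> line x" if r: "r \<in> carrier (preprojective_algebra n)" "y \<in> line x" for r y
  proof -
    obtain f where f: "f \<in> carrier PA" "\<And>x. r \<odot>\<^bsub>M\<^esub> x = act n M f x" using carrier_PiE[OF r(1)] by blast
    obtain z where "y = scale n M z x" using r(2) by (auto simp: line_def)
    then have "r \<odot>\<^bsub>M\<^esub> y = scale n M (z * f [c]) x"
      using f x act_killed[OF assms(1) f(1) assms(2)] by (simp add: scale_act[OF f(1)] scale_scale)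
    then show ?thesis by (simp add: line_def)
  qed
qed

lemma line_iso:
  assumes "x \<in> killed_at c" "x \<noteq> \<zero>\<^bsub>M\<^esub>" "c \<in> {1..<n}"
  shows "lmod_iso (preprojective_algebra n) (sub_lmod M (line x)) (simple_at c)"
proof -
  note x = killedD[OF assms(1)]
  define \<psi> where "\<psi> z = scale n M z x" for z
  have inj: "inj \<psi>" unfolding \<psi>_def using scale_inject[OF x(1) assms(2)] by (intro injI) simp
  have line: "line x = range \<psi>" by (simp add: line_def \<psi>_def)
  define \<phi> where "\<phi> = inv_into UNIV \<psi>"
  have \<phi>: "\<phi> (\<psi> z) = z" for z unfolding \<phi>_def using inj by (rule inv_f_f)
  have "\<phi> \<in> lmod_hom (preprojective_algebra n) (sub_lmod M (line x)) (simple_at c)"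
    unfolding lmod_hom_def
  proof (intro CollectI conjI ballI)
    show "\<phi> \<in> carrier (sub_lmod M (line x)) \<rightarrow> carrier (simple_at c)" by (auto simp: simple_at_def)
    fix y y' assume "y \<in> carrier (sub_lmod M (line x))" "y' \<in> carrier (sub_lmod M (line x))"
    then obtain z z' where z: "y = \<psi> z" "y' = \<psi> z'" by (auto simp: line)
    have "y \<oplus>\<^bsub>M\<^esub> y' = \<psi> (z + z')" using x by (simp add: z \<psi>_def scale_add)
    then show "\<phi> (y \<oplus>\<^bsub>sub_lmod M (line x)\<^esub> y') = \<phi> y \<oplus>\<^bsub>simple_at c\<^esub> \<phi> y'"
      by (simp add: z \<phi> simple_at_def)
  next
    fix r y assume r: "r \<in> carrier (preprojective_algebra n)" and "y \<in> carrier (sub_lmod M (line x))"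
    then obtain z where z: "y = \<psi> z" by (auto simp: line)
    obtain f where f: "f \<in> carrier PA" "r = Idl\<^bsub>PA\<^esub> {preprojective_relation n} +>\<^bsub>PA\<^esub> f"
      using r unfolding preprojective_algebra_carrier by blast
    have "r \<odot>\<^bsub>M\<^esub> y = act n M f y" by (simp add: act_def f)
    also have "\<dots> = \<psi> (z * f [c])"
      using f x act_killed[OF assms(1) f(1) assms(3)] by (simp add: z \<psi>_def scale_act[OF f(1)] scale_scale)
    finally have "\<phi> (r \<odot>\<^bsub>M\<^esub> y) = f [c] * z" by (simp add: \<phi>)
    also have "\<dots> = r \<odot>\<^bsub>simple_at c\<^esub> z"
      using act_simple_at[OF f(1), of c z] by (simp add: act_def f)
    finally show "\<phi> (r \<odot>\<^bsub>sub_lmod M (line x)\<^esub> y) = r \<odot>\<^bsub>simple_at c\<^esub> \<phi> y" by (simp add: z \<phi>)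
  qed
  moreover have "bij_betw \<phi> (line x) UNIV"
    unfolding line by (rule bij_betw_byWitness[of _ \<psi>]) (auto simp: \<phi>)
  ultimately show ?thesis unfolding lmod_iso_def by (intro bexI[of _ \<phi>]) (auto simp: simple_at_def)
qed

text \<open>In the image of an injective homomorphism to \<open>S\<^sub>c\<close>, elements of the path algebra with the same
  coefficient at the trivial path at \<open>c\<close> act in the same way. So \<open>e\<^sub>c\<close> acts as \<open>1\<close>, and \<open>U\<close> and \<open>D\<close> act as
  \<open>0\<close>.\<close>
lemma iso_simple_at_killed:
  assumes N: "submodule N (preprojective_algebra n) M" and c: "c \<in> {1..<n}"
    and \<phi>: "\<phi> \<in> lmod_hom (preprojective_algebra n) (sub_lmod M N) (simple_at c)" "inj_on \<phi> N"
  shows "N \<subseteq> killed_at c"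
proof
  fix y assume y: "y \<in> N"
  then have yc: "y \<in> carrier M" using submoduleD(1)[OF N] by blast
  have hom: "\<phi> (act n M f y) = f [c] * \<phi> y" if "f \<in> carrier PA" for f
    using lmod_hom_act[OF \<phi>(1) that, of y] y act_simple_at[OF that] by simp
  have eq: "act n M f y = act n M g y" if "f \<in> carrier PA" "g \<in> carrier PA" "f [c] = g [c]" for f g
    using inj_onD[OF \<phi>(2)] preproj_submoduleD[OF N y] hom that by metis
  have coeff: "scalar_elem n z [c] = z" "vtx n c [c] = 1" for z
    using c by (auto simp: scalar_elem_def vtx_def)
  have zero: "act n M f y = \<zero>\<^bsub>M\<^esub>" if "f \<in> carrier PA" "f [c] = 0" for f
    using eq[OF that(1) generators_closed(4), of 0] coeff that(2) scale_0[OF yc] by simp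
  show "y \<in> killed_at c"
  proof (rule killedI[OF yc])
    show "proj n M c y = y"
      using eq[OF generators_closed(1,4), of c 1] coeff scale_1[OF yc] by simp
    show "raise n M y = \<zero>\<^bsub>M\<^esub>" by (rule zero[OF generators_closed(2)]) (simp add: raise_elem_def)
    show "lower n M y = \<zero>\<^bsub>M\<^esub>" by (rule zero[OF generators_closed(3)]) (simp add: lower_elem_def)
  qed
qed

lemma trace_simple_eq:
  assumes c: "c \<in> {1..<n}"
  shows "trace_simple (preprojective_algebra n) (simple_at c) M = killed_at c"
    (is "?T = _")
proof (rule equalityI)
  show "?T \<subseteq> killed_at c"
    unfolding trace_simple_def
  proof (rule sum_submodules_least[OF killed_submodule], rule Union_least)
    fix N assume "N \<in> {N. submodule N (preprojective_algebra n) M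
      \<and> lmod_iso (preprojective_algebra n) (sub_lmod M N) (simple_at c)}"
    then show "N \<subseteq> killed_at c"
      using iso_simple_at_killed[OF _ c] unfolding lmod_iso_def bij_betw_def by auto
  qed
  have T: "submodule ?T (preprojective_algebra n) M"
    unfolding trace_simple_def by (rule sum_submodules_submodule) (auto dest: submoduleD(1))
  show "killed_at c \<subseteq> ?T"
  proof
    fix x assume x: "x \<in> killed_at c"
    show "x \<in> ?T"
    proof (cases "x = \<zero>\<^bsub>M\<^esub>")
      case True then show ?thesis using submoduleD(2)[OF T] by simp
    next
      case False
      have "line x \<subseteq> ?T" unfolding trace_simple_def
        by (rule sum_submodules_upper) (use line_submodule[OF x c] line_iso[OF x False c] in blast)
      then show ?thesis using mem_line killedD(1)[OF x] by blast
    qed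
  qed
qed

lemma line_simple:
  assumes "x \<in> killed_at c" "x \<noteq> \<zero>\<^bsub>M\<^esub>" "c \<in> {1..<n}"
  shows "simple_lmod (preprojective_algebra n) (sub_lmod M (line x))"
  unfolding simple_lmod_def
proof (intro conjI allI impI)
  note x = killedD[OF assms(1)] and L = line_submodule[OF assms(1,3)]
  show "lmodule (preprojective_algebra n) (sub_lmod M (line x))" by (rule lmodule_sub[OF lmod L])
  show "carrier (sub_lmod M (line x)) \<noteq> {\<zero>\<^bsub>sub_lmod M (line x)\<^esub>}"
    using mem_line[OF x(1)] assms(2) by auto
  fix N assume "submodule N (preprojective_algebra n) (sub_lmod M (line x))"
  then have N: "submodule N (preprojective_algebra n) M" "N \<subseteq> line x"
    using submodule_sub_iff[OF lmod L] by auto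
  show "N = {\<zero>\<^bsub>sub_lmod M (line x)\<^esub>} \<or> N = carrier (sub_lmod M (line x))"
  proof (cases "N \<subseteq> {\<zero>\<^bsub>M\<^esub>}")
    case True then show ?thesis using submoduleD(2)[OF N(1)] by auto
  next
    case False
    then obtain a where a: "scale n M a x \<in> N" "scale n M a x \<noteq> \<zero>\<^bsub>M\<^esub>" using N(2) by (auto simp: line_def)
    then have "a \<noteq> 0" using scale_0[OF x(1)] by auto
    have "scale n M z x \<in> N" for z
    proof -
      have "scale n M z x = scale n M (z / a) (scale n M a x)" using x(1) \<open>a \<noteq> 0\<close> by (simp add: scale_scale)
      then show ?thesis using preproj_submoduleD[OF N(1) a(1)] by simp
    qed
    then have "line x \<subseteq> N" by (auto simp: line_def)
    then show ?thesis using N(2) by auto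
  qed
qed

text \<open>Every nonzero element of an isotypic component spans a simple submodule, so it lies in the
  socle, which is isomorphic to \<open>S\<^sub>j\<close>.\<close>
lemma simple_socle:
  assumes iso: "lmod_iso (preprojective_algebra n) (sub_lmod M (socle (preprojective_algebra n) M)) (simple_at j)"
    and j: "j \<in> {1..<n}"
  obtains s where "s \<in> killed_at j" "s \<noteq> \<zero>\<^bsub>M\<^esub>" "killed_at j \<subseteq> line s"
    "\<And>d. d \<in> {1..<n} \<Longrightarrow> d \<noteq> j \<Longrightarrow> killed_at d = {\<zero>\<^bsub>M\<^esub>}"
proof -
  let ?S = "socle (preprojective_algebra n) M"
  have S: "submodule ?S (preprojective_algebra n) M"
    unfolding socle_def by (rule sum_submodules_submodule) (auto dest: submoduleD(1))
  have killed_socle: "killed_at d \<subseteq> ?S" if d: "d \<in> {1..<n}" for d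
  proof
    fix x assume x: "x \<in> killed_at d"
    show "x \<in> ?S"
    proof (cases "x = \<zero>\<^bsub>M\<^esub>")
      case True then show ?thesis using submoduleD(2)[OF S] by simp
    next
      case False
      have "line x \<subseteq> ?S" unfolding socle_def
        by (rule sum_submodules_upper) (use line_submodule[OF x d] line_simple[OF x False d] in blast)
      then show ?thesis using mem_line killedD(1)[OF x] by blast
    qed
  qed
  obtain \<phi> where \<phi>: "\<phi> \<in> lmod_hom (preprojective_algebra n) (sub_lmod M ?S) (simple_at j)"
    and bij: "bij_betw \<phi> ?S UNIV"
    using iso unfolding lmod_iso_def by (auto simp: simple_at_def)
  have socle_killed: "?S \<subseteq> killed_at j"
    using iso_simple_at_killed[OF S j \<phi>] bij by (simp add: bij_betw_def)
  obtain s where s: "s \<in> ?S" "\<phi> s = 1" using bij unfolding bij_betw_def by (metis UNIV_I imageE)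
  have \<phi>s: "\<phi> (scale n M z y) = z * \<phi> y" if "y \<in> ?S" for z y
    using lmod_hom_act[OF \<phi> generators_closed(4), of y z] that j
    by (simp add: act_simple_at) (simp add: scalar_elem_def)
  have sc: "s \<in> carrier M" using s submoduleD(1)[OF S] by blast
  have "s \<noteq> \<zero>\<^bsub>M\<^esub>" using \<phi>s[OF s(1), of 0] scale_0[OF sc] s(2) by auto
  moreover have "killed_at j \<subseteq> line s"
  proof
    fix x assume "x \<in> killed_at j"
    then have x: "x \<in> ?S" using killed_socle[OF j] by blast
    have "\<phi> (scale n M (\<phi> x) s) = \<phi> x" using \<phi>s[OF s(1)] s(2) by simp
    moreover have "scale n M (\<phi> x) s \<in> ?S" using preproj_submoduleD[OF S s(1)] by simp
    ultimately have "scale n M (\<phi> x) s = x" using bij x by (metis bij_betw_inv_into_left)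
    then show "x \<in> line s" unfolding line_def by (metis rangeI)
  qed
  moreover have "killed_at d = {\<zero>\<^bsub>M\<^esub>}" if d: "d \<in> {1..<n}" "d \<noteq> j" for d
  proof -
    have "x = \<zero>\<^bsub>M\<^esub>" if x: "x \<in> killed_at d" for x
      using killed_socle[OF d(1)] socle_killed x d(2) proj_killed[of x j j] proj_killed[OF x, of j] by auto
    then show ?thesis using zero_killed by blast
  qed
  ultimately show ?thesis using that s socle_killed by blast
qed

end

lemma soc_preimage_eq:
  assumes "preproj_module n M" and N: "submodule N (preprojective_algebra n) M" and c: "c \<in> {1..<n}"
  shows "soc_preimage n M N c =
    {x \<in> carrier M. proj n M c x \<ominus>\<^bsub>M\<^esub> x \<in> N \<and> raise n M x \<in> N \<and> lower n M x \<in> N}"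
proof -
  interpret M: preproj_module n M by fact
  interpret Q: preproj_module n "quot_lmod M N" by (rule M.preproj_quot[OF N])
  have "N +>\<^bsub>M\<^esub> x \<in> Q.killed_at c \<longleftrightarrow> proj n M c x \<ominus>\<^bsub>M\<^esub> x \<in> N \<and> raise n M x \<in> N \<and> lower n M x \<in> N"
    if x: "x \<in> carrier M" for x
    unfolding Q.killed_at_def comp_at_def mem_Collect_eq quot_lmod_simps(1,2)[OF M.lmod N]
    using x by (simp add: M.act_quot[OF N] coset_eq_iff[OF M.lmod N] coset_zero_iff[OF M.lmod N])
  then show ?thesis unfolding soc_preimage_def Q.trace_simple_eq[OF c] by blast
qed

context preproj_module
begin

lemma raise_pow_closed: "x \<in> carrier M \<Longrightarrow> (raise n M ^^ p) x \<in> carrier M"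
  by (induction p) auto

lemma lower_pow_closed: "x \<in> carrier M \<Longrightarrow> (lower n M ^^ q) x \<in> carrier M"
  by (induction q) auto

lemma shift_closed: "x \<in> carrier M \<Longrightarrow> shift n M p q x \<in> carrier M"
  by (simp add: shift_def raise_pow_closed lower_pow_closed)

lemma shift_0_0: "shift n M 0 0 x = x"
  by (simp add: shift_def)

lemma lower_pow_raise: "x \<in> carrier M \<Longrightarrow> (lower n M ^^ q) (raise n M x) = raise n M ((lower n M ^^ q) x)"
  by (induction q) (auto simp: lower_raise lower_pow_closed)

lemma lower_raise_pow: "x \<in> carrier M \<Longrightarrow> lower n M ((raise n M ^^ p) x) = (raise n M ^^ p) (lower n M x)"
  by (induction p) (auto simp: lower_raise raise_pow_closed)

lemma shift_raise: "x \<in> carrier M \<Longrightarrow> shift n M p q (raise n M x) = shift n M (Suc p) q x"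
  by (simp add: shift_def lower_pow_raise funpow_swap1)

lemma shift_lower: "shift n M p q (lower n M x) = shift n M p (Suc q) x"
  by (simp add: shift_def funpow_swap1)

lemma raise_shift: "raise n M (shift n M p q x) = shift n M (Suc p) q x"
  by (simp add: shift_def)

lemma lower_shift: "x \<in> carrier M \<Longrightarrow> lower n M (shift n M p q x) = shift n M p (Suc q) x"
  by (simp add: shift_def lower_raise_pow lower_pow_closed)

lemma shift_linear:
  assumes "x \<in> carrier M"
  shows "y \<in> carrier M \<Longrightarrow> shift n M p q (x \<oplus>\<^bsub>M\<^esub> y) = shift n M p q x \<oplus>\<^bsub>M\<^esub> shift n M p q y"
    "shift n M p q (scale n M z x) = scale n M z (shift n M p q x)"
proof -
  have l: "(lower n M ^^ q) (x \<oplus>\<^bsub>M\<^esub> y) = (lower n M ^^ q) x \<oplus>\<^bsub>M\<^esub> (lower n M ^^ q) y"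
    if "x \<in> carrier M" "y \<in> carrier M" for q x y
    using that by (induction q) (simp_all add: lower_pow_closed)
  have r: "(raise n M ^^ p) (x \<oplus>\<^bsub>M\<^esub> y) = (raise n M ^^ p) x \<oplus>\<^bsub>M\<^esub> (raise n M ^^ p) y"
    if "x \<in> carrier M" "y \<in> carrier M" for p x y
    using that by (induction p) (simp_all add: raise_pow_closed)
  have ls: "(lower n M ^^ q) (scale n M z x) = scale n M z ((lower n M ^^ q) x)"
    if "x \<in> carrier M" for q x
    using that by (induction q) (simp_all add: lower_pow_closed scale_act[OF generators_closed(3)])
  have rs: "(raise n M ^^ p) (scale n M z x) = scale n M z ((raise n M ^^ p) x)"
    if "x \<in> carrier M" for p x
    using that by (induction p) (simp_all add: raise_pow_closed scale_act[OF generators_closed(2)])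
  show "y \<in> carrier M \<Longrightarrow> shift n M p q (x \<oplus>\<^bsub>M\<^esub> y) = shift n M p q x \<oplus>\<^bsub>M\<^esub> shift n M p q y"
    using assms by (simp add: shift_def l r lower_pow_closed)
  show "shift n M p q (scale n M z x) = scale n M z (shift n M p q x)"
    using assms by (simp add: shift_def ls rs lower_pow_closed)
qed

lemma shift_zero: "shift n M p q \<zero>\<^bsub>M\<^esub> = \<zero>\<^bsub>M\<^esub>"
proof -
  have "(lower n M ^^ q) \<zero>\<^bsub>M\<^esub> = \<zero>\<^bsub>M\<^esub>" by (induction q) simp_all
  moreover have "(raise n M ^^ p) \<zero>\<^bsub>M\<^esub> = \<zero>\<^bsub>M\<^esub>" by (induction p) simp_all
  ultimately show ?thesis by (simp add: shift_def)
qed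

text \<open>The kernels increase with both exponents because \<open>U\<close> and \<open>D\<close> commute.\<close>
lemma shift_mono:
  assumes "x \<in> carrier M" "shift n M p q x = \<zero>\<^bsub>M\<^esub>" "p \<le> p'" "q \<le> q'"
  shows "shift n M p' q' x = \<zero>\<^bsub>M\<^esub>"
proof -
  have "shift n M (p + d) q x = \<zero>\<^bsub>M\<^esub>" for d
  proof (induction d)
    case (Suc d)
    then show ?case using raise_shift[of "p + d" q x] by simp
  qed (use assms in simp)
  then have *: "shift n M p' q x = \<zero>\<^bsub>M\<^esub>" using assms(3) by (metis le_add_diff_inverse)
  have "shift n M p' (q + d) x = \<zero>\<^bsub>M\<^esub>" for d
  proof (induction d)
    case (Suc d)
    then show ?case using lower_shift[of x p' "q + d"] assms(1) by simp
  qed (use * in simp)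
  then show ?thesis using assms(4) by (metis le_add_diff_inverse)
qed

lemma comp_closed: "x \<in> comp_at n M c \<Longrightarrow> x \<in> carrier M"
  by (simp add: comp_at_def)

lemma proj_comp: "x \<in> comp_at n M c \<Longrightarrow> proj n M d x = (if d = c then x else \<zero>\<^bsub>M\<^esub>)"
  using proj_proj[of x d c] by (auto simp: comp_at_def)

lemma comp_out: "c \<notin> {1..<n} \<Longrightarrow> x \<in> comp_at n M c \<Longrightarrow> x = \<zero>\<^bsub>M\<^esub>"
  using proj_out[of x c] by (auto simp: comp_at_def)

lemma zero_comp: "\<zero>\<^bsub>M\<^esub> \<in> comp_at n M c"
  by (simp add: comp_at_def)

lemma proj_in_comp: "x \<in> carrier M \<Longrightarrow> proj n M c x \<in> comp_at n M c"
  by (simp add: comp_at_def proj_proj)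

lemma raise_comp: "x \<in> comp_at n M c \<Longrightarrow> raise n M x \<in> comp_at n M (Suc c)"
  by (simp add: comp_at_def proj_raise)

lemma lower_comp: "x \<in> comp_at n M (Suc c) \<Longrightarrow> lower n M x \<in> comp_at n M c"
  by (simp add: comp_at_def proj_lower)

text \<open>If \<open>D\<close> is applied too often, the vertex leaves the quiver and the result is zero; so truncated
  subtraction of vertices does no harm.\<close>
lemma shift_comp:
  assumes "x \<in> comp_at n M c" "c + p = d + q"
  shows "shift n M p q x \<in> comp_at n M d"
proof -
  have low: "(lower n M ^^ q) x \<in> comp_at n M (c - q)" for q
  proof (induction q)
    case (Suc q)
    show ?case
    proof (cases "c - q")
      case 0
      then have "(lower n M ^^ q) x = \<zero>\<^bsub>M\<^esub>" using Suc comp_out[of 0] by simp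
      then show ?thesis by (simp add: zero_comp)
    next
      case (Suc d)
      then have "c - Suc q = d" by simp
      then show ?thesis
        using lower_comp[of "(lower n M ^^ q) x" d] \<open>(lower n M ^^ q) x \<in> comp_at n M (c - q)\<close> Suc by simp
    qed
  qed (use assms in simp)
  have high: "y \<in> comp_at n M e \<Longrightarrow> (raise n M ^^ p) y \<in> comp_at n M (e + p)" for p y e
    by (induction p) (use raise_comp in auto)
  show ?thesis
  proof (cases "q \<le> c")
    case True
    then show ?thesis using high[OF low, of p q] assms(2) by (simp add: shift_def)
  next
    case False
    then have "(lower n M ^^ q) x = \<zero>\<^bsub>M\<^esub>" using low[of q] comp_out[of 0] by simp
    then have "shift n M p q x = shift n M p 0 \<zero>\<^bsub>M\<^esub>" by (simp add: shift_def)
    then show ?thesis by (simp add: shift_zero zero_comp)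
  qed
qed

end

text \<open>For the diagram of \<open>A\<close>, the pair of \<open>above n A c\<close> and \<open>gaps A c\<close> gives the coordinates of the first
  cell of colour \<open>c\<close> that is not in the diagram. In the model this cell is the first one not killed by the
  corresponding powers of \<open>U\<close> and \<open>D\<close>.\<close>
definition above :: "nat \<Rightarrow> nat set \<Rightarrow> nat \<Rightarrow> nat"
  where "above n A c = card (A \<inter> {c<..n})"

definition gaps :: "nat set \<Rightarrow> nat \<Rightarrow> nat"
  where "gaps A c = card ({1..c} - A)"

definition shape_sub ::
    "nat \<Rightarrow> ((nat list \<Rightarrow> complex) set, 'b, 'y) module_scheme \<Rightarrow> nat set \<Rightarrow> 'b set"
  where "shape_sub n M A = {x \<in> carrier M. \<forall>c. shift n M (above n A c) (gaps A c) (proj n M c x) = \<zero>\<^bsub>M\<^esub>}"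

lemma above_Suc:
  assumes "A \<subseteq> {1..n}"
  shows "above n A c = above n A (Suc c) + (if Suc c \<in> A then 1 else 0)"
proof -
  have "A \<inter> {c<..n} = (if Suc c \<in> A then insert (Suc c) (A \<inter> {Suc c<..n}) else A \<inter> {Suc c<..n})"
    using assms by (auto simp: less_Suc_eq Suc_lessI) (metis Suc_lessI not_less_eq)+
  then show ?thesis by (simp add: above_def)
qed

lemma gaps_Suc: "gaps A (Suc c) = gaps A c + (if Suc c \<in> A then 0 else 1)"
proof -
  have "{1..Suc c} - A = (if Suc c \<in> A then {1..c} - A else insert (Suc c) ({1..c} - A))"
    by (auto simp: le_Suc_eq)
  then show ?thesis by (simp add: gaps_def)
qed

context preproj_module
begin

text \<open>From \<open>c\<close> to \<open>c + 1\<close> either the exponent of \<open>U\<close> drops by one or the exponent of \<open>D\<close> grows by one.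
  So \<open>U\<close> maps the condition at \<open>c\<close> into the one at \<open>c + 1\<close>, and likewise for \<open>D\<close> in the other direction.\<close>
lemma shape_sub_submodule:
  assumes A: "A \<subseteq> {1..n}"
  shows "submodule (shape_sub n M A) (preprojective_algebra n) M"
proof (rule preproj_submoduleI)
  show "shape_sub n M A \<subseteq> carrier M" by (auto simp: shape_sub_def)
  show "\<zero>\<^bsub>M\<^esub> \<in> shape_sub n M A" by (simp add: shape_sub_def shift_zero)
  show "x \<oplus>\<^bsub>M\<^esub> y \<in> shape_sub n M A" if "x \<in> shape_sub n M A" "y \<in> shape_sub n M A" for x y
    using that by (simp add: shape_sub_def shift_linear)
  show "scale n M z x \<in> shape_sub n M A" if "x \<in> shape_sub n M A" for z x
    using that by (simp add: shape_sub_def shift_linear scale_act[OF generators_closed(1)])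
  show "proj n M c x \<in> shape_sub n M A" if "x \<in> shape_sub n M A" for c x
    using that by (auto simp: shape_sub_def proj_proj shift_zero)
  show "raise n M x \<in> shape_sub n M A" if x: "x \<in> shape_sub n M A" for x
  proof -
    have xc: "x \<in> carrier M" using x by (simp add: shape_sub_def)
    have "shift n M (above n A c) (gaps A c) (proj n M c (raise n M x)) = \<zero>\<^bsub>M\<^esub>" for c
    proof (cases c)
      case 0 then show ?thesis using xc by (simp add: proj_out shift_zero)
    next
      case (Suc d)
      have "shift n M (Suc (above n A c)) (gaps A c) (proj n M d x) = \<zero>\<^bsub>M\<^esub>"
      proof (rule shift_mono)
        show "shift n M (above n A d) (gaps A d) (proj n M d x) = \<zero>\<^bsub>M\<^esub>" using x by (simp add: shape_sub_def)
      qed (use xc in \<open>auto simp: Suc above_Suc[OF A, of d] gaps_Suc\<close>)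
      then show ?thesis using xc by (simp add: Suc proj_raise shift_raise)
    qed
    then show ?thesis using xc by (simp add: shape_sub_def)
  qed
  show "lower n M x \<in> shape_sub n M A" if x: "x \<in> shape_sub n M A" for x
  proof -
    have xc: "x \<in> carrier M" using x by (simp add: shape_sub_def)
    have "shift n M (above n A c) (gaps A c) (proj n M c (lower n M x)) = \<zero>\<^bsub>M\<^esub>" for c
    proof -
      have "shift n M (above n A c) (Suc (gaps A c)) (proj n M (Suc c) x) = \<zero>\<^bsub>M\<^esub>"
      proof (rule shift_mono)
        show "shift n M (above n A (Suc c)) (gaps A (Suc c)) (proj n M (Suc c) x) = \<zero>\<^bsub>M\<^esub>"
          using x by (simp add: shape_sub_def)
      qed (use xc in \<open>auto simp: above_Suc[OF A, of c] gaps_Suc\<close>)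
      then show ?thesis using xc by (simp add: proj_lower shift_lower)
    qed
    then show ?thesis using xc by (simp add: shape_sub_def)
  qed
qed

end

lemma vimage_adj: "adj_swap c -` A = adj_swap c ` A"
  by (auto simp: image_iff intro!: bexI[of _ "adj_swap c _"])

lemma above_gaps_adj_other:
  assumes "1 \<le> c" "c < n" "d \<noteq> c"
  shows "above n (adj_swap c -` A) d = above n A d"
    "gaps (adj_swap c -` A) d = gaps A d"
proof -
  let ?s = "adj_swap c"
  have le: "?s x \<le> e \<longleftrightarrow> x \<le> e" if "e \<noteq> c" for e x using that by (auto simp: transpose_def)
  have gt: "e < ?s x \<longleftrightarrow> e < x" if "e \<noteq> c" for e x using le[OF that] by (metis not_le)
  have 1: "?s -` A \<inter> {d<..n} = ?s ` (A \<inter> {d<..n})"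
    unfolding vimage_adj[symmetric] vimage_Int using gt[OF assms(3)] le[of n] assms by auto
  have 2: "{1..d} - ?s -` A = ?s ` ({1..d} - A)"
    unfolding vimage_adj[symmetric] vimage_Diff using le[OF assms(3)] gt[of 0] assms by (auto simp: Suc_le_eq)
  show "above n (?s -` A) d = above n A d" "gaps (?s -` A) d = gaps A d"
    unfolding above_def gaps_def 1 2 by (simp_all add: card_image inj_on_subset[OF inj_transpose])
qed

lemma above_gaps_adj_same:
  assumes "1 \<le> c" "c < n" "c \<in> A" "Suc c \<notin> A"
  shows "above n (adj_swap c -` A) c = Suc (above n A c)"
    "gaps (adj_swap c -` A) c = Suc (gaps A c)"
proof -
  let ?s = "adj_swap c"
  have 1: "?s -` A \<inter> {c<..n} = insert (Suc c) (A \<inter> {c<..n})"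
    using assms by (auto simp: transpose_def split: if_splits)
  have 2: "{1..c} - ?s -` A = insert c ({1..c} - A)"
    using assms by (auto simp: transpose_def split: if_splits)
  show "above n (?s -` A) c = Suc (above n A c)" "gaps (?s -` A) c = Suc (gaps A c)"
    unfolding above_def gaps_def 1 2 using assms by simp_all
qed

lemma vimage_adj_id:
  "c \<in> A \<longleftrightarrow> Suc c \<in> A \<Longrightarrow> adj_swap c -` A = A"
  by (auto simp: transpose_def split: if_splits)

text \<open>An element belongs to the preimage of the trace of \<open>S\<^sub>c\<close> iff its components away from \<open>c\<close> lie in
  \<open>N\<^sub>A\<close> and \<open>U\<close> and \<open>D\<close> map it into \<open>N\<^sub>A\<close>. On the component at \<open>c\<close>, the condition from \<open>U\<close> is the old
  one if \<open>c + 1 \<in> A\<close>, and both exponents grow by one if \<open>c + 1 \<notin> A\<close>. The condition from \<open>D\<close> is the old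
  one if \<open>c \<notin> A\<close>, and both exponents grow by one if \<open>c \<in> A\<close>. So the condition at \<open>c\<close> is relaxed
  exactly for \<open>c \<in> A\<close>, \<open>c + 1 \<notin> A\<close>. The excluded case \<open>c \<notin> A\<close>, \<open>c + 1 \<in> A\<close> is the one in which \<open>\<sigma>\<^sub>c\<close>
  would remove a cell.\<close>
lemma (in preproj_module) soc_preimage_shape_sub:
  assumes A: "A \<subseteq> {1..n}" and c: "1 \<le> c" "c < n" and asc: "Suc c \<in> A \<Longrightarrow> c \<in> A"
  shows "soc_preimage n M (shape_sub n M A) c = shape_sub n M (adj_swap c -` A)"
    (is "_ = shape_sub n M ?A")
proof -
  let ?kills = "\<lambda>p q d x. shift n M p q (proj n M d x) = \<zero>\<^bsub>M\<^esub>"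
  have pp: "preproj_module n M" by (rule preproj_module_axioms)
  have iff1: "proj n M c x \<ominus>\<^bsub>M\<^esub> x \<in> shape_sub n M A \<longleftrightarrow> (\<forall>d. d \<noteq> c \<longrightarrow> ?kills (above n A d) (gaps A d) d x)"
    if x: "x \<in> carrier M" for x
  proof -
    have "?kills p q d (proj n M c x \<ominus>\<^bsub>M\<^esub> x) \<longleftrightarrow> d = c \<or> ?kills p q d x" for p q d
    proof -
      have "proj n M d (proj n M c x \<ominus>\<^bsub>M\<^esub> x) = (if d = c then \<zero>\<^bsub>M\<^esub> else scale n M (-1) (proj n M d x))"
        using x by (simp add: act_minus proj_proj) (simp add: a_minus_def scale_minus M.r_neg flip: scale_minus)
      then show ?thesis using x by (simp add: shift_zero shift_linear scale_eq_zero shift_closed)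
    qed
    then show ?thesis using x by (auto simp: shape_sub_def)
  qed
  have iff2: "raise n M x \<in> shape_sub n M A \<longleftrightarrow> (\<forall>d. ?kills (Suc (above n A (Suc d))) (gaps A (Suc d)) d x)"
    if x: "x \<in> carrier M" for x
  proof -
    have "?kills p q 0 (raise n M x)" for p q using x by (simp add: proj_out shift_zero)
    moreover have "?kills p q (Suc d) (raise n M x) \<longleftrightarrow> ?kills (Suc p) q d x" for p q d
      using x by (simp add: proj_raise shift_raise)
    moreover have "raise n M x \<in> shape_sub n M A \<longleftrightarrow> ?kills (above n A 0) (gaps A 0) 0 (raise n M x) \<and>
        (\<forall>d. ?kills (above n A (Suc d)) (gaps A (Suc d)) (Suc d) (raise n M x))"
      using x unfolding shape_sub_def by simp (metis not0_implies_Suc)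
    ultimately show ?thesis by simp
  qed
  have iff3: "lower n M x \<in> shape_sub n M A \<longleftrightarrow> (\<forall>d. ?kills (above n A d) (Suc (gaps A d)) (Suc d) x)"
    if x: "x \<in> carrier M" for x
    using x by (simp add: shape_sub_def proj_lower shift_lower)
  have "x \<in> soc_preimage n M (shape_sub n M A) c \<longleftrightarrow> x \<in> shape_sub n M ?A" for x
  proof (cases "x \<in> carrier M")
    case x: True
    have soc: "x \<in> soc_preimage n M (shape_sub n M A) c \<longleftrightarrow>
      (\<forall>d. d \<noteq> c \<longrightarrow> ?kills (above n A d) (gaps A d) d x) \<and>
      (\<forall>d. ?kills (Suc (above n A (Suc d))) (gaps A (Suc d)) d x) \<and>
      (\<forall>d. ?kills (above n A d) (Suc (gaps A d)) (Suc d) x)"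
      using c x by (subst soc_preimage_eq[OF pp shape_sub_submodule[OF A]]) (auto simp: iff1 iff2 iff3)
    have mono: "?kills p' q' d x" if "?kills p q d x" "p \<le> p'" "q \<le> q'" for p q p' q' d
      using shift_mono[OF _ that] x by simp
    obtain c' where c': "c = Suc c'" using c by (cases c) auto
    have split: "(\<forall>d. P d) \<longleftrightarrow> P c \<and> (\<forall>d. d \<noteq> c \<longrightarrow> P d)" for P :: "nat \<Rightarrow> bool" by auto
    \<comment> \<open>The conditions that \<open>U\<close> and \<open>D\<close> impose on components away from \<open>c\<close> follow from the first one.\<close>
    have soc': "x \<in> soc_preimage n M (shape_sub n M A) c \<longleftrightarrow>
      (\<forall>d. d \<noteq> c \<longrightarrow> ?kills (above n A d) (gaps A d) d x) \<and>
      ?kills (Suc (above n A (Suc c))) (gaps A (Suc c)) c x \<and> ?kills (above n A c') (Suc (gaps A c')) c x"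
    proof -
      have "?kills (Suc (above n A (Suc d))) (gaps A (Suc d)) d x"
        if "?kills (above n A d) (gaps A d) d x" for d
        by (rule mono[OF that]) (simp_all add: above_Suc[OF A, of d] gaps_Suc)
      moreover have "?kills (above n A d) (Suc (gaps A d)) (Suc d) x"
        if "?kills (above n A (Suc d)) (gaps A (Suc d)) (Suc d) x" for d
        by (rule mono[OF that]) (simp_all add: above_Suc[OF A, of d] gaps_Suc)
      ultimately show ?thesis unfolding soc using c' by (metis Suc_inject)
    qed
    have shape_iff: "x \<in> shape_sub n M ?A \<longleftrightarrow> ?kills (above n ?A c) (gaps ?A c) c x \<and>
      (\<forall>d. d \<noteq> c \<longrightarrow> ?kills (above n A d) (gaps A d) d x)"
      unfolding shape_sub_def using x split[of "\<lambda>d. ?kills (above n ?A d) (gaps ?A d) d x"]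
      by (simp add: above_gaps_adj_other[OF c])
    have low: "above n A c' = above n A c + (if c \<in> A then 1 else 0)" "gaps A c = gaps A c' + (if c \<in> A then 0 else 1)"
      unfolding c' using above_Suc[OF A, of c'] gaps_Suc[of A c'] by auto
    have key: "?kills (above n ?A c) (gaps ?A c) c x \<longleftrightarrow>
      ?kills (Suc (above n A (Suc c))) (gaps A (Suc c)) c x \<and> ?kills (above n A c') (Suc (gaps A c')) c x"
    proof (cases "c \<in> A \<and> Suc c \<notin> A")
      case True
      then show ?thesis using above_gaps_adj_same[OF c] low above_Suc[OF A, of c] gaps_Suc[of A c] by simp
    next
      case False
      then have "?A = A" using asc by (intro vimage_adj_id) auto
      moreover have "?kills (Suc (above n A (Suc c))) (gaps A (Suc c)) c x"
        "?kills (above n A c') (Suc (gaps A c')) c x" if k: "?kills (above n A c) (gaps A c) c x"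
        using low above_Suc[OF A, of c] gaps_Suc[of A c]
        by (auto intro!: mono[OF k])
      moreover have "?kills (above n A c) (gaps A c) c x"
        if k: "?kills (Suc (above n A (Suc c))) (gaps A (Suc c)) c x" "?kills (above n A c') (Suc (gaps A c')) c x"
        using k low above_Suc[OF A, of c] gaps_Suc[of A c] False by (cases "Suc c \<in> A") auto
      ultimately show ?thesis by auto
    qed
    show ?thesis unfolding soc' shape_iff key by blast
  next
    case False
    then show ?thesis by (auto simp: soc_preimage_def shape_sub_def)
  qed
  then show ?thesis by blast
qed

section \<open>Lifting along injectivity\<close>

text \<open>A path of positive length starting at \<open>c\<close> factors through one of the two arrows starting at \<open>c\<close>, and
  this operation cancels that arrow. It is left linear on elements without constant term at \<open>c\<close>.\<close>
definition strip_source :: "nat \<Rightarrow> (nat list \<Rightarrow> complex) \<Rightarrow> nat list \<Rightarrow> complex"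
  where "strip_source c f = (\<lambda>q. if q = [] then 0 else f (q @ [c]))"

lemma strip_source_closed:
  assumes "f \<in> carrier (path_algebra n)"
  shows "strip_source c f \<in> carrier (path_algebra n)"
proof -
  have "{q. strip_source c f q \<noteq> 0} \<subseteq> butlast ` {p. f p \<noteq> 0}"
  proof
    fix q assume "q \<in> {q. strip_source c f q \<noteq> 0}"
    then have "f (q @ [c]) \<noteq> 0" by (auto simp: strip_source_def split: if_splits)
    then show "q \<in> butlast ` {p. f p \<noteq> 0}" by (intro image_eqI[of _ _ "q @ [c]"]) auto
  qed
  moreover have "q \<in> quiver_paths n" if "strip_source c f q \<noteq> 0" for q
  proof -
    have q: "q \<noteq> []" "q @ [c] \<in> quiver_paths n"
      using that assms by (auto simp: strip_source_def path_algebra_simps split: if_splits)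
    have "q ! Suc k = Suc (q ! k) \<or> q ! k = Suc (q ! Suc k)" if "Suc k < length q" for k
    proof -
      have "Suc k < length (q @ [c])" using that by simp
      then have "(q @ [c]) ! Suc k = Suc ((q @ [c]) ! k) \<or> (q @ [c]) ! k = Suc ((q @ [c]) ! Suc k)"
        using q(2) unfolding quiver_paths_def by blast
      then show ?thesis using that by (simp add: nth_append)
    qed
    then show ?thesis using q unfolding quiver_paths_def by auto
  qed
  ultimately show ?thesis using assms unfolding path_algebra_simps
    by (auto intro: finite_subset)
qed

lemma strip_source_add: "strip_source c (f \<oplus>\<^bsub>path_algebra n\<^esub> g) = strip_source c f \<oplus>\<^bsub>path_algebra n\<^esub> strip_source c g"
  by (auto simp: strip_source_def path_algebra_simps)

lemma strip_source_mult:
  assumes "f \<in> carrier (path_algebra n)"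
  shows "strip_source c (f \<otimes>\<^bsub>path_algebra n\<^esub> g) =
    f \<otimes>\<^bsub>path_algebra n\<^esub> strip_source c g \<oplus>\<^bsub>path_algebra n\<^esub> scalar_elem n (g [c]) \<otimes>\<^bsub>path_algebra n\<^esub> strip_source c f"
  unfolding scalar_mult(1)[OF strip_source_closed[OF assms]]
proof
  fix q
  show "strip_source c (f \<otimes>\<^bsub>path_algebra n\<^esub> g) q =
    (f \<otimes>\<^bsub>path_algebra n\<^esub> strip_source c g \<oplus>\<^bsub>path_algebra n\<^esub> (\<lambda>p. g [c] * strip_source c f p)) q"
  proof (cases "q = []")
    case False
    have "(\<Sum>k<length q. f (take (Suc k) (q @ [c])) * g (drop k (q @ [c]))) =
      (\<Sum>k<length q. f (take (Suc k) q) * strip_source c g (drop k q))"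
      by (intro sum.cong) (auto simp: strip_source_def)
    then show ?thesis using False by (simp add: path_algebra_simps strip_source_def mult.commute)
  qed (simp add: path_algebra_simps strip_source_def)
qed

lemma strip_source_generators:
  assumes "c \<in> {1..<n}"
  shows "strip_source c (raise_elem n) = vtx n (Suc c)" "strip_source c (lower_elem n) = vtx n (c - 1)" "strip_source c (vtx n c) = (\<lambda>p. 0)"
proof -
  show "strip_source c (raise_elem n) = vtx n (Suc c)"
  proof
    fix q show "strip_source c (raise_elem n) q = vtx n (Suc c) q"
      using assms by (cases q) (auto simp: strip_source_def raise_elem_def vtx_def)
  qed
  show "strip_source c (lower_elem n) = vtx n (c - 1)"
  proof
    fix q show "strip_source c (lower_elem n) q = vtx n (c - 1) q"
      using assms by (cases q) (auto simp: strip_source_def lower_elem_def vtx_def)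
  qed
  show "strip_source c (vtx n c) = (\<lambda>p. 0)" by (auto simp: strip_source_def vtx_def)
qed

definition regular_lmod :: "('a, 'x) ring_scheme \<Rightarrow> ('a, 'a) module"
  where "regular_lmod R = \<lparr>carrier = carrier R, monoid.mult = undefined, one = undefined, zero = \<zero>\<^bsub>R\<^esub>,
    add = add R, smult = monoid.mult R\<rparr>"

lemma regular_lmod_simps [simp]:
  "carrier (regular_lmod R) = carrier R" "\<zero>\<^bsub>regular_lmod R\<^esub> = \<zero>\<^bsub>R\<^esub>"
  "x \<oplus>\<^bsub>regular_lmod R\<^esub> y = x \<oplus>\<^bsub>R\<^esub> y" "x \<odot>\<^bsub>regular_lmod R\<^esub> y = x \<otimes>\<^bsub>R\<^esub> y"
  by (simp_all add: regular_lmod_def)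

lemma (in ring) lmodule_regular: "lmodule R (regular_lmod R)"
proof -
  have "abelian_group (regular_lmod R)"
  proof (rule abelian_groupI)
    fix x assume "x \<in> carrier (regular_lmod R)"
    then show "\<exists>y\<in>carrier (regular_lmod R). y \<oplus>\<^bsub>regular_lmod R\<^esub> x = \<zero>\<^bsub>regular_lmod R\<^esub>"
      by (intro bexI[of _ "\<ominus> x"]) (simp_all add: l_neg)
  qed (simp_all add: a_assoc, simp add: a_comm)
  then show ?thesis
    by (intro lmodule.intro lmodule_axioms.intro ring_axioms) (simp_all add: l_distr r_distr m_assoc)
qed

context preproj_module
begin

text \<open>Cancelling the arrow is compatible with the relations when it is followed by the action on \<open>u\<close>.
  The elements of the ideal for which this holds form an ideal, because those elements act as zero
  and have no constant terms; and for the relation itself this is the assumption on \<open>u\<close>.\<close>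
lemma strip_source_ideal:
  assumes c: "c \<in> {1..<n}" and u: "u \<in> carrier M"
    and rel: "lower n M (proj n M (Suc c) u) = raise n M (proj n M (c - 1) u)"
    and f: "f \<in> Idl\<^bsub>PA\<^esub> {preprojective_relation n}"
  shows "act n M (strip_source c f) u = \<zero>\<^bsub>M\<^esub>"
proof -
  interpret PA: ring PA by (rule ring_path_algebra)
  let ?I = "Idl\<^bsub>PA\<^esub> {preprojective_relation n}"
  interpret I: ideal ?I PA by (rule ideal_preprojective)
  let ?J = "{f \<in> ?I. act n M (strip_source c f) u = \<zero>\<^bsub>M\<^esub>}"
  have IPA: "g \<in> carrier PA" if "g \<in> ?I" for g using that I.a_Hcarr by blast
  have \<rho>: "preprojective_relation n \<in> ?I" using PA.genideal_self' preprojective_relation_carrier by blast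
  have mult: "act n M (strip_source c (g \<otimes>\<^bsub>PA\<^esub> h)) u =
    act n M g (act n M (strip_source c h) u) \<oplus>\<^bsub>M\<^esub> scale n M (h [c]) (act n M (strip_source c g) u)"
    if "g \<in> carrier PA" "h \<in> carrier PA" for g h
    using that u by (simp add: strip_source_mult add_act mult_act strip_source_closed)
  have left: "g \<otimes>\<^bsub>PA\<^esub> h \<in> ?J" if "g \<in> carrier PA" "h \<in> ?J" for g h
    using that u IPA I.I_l_closed ideal_preprojective_coeff[of h n c]
    by (simp add: mult scale_0 strip_source_closed)
  have right: "h \<otimes>\<^bsub>PA\<^esub> g \<in> ?J" if "g \<in> carrier PA" "h \<in> ?J" for g h
    using that u IPA I.I_r_closed by (simp add: mult ideal_act strip_source_closed)
  have "ideal ?J PA"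
  proof (rule idealI[OF ring_path_algebra])
    show "subgroup ?J (add_monoid PA)"
    proof (rule PA.add.subgroupI)
      show "?J \<subseteq> carrier PA" using IPA by blast
      have "strip_source c \<zero>\<^bsub>PA\<^esub> = (\<lambda>p. 0)" by (simp add: strip_source_def path_algebra_simps)
      then have "\<zero>\<^bsub>PA\<^esub> \<in> ?J"
        using u additive_subgroup.zero_closed[OF I.is_additive_subgroup] by (simp add: zero_act)
      then show "?J \<noteq> {}" by blast
      fix g h assume g: "g \<in> ?J"
      have "\<ominus>\<^bsub>PA\<^esub> g = \<ominus>\<^bsub>PA\<^esub> \<one>\<^bsub>PA\<^esub> \<otimes>\<^bsub>PA\<^esub> g" using IPA g by (simp add: PA.l_minus)
      moreover have "\<ominus>\<^bsub>PA\<^esub> \<one>\<^bsub>PA\<^esub> \<otimes>\<^bsub>PA\<^esub> g \<in> ?J" by (rule left[OF _ g]) simp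
      ultimately show "\<ominus>\<^bsub>PA\<^esub> g \<in> ?J" by argo
      assume h: "h \<in> ?J"
      have "g \<oplus>\<^bsub>PA\<^esub> h \<in> ?I"
        by (rule additive_subgroup.a_closed[OF I.is_additive_subgroup]) (use g h in auto)
      moreover have "act n M (strip_source c (g \<oplus>\<^bsub>PA\<^esub> h)) u = \<zero>\<^bsub>M\<^esub>"
        using g h u IPA[of g] IPA[of h] by (simp add: strip_source_add add_act strip_source_closed)
      ultimately show "g \<oplus>\<^bsub>PA\<^esub> h \<in> ?J" by simp
    qed
  qed (use left right in blast)+
  moreover have "preprojective_relation n \<in> ?J"
  proof -
    have "strip_source c (lower_elem n \<otimes>\<^bsub>PA\<^esub> raise_elem n) =
      strip_source c (preprojective_relation n) \<oplus>\<^bsub>PA\<^esub> strip_source c (raise_elem n \<otimes>\<^bsub>PA\<^esub> lower_elem n)"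
      unfolding preprojective_relation_eq by (rule strip_source_add)
    then have "act n M (strip_source c (lower_elem n \<otimes>\<^bsub>PA\<^esub> raise_elem n)) u =
      act n M (strip_source c (preprojective_relation n)) u \<oplus>\<^bsub>M\<^esub> act n M (strip_source c (raise_elem n \<otimes>\<^bsub>PA\<^esub> lower_elem n)) u"
      using u preprojective_relation_carrier by (simp add: add_act strip_source_closed path_algebra_mult_closed)
    moreover have "act n M (strip_source c (lower_elem n \<otimes>\<^bsub>PA\<^esub> raise_elem n)) u = lower n M (proj n M (Suc c) u)"
      using u c by (simp add: mult strip_source_generators) (simp add: raise_elem_def scale_0)
    moreover have "act n M (strip_source c (raise_elem n \<otimes>\<^bsub>PA\<^esub> lower_elem n)) u = raise n M (proj n M (c - 1) u)"
      using u c by (simp add: mult strip_source_generators) (simp add: lower_elem_def scale_0)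
    ultimately have "raise n M (proj n M (c - 1) u) =
      act n M (strip_source c (preprojective_relation n)) u \<oplus>\<^bsub>M\<^esub> raise n M (proj n M (c - 1) u)"
      using rel by simp
    moreover have "raise n M (proj n M (c - 1) u) \<in> carrier M" using u by simp
    moreover have "act n M (strip_source c (preprojective_relation n)) u \<in> carrier M"
      using u preprojective_relation_carrier by (simp add: strip_source_closed)
    ultimately have "act n M (strip_source c (preprojective_relation n)) u = \<zero>\<^bsub>M\<^esub>"
      using M.add.r_cancel_one' by blast
    then show ?thesis using \<rho> by simp
  qed
  ultimately have "?I \<subseteq> ?J" by (intro PA.genideal_minimal) auto
  then show ?thesis using f by blast
qed

text \<open>The left ideal \<open>L\<close> of elements without constant term at \<open>c\<close> has a homomorphism to \<open>M\<close> that sends the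
  arrow from \<open>c\<close> to \<open>c + 1\<close> to \<open>y\<close> and the arrow from \<open>c\<close> to \<open>c - 1\<close> to \<open>z\<close>; it is well defined
  because the only relation between these two arrows is the one that \<open>y\<close> and \<open>z\<close> satisfy. By
  injectivity it extends to the algebra, and the image of \<open>e\<^sub>c\<close> is the required element.\<close>
lemma injective_lift:
  assumes inj: "injective_lmod (preprojective_algebra n) M" and c: "c \<in> {1..<n}"
    and y: "y \<in> comp_at n M (Suc c)" and z: "z \<in> comp_at n M (c - 1)"
    and rel: "lower n M y = raise n M z"
  obtains x where "x \<in> comp_at n M c" "raise n M x = y" "lower n M x = z"
proof -
  interpret PA: ring PA by (rule ring_path_algebra)
  let ?P = "preprojective_algebra n"
  let ?I = "Idl\<^bsub>PA\<^esub> {preprojective_relation n}"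
  interpret I: ideal ?I PA by (rule ideal_preprojective)
  \<comment> \<open>The summands live at different vertices, so acting on \<open>u\<close> after cancelling an arrow selects
    the summand that belongs to this arrow.\<close>
  define u where "u = y \<oplus>\<^bsub>M\<^esub> z"
  have yz: "y \<in> carrier M" "z \<in> carrier M" using y z comp_closed by auto
  then have u: "u \<in> carrier M" by (simp add: u_def)
  have "Suc c \<noteq> c - 1" by simp
  then have pu: "proj n M (Suc c) u = y" "proj n M (c - 1) u = z"
    using yz proj_comp[OF y] proj_comp[OF z] by (simp_all add: u_def)
  define cl where "cl f = ?I +>\<^bsub>PA\<^esub> f" for f
  have cl: "cl f \<in> carrier ?P" "cl f \<oplus>\<^bsub>?P\<^esub> cl g = cl (f \<oplus>\<^bsub>PA\<^esub> g)" "cl f \<otimes>\<^bsub>?P\<^esub> cl g = cl (f \<otimes>\<^bsub>PA\<^esub> g)"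
    if "f \<in> carrier PA" "g \<in> carrier PA" for f g
    using preprojective_algebra_simps(1-3)[OF that] by (simp_all add: cl_def)
  have clE: "\<exists>f\<in>carrier PA. X = cl f" if "X \<in> carrier ?P" for X
    using that unfolding preprojective_algebra_carrier cl_def by blast
  have cl_smult: "cl f \<odot>\<^bsub>M\<^esub> x = act n M f x" for f x by (simp add: cl_def act_def)
  define g where "g X = act n M (strip_source c (SOME f. f \<in> carrier PA \<and> X = cl f)) u" for X
  have g: "g (cl f) = act n M (strip_source c f) u" if f: "f \<in> carrier PA" for f
  proof -
    let ?h = "SOME h. h \<in> carrier PA \<and> cl f = cl h"
    have h: "?h \<in> carrier PA \<and> cl f = cl ?h" by (rule someI[of _ f]) (use f in simp)
    then have "?h \<in> ?I +>\<^bsub>PA\<^esub> f" using I.a_rcos_self unfolding cl_def by blast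
    then obtain i where i: "i \<in> ?I" "?h = i \<oplus>\<^bsub>PA\<^esub> f" unfolding a_r_coset_def' by auto
    have ic: "i \<in> carrier PA" using i I.a_Hcarr by blast
    have "act n M (strip_source c i) u = \<zero>\<^bsub>M\<^esub>"
      by (rule strip_source_ideal[OF c u _ i(1)]) (simp only: pu rel)
    then show ?thesis using u f ic unfolding g_def i(2) by (simp add: strip_source_add add_act strip_source_closed)
  qed
  define L where "L = cl ` {f \<in> carrier PA. f [c] = 0}"
  define B where "B = regular_lmod ?P"
  have LI: "cl f \<in> L" if "f \<in> carrier PA" "f [c] = 0" for f using that by (simp add: L_def)
  have LE: "\<exists>f\<in>carrier PA. f [c] = 0 \<and> X = cl f" if "X \<in> L" for X using that by (auto simp: L_def)
  have B: "lmodule ?P B" unfolding B_def by (rule ring.lmodule_regular[OF ring_preprojective_algebra])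
  have zc: "\<zero>\<^bsub>?P\<^esub> = cl (\<lambda>p. 0)"
    using preprojective_algebra_simps(5)[OF path_algebra_one_closed path_algebra_one_closed]
      PA.a_rcos_zero[OF ideal_preprojective, of "\<zero>\<^bsub>PA\<^esub>"] additive_subgroup.zero_closed[OF I.is_additive_subgroup]
    by (simp add: cl_def path_algebra_simps(4))
  have zPA: "(\<lambda>p. 0) \<in> carrier PA" by (simp add: path_algebra_simps)
  have L: "submodule L ?P B"
  proof (rule lmodule.submoduleI[OF B])
    show "L \<subseteq> carrier B" using LE cl(1) by (auto simp: B_def)
    show "\<zero>\<^bsub>B\<^esub> \<in> L" using LI[OF zPA] by (simp add: B_def zc)
    fix X Y assume "X \<in> L" "Y \<in> L"
    then obtain f h where fh: "f \<in> carrier PA" "f [c] = 0" "X = cl f" "h \<in> carrier PA" "h [c] = 0" "Y = cl h"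
      using LE by blast
    have "(f \<oplus>\<^bsub>PA\<^esub> h) [c] = 0" using fh by (simp add: path_algebra_simps)
    then show "X \<oplus>\<^bsub>B\<^esub> Y \<in> L"
      using LI[OF PA.a_closed[OF fh(1,4)]] by (simp add: B_def fh(3,6) cl(2)[OF fh(1,4)])
  next
    fix r X assume r: "r \<in> carrier ?P" and X: "X \<in> L"
    obtain a where a: "a \<in> carrier PA" "r = cl a" using clE r by blast
    obtain f where f: "f \<in> carrier PA" "f [c] = 0" "X = cl f" using LE X by blast
    have "(a \<otimes>\<^bsub>PA\<^esub> f) [c] = 0" using f by (simp add: path_algebra_simps)
    then show "r \<odot>\<^bsub>B\<^esub> X \<in> L"
      using LI[OF PA.m_closed[OF a(1) f(1)]] by (simp add: B_def a(2) f(3) cl(3)[OF a(1) f(1)])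
  qed
  have "g \<in> lmod_hom ?P (sub_lmod B L) M"
    unfolding lmod_hom_def
  proof (intro CollectI conjI ballI)
    show "g \<in> carrier (sub_lmod B L) \<rightarrow> carrier M"
    proof
      fix X assume "X \<in> carrier (sub_lmod B L)"
      then obtain f where "f \<in> carrier PA" "X = cl f" using LE by auto
      then show "g X \<in> carrier M" using u by (simp add: g strip_source_closed)
    qed
    fix X Y assume "X \<in> carrier (sub_lmod B L)" "Y \<in> carrier (sub_lmod B L)"
    then have "X \<in> L" "Y \<in> L" by simp_all
    then obtain f h where fh: "f \<in> carrier PA" "X = cl f" "h \<in> carrier PA" "Y = cl h" using LE by blast
    have "g (X \<oplus>\<^bsub>sub_lmod B L\<^esub> Y) = g (cl (f \<oplus>\<^bsub>PA\<^esub> h))" by (simp add: B_def fh(2,4) cl(2)[OF fh(1,3)])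
    also have "\<dots> = g X \<oplus>\<^bsub>M\<^esub> g Y"
      using u fh by (simp add: g strip_source_add add_act strip_source_closed)
    finally show "g (X \<oplus>\<^bsub>sub_lmod B L\<^esub> Y) = g X \<oplus>\<^bsub>M\<^esub> g Y" .
  next
    fix r X assume r: "r \<in> carrier ?P" and X: "X \<in> carrier (sub_lmod B L)"
    obtain a where a: "a \<in> carrier PA" "r = cl a" using clE r by blast
    obtain f where f: "f \<in> carrier PA" "f [c] = 0" "X = cl f" using LE X by auto
    have "g (r \<odot>\<^bsub>sub_lmod B L\<^esub> X) = g (cl (a \<otimes>\<^bsub>PA\<^esub> f))" by (simp add: B_def a(2) f(3) cl(3)[OF a(1) f(1)])
    also have "\<dots> = act n M (strip_source c (a \<otimes>\<^bsub>PA\<^esub> f)) u" by (rule g[OF PA.m_closed[OF a(1) f(1)]])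
    also have "\<dots> = act n M a (act n M (strip_source c f) u)"
      using u a(1) f by (simp add: strip_source_mult add_act mult_act strip_source_closed scale_0)
    also have "\<dots> = r \<odot>\<^bsub>M\<^esub> g X" by (simp add: g[OF f(1)] f(3) a(2) cl_smult)
    finally show "g (r \<odot>\<^bsub>sub_lmod B L\<^esub> X) = r \<odot>\<^bsub>M\<^esub> g X" .
  qed
  moreover have "(\<lambda>X. X) \<in> lmod_hom ?P (sub_lmod B L) B"
    using submoduleD(1)[OF L] by (auto simp: lmod_hom_def)
  moreover have "inj_on (\<lambda>X. X) (carrier (sub_lmod B L))" by simp
  ultimately have "\<exists>h\<in>lmod_hom ?P B M. \<forall>X\<in>carrier (sub_lmod B L). h X = g X"
    using inj lmodule_sub[OF B L] B unfolding injective_lmod_def by blast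
  then obtain h where h: "h \<in> lmod_hom ?P B M" "\<And>X. X \<in> L \<Longrightarrow> h X = g X" by auto
  define x where "x = h (cl (vtx n c))"
  note vc = generators_closed(1)[of n c]
  have x: "x \<in> carrier M" using lmod_homD(3)[OF h(1)] cl(1)[OF vc vc] by (simp add: x_def B_def)
  have ax: "act n M a x = h (cl (a \<otimes>\<^bsub>PA\<^esub> vtx n c))" if a: "a \<in> carrier PA" for a
    using lmod_homD(2)[OF h(1), of "cl a" "cl (vtx n c)"] cl(1)[OF vc vc] cl(1,3)[OF a vc]
    by (simp add: x_def B_def cl_smult)
  have ax': "act n M a x = act n M (strip_source c a) u" if a: "a \<in> carrier PA" "a [c] = 0" for a
  proof -
    have "(a \<otimes>\<^bsub>PA\<^esub> vtx n c) [c] = 0" using a(2) by (simp add: mult_vtx)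
    then have "cl (a \<otimes>\<^bsub>PA\<^esub> vtx n c) \<in> L" using a(1) by (intro LI PA.m_closed) auto
    then have "act n M a x = g (cl (a \<otimes>\<^bsub>PA\<^esub> vtx n c))" using h(2) ax[OF a(1)] by simp
    also have "\<dots> = act n M (strip_source c a) u"
    proof -
      have "vtx n c [c] = 1" using c by (simp add: vtx_def)
      then have "strip_source c (a \<otimes>\<^bsub>PA\<^esub> vtx n c) = a \<otimes>\<^bsub>PA\<^esub> (\<lambda>p. 0) \<oplus>\<^bsub>PA\<^esub> scalar_elem n 1 \<otimes>\<^bsub>PA\<^esub> strip_source c a"
        by (simp add: strip_source_mult[OF a(1)] strip_source_generators(3)[OF c])
      then show ?thesis using u a(1) zPA
        by (simp add: g[OF PA.m_closed[OF a(1) vc]] add_act mult_act strip_source_closed zero_act scale_1)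
    qed
    finally show ?thesis .
  qed
  show ?thesis
  proof (rule that)
    show "x \<in> comp_at n M c" using x ax[OF generators_closed(1), of c] by (simp add: comp_at_def vtx_vtx x_def)
    show "raise n M x = y"
      using ax'[OF generators_closed(2)] pu strip_source_generators[OF c] by (simp add: raise_elem_def)
    show "lower n M x = z"
      using ax'[OF generators_closed(3)] pu strip_source_generators[OF c] by (simp add: lower_elem_def)
  qed
qed

end

section \<open>Modules with simple socle\<close>

locale simple_socle_module = preproj_module n M
  for n and M :: "((nat list \<Rightarrow> complex) set, 'b, 'y) module_scheme" +
  fixes j :: nat and s :: 'b
  assumes j: "j \<in> {1..<n}"
    and s: "s \<in> killed_at j" "s \<noteq> \<zero>\<^bsub>M\<^esub>" "killed_at j \<subseteq> line s"
    and killed_other: "\<And>d. d \<in> {1..<n} \<Longrightarrow> d \<noteq> j \<Longrightarrow> killed_at d = {\<zero>\<^bsub>M\<^esub>}"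
begin

lemma killed_off_socle:
  assumes "x \<in> comp_at n M c" "c \<noteq> j" "raise n M x = \<zero>\<^bsub>M\<^esub>" "lower n M x = \<zero>\<^bsub>M\<^esub>"
  shows "x = \<zero>\<^bsub>M\<^esub>"
proof (cases "c \<in> {1..<n}")
  case True
  have "x \<in> killed_at c" using assms by (simp add: killed_at_def)
  then show ?thesis using killed_other[OF True assms(2)] by simp
qed (use comp_out assms in blast)

text \<open>If \<open>Dx = 0\<close>, then \<open>D(Ux) = U(Dx) = 0\<close> at the next vertex. Going up to the last vertex, induction
  gives \<open>Ux = 0\<close>, so \<open>x\<close> is in the socle at a vertex different from \<open>j\<close>.\<close>
lemma lower_injective:
  assumes "x \<in> comp_at n M c" "j < c" "lower n M x = \<zero>\<^bsub>M\<^esub>"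
  shows "x = \<zero>\<^bsub>M\<^esub>"
  using assms
proof (induction "n - c" arbitrary: c x)
  case 0
  then show ?case using comp_out[of c x] by simp
next
  case (Suc d)
  have "lower n M (raise n M x) = \<zero>\<^bsub>M\<^esub>"
    using Suc(5) comp_closed[OF Suc(3)] by (simp add: lower_raise)
  then have "raise n M x = \<zero>\<^bsub>M\<^esub>"
    using Suc(1)[of "Suc c" "raise n M x"] Suc(2,4) raise_comp[OF Suc(3)] by simp
  then show ?case using killed_off_socle[OF Suc(3)] Suc(4,5) by simp
qed

lemma raise_injective:
  assumes "x \<in> comp_at n M c" "c < j" "raise n M x = \<zero>\<^bsub>M\<^esub>"
  shows "x = \<zero>\<^bsub>M\<^esub>"
  using assms
proof (induction c arbitrary: x)
  case 0
  then show ?case using comp_out[of 0 x] by simp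
next
  case (Suc c)
  have "raise n M (lower n M x) = \<zero>\<^bsub>M\<^esub>"
    using Suc(4) comp_closed[OF Suc(2)] by (simp flip: lower_raise)
  then have "lower n M x = \<zero>\<^bsub>M\<^esub>"
    using Suc(1)[of "lower n M x"] Suc(3) lower_comp[OF Suc(2)] by simp
  then show ?case using killed_off_socle[OF Suc(2)] Suc(3,4) by simp
qed

lemma shape_sub_initial: "shape_sub n M {1..j} = {\<zero>\<^bsub>M\<^esub>}"
proof -
  have up: "x = \<zero>\<^bsub>M\<^esub>" if "x \<in> comp_at n M c" "c + p \<le> j" "shift n M p 0 x = \<zero>\<^bsub>M\<^esub>" for x c p
    using that(2,3)
  proof (induction p)
    case 0 then show ?case by (simp add: shift_0_0)
  next
    case (Suc p)
    have "raise n M (shift n M p 0 x) = \<zero>\<^bsub>M\<^esub>" using Suc(3) by (simp add: raise_shift)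
    then have "shift n M p 0 x = \<zero>\<^bsub>M\<^esub>"
      using raise_injective[OF shift_comp[OF that(1), of p "c + p" 0]] Suc(2) by simp
    then show ?case using Suc by simp
  qed
  have down: "x = \<zero>\<^bsub>M\<^esub>" if "x \<in> comp_at n M c" "j + q \<le> c" "shift n M 0 q x = \<zero>\<^bsub>M\<^esub>" for x c q
    using that(2,3)
  proof (induction q)
    case 0 then show ?case by (simp add: shift_0_0)
  next
    case (Suc q)
    have "lower n M (shift n M 0 q x) = \<zero>\<^bsub>M\<^esub>"
      using Suc(3) comp_closed[OF that(1)] by (simp add: lower_shift)
    then have "shift n M 0 q x = \<zero>\<^bsub>M\<^esub>"
      using lower_injective[OF shift_comp[OF that(1), of 0 "c - q" q]] Suc(2) by simp
    then show ?case using Suc by simp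
  qed
  have "x = \<zero>\<^bsub>M\<^esub>" if x: "x \<in> shape_sub n M {1..j}" for x
  proof (rule eq_zero_if_components)
    show xc: "x \<in> carrier M" using x by (simp add: shape_sub_def)
    fix c
    have "{1..j} \<inter> {c<..n} = {c<..j}" "{1..c} - {1..j} = {j<..c}" using j by auto
    then have "above n {1..j} c = j - c" "gaps {1..j} c = c - j" by (simp_all only: above_def gaps_def card_greaterThanAtMost)
    then have "shift n M (j - c) (c - j) (proj n M c x) = \<zero>\<^bsub>M\<^esub>"
      using x unfolding shape_sub_def by (metis (mono_tags, lifting) mem_Collect_eq)
    then show "proj n M c x = \<zero>\<^bsub>M\<^esub>"
      using up[OF proj_in_comp[OF xc, of c], of "j - c"] down[OF proj_in_comp[OF xc, of c], of "c - j"]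
      by (cases "c \<le> j") auto
  qed
  moreover have "\<zero>\<^bsub>M\<^esub> \<in> shape_sub n M {1..j}" by (simp add: shape_sub_def shift_zero)
  ultimately show ?thesis by blast
qed

lemma socle_line:
  assumes "z \<in> comp_at n M j" "raise n M (lower n M z) = \<zero>\<^bsub>M\<^esub>"
  shows "\<exists>a. z = scale n M a s"
proof -
  have zc: "z \<in> carrier M" using comp_closed assms(1) .
  obtain d where d: "j = Suc d" using j by (cases j) auto
  have "lower n M z = \<zero>\<^bsub>M\<^esub>" using raise_injective[OF lower_comp[of z d]] assms d by simp
  moreover have "raise n M z = \<zero>\<^bsub>M\<^esub>"
    using lower_injective[OF raise_comp[OF assms(1)]] assms(2) lower_raise[OF zc] by simp
  ultimately have "z \<in> killed_at j" using assms(1) by (simp add: killed_at_def)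
  then show ?thesis using s(3) by (auto simp: line_def)
qed

end

text \<open>This is the statement that the cell with these coordinates has colour \<open>c\<close>.\<close>
lemma card_above_gaps:
  assumes "A \<subseteq> {1..n}"
  shows "c + above n A c = card A + gaps A c"
proof (induction c)
  case 0
  have "A \<inter> {0<..n} = A" using assms by auto
  then show ?case by (simp add: above_def gaps_def)
next
  case (Suc c)
  then show ?case using above_Suc[OF assms, of c] gaps_Suc[of A c] by (simp split: if_splits)
qed

locale injective_simple_socle_module = simple_socle_module +
  assumes inj: "injective_lmod (preprojective_algebra n) M"
begin

text \<open>A row of cells is built cell by cell. The next cell exists by injectivity, since its two prescribed
  neighbours, in the previous row and in this row, are compatible: \<open>D\<close> of the former and \<open>U\<close> of the
  latter are the same cell of the previous row.\<close>

lemma lift_row: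
  assumes x0: "x0 \<in> comp_at n M d" "lower n M x0 = \<zero>\<^bsub>M\<^esub>" "raise n M x0 = prev 0" and d: "1 \<le> d" "d + N \<le> n"
    and prev: "\<And>q. q < N \<Longrightarrow> prev q \<in> comp_at n M (Suc (d + q))"
      "\<And>q. Suc q < N \<Longrightarrow> lower n M (prev (Suc q)) = prev q"
  shows "\<exists>r. r 0 = x0 \<and> (\<forall>q<N. r q \<in> comp_at n M (d + q) \<and> raise n M (r q) = prev q) \<and>
    (\<forall>q. Suc q < N \<longrightarrow> lower n M (r (Suc q)) = r q)"
  using d(2) prev
proof (induction N)
  case (Suc N)
  then obtain r where r: "r 0 = x0" "\<And>q. q < N \<Longrightarrow> r q \<in> comp_at n M (d + q) \<and> raise n M (r q) = prev q"
    "\<And>q. Suc q < N \<Longrightarrow> lower n M (r (Suc q)) = r q" by auto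
  show ?case
  proof (cases N)
    case 0
    then show ?thesis using x0 by (intro exI[of _ "\<lambda>_. x0"]) auto
  next
    case (Suc N')
    have "lower n M (prev N) = raise n M (r N')" using Suc.prems(3)[of N'] r(2)[of N'] Suc by simp
    moreover have "prev N \<in> comp_at n M (Suc (d + N))" using Suc.prems(2)[of N] by simp
    moreover have "r N' \<in> comp_at n M (d + N - 1)" using r(2)[of N'] Suc by simp
    moreover have "d + N \<in> {1..<n}" using d(1) Suc.prems(1) by auto
    ultimately obtain x where x: "x \<in> comp_at n M (d + N)" "raise n M x = prev N" "lower n M x = r N'"
      using injective_lift[OF inj, of "d + N" "prev N" "r N'"] by blast
    show ?thesis
    proof (intro exI[of _ "r(N := x)"] conjI allI impI)
      show "(r(N := x)) 0 = x0" using r(1) Suc by simp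
      show "(r(N := x)) q \<in> comp_at n M (d + q)" "raise n M ((r(N := x)) q) = prev q" if "q < Suc N" for q
        using that x r(2)[of q] by (auto simp: less_Suc_eq)
      show "lower n M ((r(N := x)) (Suc q)) = (r(N := x)) q" if "Suc q < Suc N" for q
        using that x r(3)[of q] Suc by auto
    qed
  qed
qed (auto intro: exI[of _ "\<lambda>_. x0"])

text \<open>The cells of the row \<open>p\<close> of the rectangle, each lifted from its neighbours in the previous row
  and in the same row.\<close>
lemma rectangle_rows:
  assumes "p < j"
  shows "\<exists>r. (\<forall>q<n - j. r q \<in> comp_at n M (j - p + q)) \<and> lower n M (r 0) = \<zero>\<^bsub>M\<^esub> \<and>
    (\<forall>q. Suc q < n - j \<longrightarrow> lower n M (r (Suc q)) = r q) \<and> (raise n M ^^ p) (r 0) = s"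
  using assms
proof (induction p)
  case 0
  have s': "s \<in> comp_at n M j" "raise n M s = \<zero>\<^bsub>M\<^esub>" "lower n M s = \<zero>\<^bsub>M\<^esub>" using s(1) by (auto simp: killed_at_def)
  have "\<exists>r. r 0 = s \<and> (\<forall>q<n - j. r q \<in> comp_at n M (j + q) \<and> raise n M (r q) = \<zero>\<^bsub>M\<^esub>) \<and>
    (\<forall>q. Suc q < n - j \<longrightarrow> lower n M (r (Suc q)) = r q)"
    by (rule lift_row[where prev = "\<lambda>_. \<zero>\<^bsub>M\<^esub>"]) (use s' j zero_comp in auto)
  then obtain r where "r 0 = s" "\<forall>q<n - j. r q \<in> comp_at n M (j + q) \<and> raise n M (r q) = \<zero>\<^bsub>M\<^esub>"
    "\<forall>q. Suc q < n - j \<longrightarrow> lower n M (r (Suc q)) = r q" by blast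
  then show ?case using s' by (intro exI[of _ r]) auto
next
  case (Suc p)
  then obtain r where r: "\<And>q. q < n - j \<Longrightarrow> r q \<in> comp_at n M (j - p + q)" "lower n M (r 0) = \<zero>\<^bsub>M\<^esub>"
    "\<And>q. Suc q < n - j \<Longrightarrow> lower n M (r (Suc q)) = r q" "(raise n M ^^ p) (r 0) = s" by auto
  define d where "d = j - Suc p"
  have d: "1 \<le> d" "d + (n - j) \<le> n" "j - p = Suc d" "d \<in> {1..<n}" using Suc(2) j by (auto simp: d_def)
  have "r 0 \<in> comp_at n M (Suc d)" using r(1)[of 0] j d by simp
  then obtain x0 where x0: "x0 \<in> comp_at n M d" "raise n M x0 = r 0" "lower n M x0 = \<zero>\<^bsub>M\<^esub>"
    using injective_lift[OF inj d(4), of "r 0" "\<zero>\<^bsub>M\<^esub>"] r(2) zero_comp by auto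
  have "\<exists>r'. r' 0 = x0 \<and> (\<forall>q<n - j. r' q \<in> comp_at n M (d + q) \<and> raise n M (r' q) = r q) \<and>
    (\<forall>q. Suc q < n - j \<longrightarrow> lower n M (r' (Suc q)) = r' q)"
    by (rule lift_row) (use x0 d r in auto)
  then obtain r' where r': "r' 0 = x0" "\<forall>q<n - j. r' q \<in> comp_at n M (d + q) \<and> raise n M (r' q) = r q"
    "\<forall>q. Suc q < n - j \<longrightarrow> lower n M (r' (Suc q)) = r' q" by blast
  then have "(raise n M ^^ Suc p) (r' 0) = s" using x0 r(4) by (simp add: funpow_swap1)
  then show ?case using r' x0 by (intro exI[of _ r']) (auto simp: d_def)
qed

lemma exists_shift_to_socle:
  assumes "p < j" "q < n - j" "c + p = j + q"
  shows "\<exists>x\<in>comp_at n M c. shift n M p q x = s"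
proof -
  obtain r where r: "\<And>q. q < n - j \<Longrightarrow> r q \<in> comp_at n M (j - p + q)"
    "\<And>q. Suc q < n - j \<Longrightarrow> lower n M (r (Suc q)) = r q" "(raise n M ^^ p) (r 0) = s"
    using rectangle_rows[OF assms(1)] by blast
  have "(lower n M ^^ q) (r q) = r 0" using assms(2)
  proof (induction q)
    case (Suc q)
    then show ?case using r(2)[of q] by (simp add: funpow_swap1)
  qed simp
  then have "shift n M p q (r q) = s" using r(3) by (simp add: shift_def)
  moreover have "j - p + q = c" using assms by simp
  ultimately show ?thesis using r(1)[OF assms(2)] by blast
qed

end

context preproj_module
begin

text \<open>A proper submodule meets the line of \<open>g\<close> only in zero, so it lies in the largest submodule that
  vanishes at the vertex \<open>c\<close>.\<close>
lemma simple_top_if_cyclic: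
  assumes g: "g \<in> carrier M" "g \<noteq> \<zero>\<^bsub>M\<^esub>" "proj n M c g = g"
    and line: "\<And>x. x \<in> carrier M \<Longrightarrow> \<exists>a. proj n M c x = scale n M a g"
    and gen: "\<And>L. submodule L (preprojective_algebra n) M \<Longrightarrow> g \<in> L \<Longrightarrow> L = carrier M"
  shows "simple_lmod (preprojective_algebra n) (top_lmod (preprojective_algebra n) M)"
proof (rule simple_top_if_largest_proper[OF lmod])
  let ?N = "{x \<in> carrier M. \<forall>f\<in>carrier PA. proj n M c (act n M f x) = \<zero>\<^bsub>M\<^esub>}"
  show "submodule ?N (preprojective_algebra n) M"
  proof (rule submoduleI)
    fix r x assume r: "r \<in> carrier (preprojective_algebra n)" and x: "x \<in> ?N"
    obtain a where a: "a \<in> carrier PA" "\<And>x. r \<odot>\<^bsub>M\<^esub> x = act n M a x" using carrier_PiE[OF r] by blast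
    have "proj n M c (act n M f (act n M a x)) = \<zero>\<^bsub>M\<^esub>" if "f \<in> carrier PA" for f
      using x that a(1) path_algebra_mult_closed[OF that a(1)] mult_act[OF that a(1), of x] by fastforce
    then show "r \<odot>\<^bsub>M\<^esub> x \<in> ?N" using a x by simp
  qed auto
  have "proj n M c (act n M \<one>\<^bsub>PA\<^esub> g) \<noteq> \<zero>\<^bsub>M\<^esub>" using g by (simp add: one_act)
  then have "g \<notin> ?N" using path_algebra_one_closed by blast
  then show "?N \<noteq> carrier M" using g(1) by blast
  fix L assume L: "submodule L (preprojective_algebra n) M" "L \<noteq> carrier M"
  show "L \<subseteq> ?N"
  proof
    fix x assume x: "x \<in> L"
    then have xc: "x \<in> carrier M" using submoduleD(1)[OF L(1)] by blast
    have "proj n M c (act n M f x) = \<zero>\<^bsub>M\<^esub>" if f: "f \<in> carrier PA" for f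
    proof (rule ccontr)
      assume nz: "proj n M c (act n M f x) \<noteq> \<zero>\<^bsub>M\<^esub>"
      obtain a where a: "proj n M c (act n M f x) = scale n M a g" using line[of "act n M f x"] f xc by auto
      have "a \<noteq> 0" using nz a scale_0[OF g(1)] by auto
      have "scale n M a g \<in> L" using preproj_submoduleD[OF L(1)] x f a by (metis generators_closed(1))
      then have "scale n M (1 / a) (scale n M a g) \<in> L" using preproj_submoduleD[OF L(1)] by simp
      then have "g \<in> L" using \<open>a \<noteq> 0\<close> g(1) by (simp add: scale_scale scale_1)
      then show False using gen L by blast
    qed
    then show "x \<in> ?N" using xc by blast
  qed
qed

lemma shape_sub_homogeneous:
  assumes "x \<in> comp_at n M c"
  shows "x \<in> shape_sub n M A \<longleftrightarrow> shift n M (above n A c) (gaps A c) x = \<zero>\<^bsub>M\<^esub>"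
  using assms comp_closed[OF assms] proj_comp[OF assms] by (auto simp: shape_sub_def shift_zero)

end

text \<open>The ribbon between the two diagrams has one cell of each colour \<open>x, \<dots>, y - 1\<close>.\<close>
lemma above_gaps_exchange:
  assumes "A \<subseteq> {1..n}" "x \<in> A" "y \<notin> A" "x < y" "y \<le> n"
  shows "above n (insert y (A - {x})) c = above n A c + (if x \<le> c \<and> c < y then 1 else 0)"
    "gaps (insert y (A - {x})) c = gaps A c + (if x \<le> c \<and> c < y then 1 else 0)"
proof -
  let ?B = "insert y (A - {x})"
  have fin: "finite A" using assms(1) finite_subset by blast
  have B: "?B \<subseteq> {1..n}" using assms by auto
  have "card A = Suc (card (A - {x}))" using assms(2) fin by (metis card_Suc_Diff1)
  then have card: "card ?B = card A" using assms fin by simp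
  consider "c < x" | "x \<le> c" "c < y" | "y \<le> c" by linarith
  then show ab: "above n ?B c = above n A c + (if x \<le> c \<and> c < y then 1 else 0)"
  proof cases
    case 1
    then have eq: "?B \<inter> {c<..n} = insert y ((A \<inter> {c<..n}) - {x})" "x \<in> A \<inter> {c<..n}" "y \<notin> A \<inter> {c<..n}"
      using assms by auto
    have "card (?B \<inter> {c<..n}) = Suc (card ((A \<inter> {c<..n}) - {x}))"
      unfolding eq(1) by (rule card_insert_disjoint) (use eq in auto)
    also have "\<dots> = card (A \<inter> {c<..n})" by (rule card_Suc_Diff1) (use eq in auto)
    finally have "card (?B \<inter> {c<..n}) = card (A \<inter> {c<..n})" .
    then show ?thesis using 1 by (simp add: above_def)
  next
    case 2
    then have "?B \<inter> {c<..n} = insert y (A \<inter> {c<..n})" using assms by auto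
    then show ?thesis using 2 assms(3) by (simp add: above_def)
  next
    case 3
    then have "?B \<inter> {c<..n} = A \<inter> {c<..n}" using assms by auto
    then show ?thesis using 3 by (simp add: above_def)
  qed
  show "gaps ?B c = gaps A c + (if x \<le> c \<and> c < y then 1 else 0)"
    using card_above_gaps[OF assms(1), of c] card_above_gaps[OF B, of c] ab card by simp
qed

context injective_simple_socle_module
begin

text \<open>The corner of the hook has colour \<open>c\<^sub>0\<close>, the last position with a horizontal step between \<open>x\<close> and \<open>y\<close> (or
  \<open>x\<close> itself). An element \<open>g\<close> of \<open>M\<close> over this cell reaches the cells of larger colour by \<open>U\<close> and the
  cells of smaller colour by \<open>D\<close>, since it is still mapped to the socle generator by the smaller powers
  that define the inner diagram. The quotient is one-dimensional in each colour, so \<open>g\<close> generates it.\<close>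
lemma ribbon_simple_top:
  assumes A: "A \<subseteq> {1..n}" "card A = j" and xy: "x \<in> A" "y \<notin> A" "x < y" "y \<le> n"
    and hook: "\<And>t t'. x < t \<Longrightarrow> t < t' \<Longrightarrow> t' < y \<Longrightarrow> \<not> (t \<in> A \<and> t' \<notin> A)"
  defines "B \<equiv> insert y (A - {x})"
  shows "simple_lmod (preprojective_algebra n) (top_lmod (preprojective_algebra n)
    (quot_lmod (sub_lmod M (shape_sub n M B)) (shape_sub n M A)))"
proof -
  let ?V = "shape_sub n M B" and ?V' = "shape_sub n M A"
  note ex = above_gaps_exchange[OF A(1) xy, folded B_def]
  have B: "B \<subseteq> {1..n}" "card B = j"
  proof -
    show "B \<subseteq> {1..n}" using A xy by (auto simp: B_def)
    have "finite A" using A(1) finite_subset by blast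
    then show "card B = j" using xy A(2) card_Suc_Diff1[of A x] by (simp add: B_def)
  qed
  have V: "submodule ?V (preprojective_algebra n) M" and V': "submodule ?V' (preprojective_algebra n) M"
    using shape_sub_submodule A(1) B(1) by auto
  have V'V: "?V' \<subseteq> ?V"
  proof
    fix v assume v: "v \<in> ?V'"
    then have vc: "v \<in> carrier M" by (simp add: shape_sub_def)
    have "shift n M (above n B c) (gaps B c) (proj n M c v) = \<zero>\<^bsub>M\<^esub>" for c
    proof (rule shift_mono)
      show "shift n M (above n A c) (gaps A c) (proj n M c v) = \<zero>\<^bsub>M\<^esub>" using v by (simp add: shape_sub_def)
    qed (use vc ex in auto)
    then show "v \<in> ?V" using vc by (simp add: shape_sub_def)
  qed
  define c0 where "c0 = Max (insert x {t. x < t \<and> t < y \<and> t \<notin> A})"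
  have fin: "finite (insert x {t. x < t \<and> t < y \<and> t \<notin> A})" by (simp add: finite_subset[of _ "{..y}"] subset_iff)
  have c0: "x \<le> c0" "c0 < y" "\<And>t. c0 < t \<Longrightarrow> t < y \<Longrightarrow> t \<in> A" "\<And>t. x < t \<Longrightarrow> t \<le> c0 \<Longrightarrow> t \<notin> A"
  proof -
    have mem: "c0 \<in> insert x {t. x < t \<and> t < y \<and> t \<notin> A}" unfolding c0_def by (rule Max_in[OF fin]) simp
    then show "x \<le> c0" "c0 < y" using xy(3) by auto
    show "t \<in> A" if "c0 < t" "t < y" for t
    proof (rule ccontr)
      assume "t \<notin> A"
      then have "t \<in> insert x {t. x < t \<and> t < y \<and> t \<notin> A}" using that \<open>x \<le> c0\<close> by simp
      then have "t \<le> c0" unfolding c0_def by (rule Max_ge[OF fin])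
      then show False using that by simp
    qed
    show "t \<notin> A" if "x < t" "t \<le> c0" for t
      using that mem hook[of t c0] by (cases "t = c0") auto
  qed
  have bal: "c + above n A c = j + gaps A c" for c using card_above_gaps[OF A(1)] A(2) by simp
  have "above n B c0 \<le> j" unfolding above_def using B finite_subset[OF B(1)] card_mono[of B "B \<inter> {c0<..n}"] by auto
  then have p: "above n A c0 < j" using ex(1)[of c0] c0 by simp
  have "gaps B c0 \<le> card ({1..n} - B)" unfolding gaps_def using c0 xy by (intro card_mono) auto
  also have "\<dots> = n - j" using B finite_subset[OF B(1)] by (simp add: card_Diff_subset)
  finally have q: "gaps A c0 < n - j" using ex(2)[of c0] c0 by simp
  obtain g where g: "g \<in> comp_at n M c0" "shift n M (above n A c0) (gaps A c0) g = s"
    using exists_shift_to_socle[OF p q bal] by blast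
  have sk: "raise n M s = \<zero>\<^bsub>M\<^esub>" "lower n M s = \<zero>\<^bsub>M\<^esub>" using killedD[OF s(1)] by auto
  have gc: "g \<in> carrier M" using comp_closed g(1) .
  have "shift n M (above n B c0) (gaps B c0) g = \<zero>\<^bsub>M\<^esub>"
  proof -
    have "shift n M (Suc (above n A c0)) (gaps A c0) g = \<zero>\<^bsub>M\<^esub>" using sk g(2) by (simp flip: raise_shift)
    then show ?thesis by (rule shift_mono[OF gc]) (use ex c0 in auto)
  qed
  then have gV: "g \<in> ?V" using shape_sub_homogeneous[OF g(1)] by simp
  have gV': "g \<notin> ?V'" using shape_sub_homogeneous[OF g(1)] g(2) s(2) by simp
  \<comment> \<open>The quotient is at most one-dimensional at each vertex: applying the powers that define the inner
    diagram maps it injectively to the socle.\<close>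
  have component: "\<exists>a. proj n M c v \<ominus>\<^bsub>M\<^esub> scale n M a h \<in> ?V'"
    if v: "v \<in> ?V" and c: "x \<le> c" "c < y" and h: "h \<in> comp_at n M c" "shift n M (above n A c) (gaps A c) h = s"
    for v c h
  proof -
    have vc: "v \<in> carrier M" using v by (simp add: shape_sub_def)
    let ?z = "shift n M (above n A c) (gaps A c) (proj n M c v)"
    have pv: "proj n M c v \<in> comp_at n M c" using proj_in_comp[OF vc] .
    have "raise n M (lower n M ?z) = shift n M (above n B c) (gaps B c) (proj n M c v)"
      using vc c ex by (simp add: lower_shift raise_shift)
    also have "\<dots> = \<zero>\<^bsub>M\<^esub>" using v by (simp add: shape_sub_def)
    finally obtain a where a: "?z = scale n M a s"
      using socle_line[OF shift_comp[OF pv bal]] by blast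
    have hc: "h \<in> carrier M" using comp_closed h(1) .
    let ?w = "proj n M c v \<ominus>\<^bsub>M\<^esub> scale n M a h"
    have w: "?w \<in> comp_at n M c"
      using vc hc h(1) by (simp add: comp_at_def act_minus proj_proj scale_act[OF generators_closed(1)])
    have "shift n M (above n A c) (gaps A c) ?w = ?z \<oplus>\<^bsub>M\<^esub> scale n M (- 1) (scale n M a s)"
      using vc hc h(2) by (simp add: a_minus_def scale_minus shift_linear)
    also have "\<dots> = \<zero>\<^bsub>M\<^esub>" unfolding a using killedD(1)[OF s(1)] by (simp add: M.r_neg flip: scale_minus)
    finally show ?thesis using shape_sub_homogeneous[OF w] by blast
  qed
  \<comment> \<open>Starting from the corner, \<open>U\<close> and \<open>D\<close> reach every cell of the ribbon.\<close>
  have ladder: "\<exists>h\<in>L. h \<in> comp_at n M c \<and> shift n M (above n A c) (gaps A c) h = s"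
    if L: "submodule L (preprojective_algebra n) M" "g \<in> L" and c: "x \<le> c" "c < y" for L c
  proof (cases "c0 \<le> c")
    case True
    then show ?thesis using c(2)
    proof (induction c rule: dec_induct)
      case base
      then show ?case using L(2) g by blast
    next
      case (step c)
      then obtain h where h: "h \<in> L" "h \<in> comp_at n M c" "shift n M (above n A c) (gaps A c) h = s" by auto
      have "Suc c \<in> A" using c0(3)[of "Suc c"] step by simp
      then have "shift n M (above n A (Suc c)) (gaps A (Suc c)) (raise n M h) = s"
        using h above_Suc[OF A(1), of c] gaps_Suc[of A c] comp_closed[OF h(2)] by (simp add: shift_raise)
      then show ?case using preproj_submoduleD[OF L(1) h(1) generators_closed(2)] raise_comp[OF h(2)] by blast
    qed
  next
    case False
    then have "c \<le> c0" by simp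
    then show ?thesis using c(1)
    proof (induction c rule: inc_induct)
      case base
      then show ?case using L(2) g by blast
    next
      case (step c)
      then obtain h where h: "h \<in> L" "h \<in> comp_at n M (Suc c)"
        "shift n M (above n A (Suc c)) (gaps A (Suc c)) h = s" by auto
      have "Suc c \<notin> A" using c0(4)[of "Suc c"] step by simp
      then have "shift n M (above n A c) (gaps A c) (lower n M h) = s"
        using h above_Suc[OF A(1), of c] gaps_Suc[of A c] by (simp add: shift_lower)
      then show ?case using preproj_submoduleD[OF L(1) h(1) generators_closed(3)] lower_comp[OF h(2)] by blast
    qed
  qed
  have generate: "?V \<subseteq> L" if L: "submodule L (preprojective_algebra n) M" "g \<in> L" "?V' \<subseteq> L" for L
  proof
    fix v assume v: "v \<in> ?V"
    then have vc: "v \<in> carrier M" by (simp add: shape_sub_def)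
    show "v \<in> L"
    proof (rule mem_if_components[OF vc submoduleD(2,3)[OF L(1)]])
      fix c
      show "proj n M c v \<in> L"
      proof (cases "x \<le> c \<and> c < y")
        case True
        then obtain h where h: "h \<in> L" "h \<in> comp_at n M c" "shift n M (above n A c) (gaps A c) h = s"
          using ladder[OF L(1,2)] by blast
        then obtain a where a: "proj n M c v \<ominus>\<^bsub>M\<^esub> scale n M a h \<in> ?V'" using component[OF v] True by blast
        have "scale n M a h \<in> L" using preproj_submoduleD[OF L(1) h(1)] by simp
        moreover have "proj n M c v = (proj n M c v \<ominus>\<^bsub>M\<^esub> scale n M a h) \<oplus>\<^bsub>M\<^esub> scale n M a h"
          using vc comp_closed[OF h(2)] by (simp add: a_minus_def M.a_assoc M.l_neg)
        ultimately show ?thesis using submoduleD(3)[OF L(1)] a L(3) by (metis subsetD)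
      next
        case False
        have "shift n M (above n B c) (gaps B c) (proj n M c v) = \<zero>\<^bsub>M\<^esub>" using v by (simp add: shape_sub_def)
        then have "proj n M c v \<in> ?V'"
          using shape_sub_homogeneous[OF proj_in_comp[OF vc]] ex[of c] False by simp
        then show ?thesis using L(3) by blast
      qed
    qed
  qed
  let ?X = "quot_lmod (sub_lmod M ?V) ?V'"
  interpret S: preproj_module n "sub_lmod M ?V" by (rule preproj_sub[OF V])
  have S': "submodule ?V' (preprojective_algebra n) (sub_lmod M ?V)"
    using submodule_sub_iff[OF lmod V] V' V'V by blast
  interpret X: preproj_module n ?X by (rule S.preproj_quot[OF S'])
  note qs = quot_lmod_simps[OF S.lmod S']
  let ?cl = "\<lambda>v. ?V' +>\<^bsub>sub_lmod M ?V\<^esub> v"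
  have act_cl: "act n ?X f (?cl v) = ?cl (act n M f v)" if "f \<in> carrier PA" "v \<in> ?V" for f v
    using S.act_quot[OF S' that(1), of v] that(2) by simp
  show ?thesis
  proof (rule X.simple_top_if_cyclic)
    show "?cl g \<in> carrier ?X" using gV unfolding qs(1) by simp
    show "?cl g \<noteq> \<zero>\<^bsub>?X\<^esub>" using coset_zero_iff[OF S.lmod S', of g] gV gV' unfolding qs(2) by simp
    show "proj n ?X c0 (?cl g) = ?cl g" using act_cl[OF generators_closed(1) gV] proj_comp[OF g(1)] by simp
    show "\<exists>a. proj n ?X c0 Y = scale n ?X a (?cl g)" if Y: "Y \<in> carrier ?X" for Y
    proof -
      obtain v where v: "v \<in> ?V" "Y = ?cl v" using Y unfolding qs(1) by auto
      obtain a where a: "proj n M c0 v \<ominus>\<^bsub>M\<^esub> scale n M a g \<in> ?V'" using component[OF v(1) c0(1,2) g] by blast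
      have pv: "proj n M c0 v \<in> ?V" "scale n M a g \<in> ?V"
        using preproj_submoduleD[OF V v(1) generators_closed(1)] preproj_submoduleD[OF V gV generators_closed(4)] by auto
      have "\<ominus>\<^bsub>sub_lmod M ?V\<^esub> scale n M a g = \<ominus>\<^bsub>M\<^esub> scale n M a g"
        using S.scale_minus[of "scale n M a g"] scale_minus[of "scale n M a g"] pv(2) gc by simp
      then have "?cl (proj n M c0 v) = ?cl (scale n M a g)"
        using coset_eq_iff[OF S.lmod S', of "proj n M c0 v" "scale n M a g"] pv a by (simp add: a_minus_def)
      then show ?thesis using act_cl[OF generators_closed(1) v(1)] act_cl[OF generators_closed(4) gV] v(2) by metis
    qed
    show "L = carrier ?X" if L: "submodule L (preprojective_algebra n) ?X" "?cl g \<in> L" for L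
    proof -
      let ?L = "{v \<in> carrier (sub_lmod M ?V). ?cl v \<in> L}"
      note pre = submodule_coset_preimage[OF S.lmod S' L(1)]
      have "?V \<subseteq> ?L"
        using pre submodule_sub_iff[OF lmod V] L(2) gV by (intro generate) auto
      then show ?thesis using submoduleD(1)[OF L(1)] unfolding qs(1) by auto
    qed
  qed
qed

end

section \<open>The submodules of a word\<close>

lemma hook_word_append: "hook_word (us @ ws) \<Longrightarrow> hook_word ws"
  by (induction us) auto

lemma hook_word_inversions_persist:
  assumes "hook_word (us @ ws)" "x < y" "word_perm ws y < word_perm ws x"
  shows "word_perm (us @ ws) y < word_perm (us @ ws) x"
  using assms(1)
proof (induction us)
  case (Cons i us)
  let ?v = "word_perm (us @ ws)"
  have IH: "?v y < ?v x" and step: "hook_step ?v i" using Cons by auto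
  have "\<not> (?v y = i \<and> ?v x = Suc i)" using step assms(2) unfolding hook_step_def by fastforce
  then show ?case using IH by (auto simp: word_perm_simps transpose_def)
qed (use assms in simp)

text \<open>The step \<open>c\<close> creates an inversion, which persists until the end of the word. For the word in front
  this means an ascent at \<open>c\<close>, which excludes that \<open>\<sigma>\<^sub>c\<close> removes a cell.\<close>
lemma hook_word_ascent:
  assumes "hook_word (us @ c # ws)"
  shows "word_perm us c < word_perm us (Suc c)"
proof -
  let ?v = "word_perm ws"
  obtain x y where xy: "?v x = c" "?v y = Suc c" using bij_word_perm[of ws] by (metis bij_pointE)
  have "hook_step ?v c" using hook_word_append[OF assms] by simp
  then have "x < y" using xy unfolding hook_step_def by blast
  moreover have "word_perm (c # ws) x = Suc c" "word_perm (c # ws) y = c"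
    using xy by (simp_all add: word_perm_simps)
  ultimately have "word_perm (us @ c # ws) y < word_perm (us @ c # ws) x"
    by (intro hook_word_inversions_persist[OF assms]) auto
  then show ?thesis using \<open>word_perm (c # ws) x = Suc c\<close> \<open>word_perm (c # ws) y = c\<close>
    by (simp add: word_perm_append)
qed

lemma word_perm_range:
  assumes "set ws \<subseteq> {1..<n}"
  shows "word_perm ws x \<in> {1..n} \<longleftrightarrow> x \<in> {1..n}"
proof -
  have "0 \<notin> set ws" "n \<notin> set ws" using assms by auto
  then show ?thesis using word_perm_le_iff[of 0 ws x] word_perm_le_iff[of n ws x] by auto
qed

lemma word_vimage:
  assumes "set ws \<subseteq> {1..<n}" "j \<le> n"
  shows "word_perm ws -` {1..j} \<subseteq> {1..n}" "card (word_perm ws -` {1..j}) = j"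
proof -
  show "word_perm ws -` {1..j} \<subseteq> {1..n}"
  proof
    fix x assume "x \<in> word_perm ws -` {1..j}"
    then have "word_perm ws x \<in> {1..n}" using assms(2) by auto
    then show "x \<in> {1..n}" using word_perm_range[OF assms(1)] by blast
  qed
  show "card (word_perm ws -` {1..j}) = j"
    using card_vimage_inj[OF bij_is_inj[OF bij_word_perm[of ws]], of "{1..j}"] bij_is_surj[OF bij_word_perm[of ws]] by simp
qed

context simple_socle_module
begin

text \<open>The sequence of socles starts with the leftmost letter of the word, so the induction extends the
  word on the right and the set of positions is transformed by the new rightmost letter.\<close>
lemma soc_seq_shape_sub:
  assumes "hook_word us" "set us \<subseteq> {1..<n}"
  shows "soc_seq n M us = shape_sub n M (word_perm us -` {1..j})"
proof -
  have "soc_seq n M us = shape_sub n M (word_perm us -` {1..j})" if "hook_word (us @ vs)" "set us \<subseteq> {1..<n}" for us vs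
    using that
  proof (induction us arbitrary: vs rule: rev_induct)
    case Nil
    show ?case using shape_sub_initial by (simp add: soc_seq_def word_perm_simps)
  next
    case (snoc c us)
    let ?A = "word_perm us -` {1..j}"
    have IH: "soc_seq n M us = shape_sub n M ?A" using snoc(1)[of "c # vs"] snoc(2,3) by simp
    have c: "1 \<le> c" "c < n" and us: "set us \<subseteq> {1..<n}" using snoc(3) by auto
    have A: "?A \<subseteq> {1..n}" using word_vimage(1)[OF us] j by auto
    have "word_perm us c < word_perm us (Suc c)" using hook_word_ascent[of us c vs] snoc(2) by simp
    moreover have "word_perm us c \<in> {1..n}" using word_perm_range[OF us] c by auto
    ultimately have asc: "c \<in> ?A" if "Suc c \<in> ?A" using that by auto
    have "soc_seq n M (us @ [c]) = soc_preimage n M (shape_sub n M ?A) c"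
      using IH by (simp add: soc_seq_def)
    also have "\<dots> = shape_sub n M (adj_swap c -` ?A)"
      by (rule soc_preimage_shape_sub[OF A c asc])
    also have "adj_swap c -` ?A = word_perm (us @ [c]) -` {1..j}"
      by (simp add: word_perm_append word_perm_simps vimage_comp)
    finally show ?case .
  qed
  from this[of us "[]"] show ?thesis using assms by simp
qed

end

text \<open>Between \<open>k\<^sup>-\<close> and \<open>k\<close> the letter \<open>i\<^sub>k\<close> does not occur, so the set of positions that belongs to \<open>k\<^sup>-\<close> is the one for
  the permutation just before step \<open>k\<close>.\<close>
lemma word_perm_vimage_stable:
  assumes "set us \<subseteq> {1..<n}" "j \<notin> set us"
  shows "word_perm (us @ ws) -` {1..j} = word_perm ws -` {1..j}"
proof -
  have "0 \<notin> set us" using assms(1) by auto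
  then have "word_perm us z \<in> {1..j} \<longleftrightarrow> z \<in> {1..j}" for z
    using word_perm_le_iff[of 0 us z] word_perm_le_iff[OF assms(2), of z] by auto
  then show ?thesis by (auto simp: word_perm_append)
qed

lemma drop_prev_pos:
  assumes k: "1 \<le> k" "k \<le> length ws"
  obtains us where "drop (length ws - k) ws = letter ws k # us @ drop (length ws - prev_pos ws k) ws"
    "letter ws k \<notin> set us" "set us \<subseteq> set ws" "letter ws k \<in> set ws"
proof -
  let ?p = "prev_pos ws k" and ?N = "length ws"
  let ?S = "{0} \<union> {s. 1 \<le> s \<and> s < k \<and> letter ws s = letter ws k}"
  have fin: "finite ?S" by (simp add: finite_subset[of _ "{..k}"] subset_iff)
  have mem: "?p \<in> ?S" unfolding prev_pos_def by (rule Max_in[OF fin]) simp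
  then have pk: "?p < k" using k by auto
  have max: "t \<le> ?p" if "t \<in> ?S" for t unfolding prev_pos_def by (rule Max_ge[OF fin that])
  define us where "us = take (k - 1 - ?p) (drop (Suc (?N - k)) ws)"
  have "drop (?N - k) ws = ws ! (?N - k) # drop (Suc (?N - k)) ws"
    using k by (intro Cons_nth_drop_Suc[symmetric]) auto
  moreover have "drop (Suc (?N - k)) ws = us @ drop (?N - ?p) ws"
  proof -
    have "k - 1 - ?p + Suc (?N - k) = ?N - ?p" using pk k by simp
    then have "drop (k - 1 - ?p) (drop (Suc (?N - k)) ws) = drop (?N - ?p) ws" by (simp only: drop_drop)
    then show ?thesis unfolding us_def by (metis append_take_drop_id)
  qed
  ultimately have "drop (?N - k) ws = letter ws k # us @ drop (?N - ?p) ws" by (simp add: letter_def)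
  moreover have "letter ws k \<notin> set us"
  proof
    assume "letter ws k \<in> set us"
    then obtain i where i: "i < length us" "us ! i = letter ws k" by (auto simp: in_set_conv_nth)
    have ilt: "i < k - 1 - ?p" using i(1) by (simp add: us_def)
    let ?t = "k - 1 - i"
    have "us ! i = ws ! (?N - ?t)"
    proof -
      have "us ! i = ws ! (Suc (?N - k) + i)" using ilt k pk by (simp add: us_def)
      moreover have "Suc (?N - k) + i = ?N - ?t" using ilt k by simp
      ultimately show ?thesis by (simp only:)
    qed
    then have "?t \<in> ?S" using i(2) ilt k by (auto simp: letter_def)
    then show False using max[of ?t] ilt by simp
  qed
  moreover have "set us \<subseteq> set ws" unfolding us_def using set_take_subset set_drop_subset by fast
  moreover have "letter ws k \<in> set ws" using k by (simp add: letter_def)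
  ultimately show ?thesis using that by blast
qed

theorem proposition14p11:
  fixes n m :: nat
    and K :: "nat set"
    and a b :: "nat \<Rightarrow> nat"
    and ws :: "nat list"
    and R :: "nat \<Rightarrow> ((nat list \<Rightarrow> complex) set, 'b) module"
  assumes "n > 1"
    and R: "\<And>j. j \<in> {1..<n} \<Longrightarrow>
          indecomposable_lmod (preprojective_algebra n) (R j) \<and>
          injective_lmod (preprojective_algebra n) (R j) \<and>
          lmod_iso (preprojective_algebra n)
            (sub_lmod (R j) (socle (preprojective_algebra n) (R j))) (simple_at j)"
    and K: "K \<subseteq> {1..<n}"
    and reduced: "is_reduced_word_of n ws
          (longest_elem n (carrier (sym_group n)) \<circ> longest_elem n (parabolic n K))"
    and ws: "ws = concat (map (\<lambda>i. interval_word (a i) (b i)) (rev [1..<Suc m]))"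
    and new: "\<And>i. 1 < i \<Longrightarrow> i \<le> m \<Longrightarrow>
          b i \<notin> (\<Union>j\<in>{1..<i}. set (interval_word (a j) (b j)))"
    and old: "\<And>i. 1 < i \<Longrightarrow> i \<le> m \<Longrightarrow>
          set (interval_word (a i) (b i)) - {b i} \<subseteq> (\<Union>j\<in>{1..<i}. set (interval_word (a j) (b j)))"
    and "1 \<le> k" and "k \<le> length ws"
  shows "simple_lmod (preprojective_algebra n)
           (top_lmod (preprojective_algebra n) (M_mod n R ws k))"
proof -
  have wsn: "set ws \<subseteq> {1..<n}" using reduced by (simp add: is_reduced_word_of_def)
  have "rev_layered 1 n (word_perm ws)"
    using reduced rev_layered_w0_w0K[OF K] by (simp add: is_reduced_word_of_def)
  then have good: "hook_word ws" unfolding ws using hook_word_intervals[OF new] by blast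
  define j where "j = letter ws k"
  define us' where "us' = drop (length ws - prev_pos ws k) ws"
  obtain us where us: "drop (length ws - k) ws = j # us @ us'" "j \<notin> set us" "set us \<subseteq> set ws" "j \<in> set ws"
    using drop_prev_pos[OF \<open>1 \<le> k\<close> \<open>k \<le> length ws\<close>] unfolding j_def us'_def by blast
  have j: "j \<in> {1..<n}" using us(4) wsn by blast
  have "hook_word (drop i ws)" for i
    using good hook_word_append[of "take i ws" "drop i ws"] by (simp only: append_take_drop_id)
  then have goods: "hook_word (j # us @ us')" "hook_word us'" by (metis us(1), simp add: us'_def)
  have us'n: "set us' \<subseteq> {1..<n}" and usn: "set us \<subseteq> {1..<n}"
    using wsn us(3) set_drop_subset unfolding us'_def by fast+
  interpret P: preproj_module n "R j"
    using R[OF j] by (simp add: preproj_module_def injective_lmod_def)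
  obtain s where "s \<in> P.killed_at j" "s \<noteq> \<zero>\<^bsub>R j\<^esub>" "P.killed_at j \<subseteq> P.line s"
    "\<And>d. d \<in> {1..<n} \<Longrightarrow> d \<noteq> j \<Longrightarrow> P.killed_at d = {\<zero>\<^bsub>R j\<^esub>}"
    using P.simple_socle[OF _ j] R[OF j] by blast
  then interpret E: injective_simple_socle_module n "R j" j s
    using R[OF j] j by unfold_locales auto
  let ?v = "word_perm (us @ us')"
  let ?A = "?v -` {1..j}"
  obtain x y where xy: "?v x = j" "?v y = Suc j" using bij_word_perm[of "us @ us'"] by (metis bij_pointE)
  have inj: "?v z = ?v z' \<longleftrightarrow> z = z'" for z z'
    using bij_is_inj[OF bij_word_perm[of "us @ us'"]] by (auto dest: injD)
  have step: "x < y" "\<And>t t'. x < t \<Longrightarrow> t < t' \<Longrightarrow> t' < y \<Longrightarrow> \<not> (?v t < j \<and> Suc j < ?v t')"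
    using goods(1) xy unfolding hook_word.simps hook_step_def by blast+
  have n': "set (us @ us') \<subseteq> {1..<n}" using usn us'n by simp
  have "V_sub n (R j) ws (prev_pos ws k) = shape_sub n (R j) ?A"
    using E.soc_seq_shape_sub[OF goods(2) us'n] word_perm_vimage_stable[OF usn us(2)]
    unfolding V_sub_def us'_def[symmetric] by simp
  moreover have "V_sub n (R j) ws k = shape_sub n (R j) (insert y (?A - {x}))"
  proof -
    have "word_perm (j # us @ us') -` {1..j} = insert y (?A - {x})"
    proof (rule Set.set_eqI)
      fix z
      show "z \<in> word_perm (j # us @ us') -` {1..j} \<longleftrightarrow> z \<in> insert y (?A - {x})"
        using inj[of z x] inj[of z y] xy j by (auto simp: word_perm_simps transpose_def)
    qed
    then show ?thesis using E.soc_seq_shape_sub[OF goods(1)] n' j us(1) unfolding V_sub_def by simp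
  qed
  moreover have "simple_lmod (preprojective_algebra n) (top_lmod (preprojective_algebra n)
    (quot_lmod (sub_lmod (R j) (shape_sub n (R j) (insert y (?A - {x})))) (shape_sub n (R j) ?A)))"
  proof (rule E.ribbon_simple_top)
    show "?A \<subseteq> {1..n}" "card ?A = j" using word_vimage[OF n', of j] j by auto
    show "x \<in> ?A" "y \<notin> ?A" using xy j by auto
    show "y \<le> n" using word_perm_range[OF n', of y] xy j by auto
    show "\<not> (t \<in> ?A \<and> t' \<notin> ?A)" if "x < t" "t < t'" "t' < y" for t t'
    proof
      assume h: "t \<in> ?A \<and> t' \<notin> ?A"
      have "t' \<in> {1..n}" using that \<open>y \<le> n\<close> by auto
      then have "?v t' \<in> {1..n}" using word_perm_range[OF n'] by blast
      then have "j < ?v t'" "?v t \<le> j" using h by auto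
      moreover have "?v t \<noteq> j" "?v t' \<noteq> Suc j" using inj[of t x] inj[of t' y] xy that by auto
      ultimately show False using step(2)[OF that] by auto
    qed
  qed (rule step(1))
  ultimately show ?thesis unfolding M_mod_def j_def[symmetric] Let_def by simp
qed

end
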